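(* Assume that the stochastic game $\Gamma=(X,A,B,g,l)$ satisfies (H1)–(H7) of the context. Then for every initial distribution $u\in\Delta_f(X)$: (1) The game $\Gamma(u)$ has a uniform value $v^*(u)$. (2) Each player can guarantee $v^*(u)$ with a Markov strategy: for every $\varepsilon>0$ there exist $\sigma\in\Sigma^M$, $\tau\in\mathcal T^M$ and $N_0$ such that for all $N\ge N_0$, $\sigma'\in\Sigma$, $\tau'\in\mathcal T$, $$\gamma_N^u(\sigma,\tau')\ge v^*(u)-\varepsilon\quad\text{and}\quad \gamma_N^u(\sigma',\tau)\le v^*(u)+\varepsilon .$$ (3) One has $$v^*(u)=\inf_{n\ge1}\sup_{m\ge0}\tilde v_{m,n}(u)=\sup_{m\ge0}\inf_{n\ge1}\tilde v_{m,n}(u)=\inf_{n\ge1}\sup_{m\ge0}w_{m,n}(u)=\sup_{m\ge0}\inf_{n\ge1}w_{m,n}(u),$$ where $\tilde v_{m,n}(u)=\sup_{\sigma\in\Sigma}\inf_{\tau\in\mathcal T}\gamma_{m,n}^u(\sigma,\tau)=\inf_{\tau\in\mathcal T}\sup_{\sigma\in\Sigma}\gamma_{m,n}^u(\sigma,\tau)$ and $w_{m,n}(u)=\sup_{\sigma\in\Sigma}\inf_{\tau\in\mathcal T}\min_{t\in\{1,\dots,n\}}\gamma_{m,t}^u(\sigma,\tau)$. Moreover, for all $m\ge0$ and $n\ge1$, the maps $\tilde v_{m,n}$ and $w_{m,n}$ are non expansive (1-Lipschitz) on $\Delta_f(X)$ for the Wasserstein distance, and the functions $v_n:X\to\mathbb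 R$, $v_n(p)=\tilde v_{0,n}(\delta_p)$, converge uniformly on $X$ to $p\mapsto v^*(\delta_p)$ as $n\to\infty$.
   Context: Stochastic game (pure strategies). $X,A,B$ are nonempty sets (states, actions of player 1, actions of player 2); $\Delta_f(X)$ is the set of probabilities on $X$ with finite support; $\delta_p$ is the Dirac mass at $p$; $g:X\times A\times B\to[0,1]$ is the payoff of player 1 and $l:X\times A\times B\to\Delta_f(X)$ the transition. For $u\in\Delta_f(X)$, in the zero-sum game $\Gamma(u)$ the state $p_1$ is drawn from $u$; at each stage $t\ge1$ both players know the current state $p_t$ and all past states and actions, they simultaneously choose $a_t\in A$ (player 1) and $b_t\in B$ (player 2), player 1's payoff is $g(p_t,a_t,b_t)$ (player 2's is the opposite), and $p_{t+1}$ is drawn from $l(p_t,a_t,b_t)$. A strategy of player 1 is a sequence $\sigma=(\sigma_t)_{t\ge1}$ of maps $\sigma_t:(X\times A\times B)^{t-1}\times X\to A$; a strategy of player 2 is a sequence $\tau=(\tau_t)_{t\ge1}$ of maps $\tau_t:(X\times A\times B)^{t-1}\times X\to B$. The strategy sets are $\Sigma,\mathcal T$; a strategy is Markov if at each stage it depends only on the current state, and $\Sigma^M,\mathcal T^M$ are the sets of Markov strategies. $\mathbb P_{u,\sigma,\tau}$ is the induced probability on plays. Assumptions. (H1) $l(p,a,b)$ does not depend on $b$; write $l(p,a)$. (H2) $X$ is a compact convex subset of a normed vector space, with $d$ the norm distance on $X$. Notation: $\Delta(X)$ is the set of Borel probabilities on $X$ with the weak* topology, containing $\Delta_f(X)$;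 $E_1$ is the set of 1-Lipschitz functions $X\to\mathbb R$; for $f$ continuous on $X$ and $u\in\Delta(X)$, $\tilde f(u)=u(f)=\int_X f\,du$; the Wasserstein distance is $d(u,v)=\sup_{f\in E_1}|u(f)-v(f)|$; $u\succeq v$ means $u(f)\ge v(f)$ for every concave continuous $f:X\to\mathbb R$. (H3) $A$ and $B$ are compact convex subsets of topological vector spaces. (H4) For all $(p,b)$, $a\mapsto g(p,a,b)$ is concave and upper semi-continuous; for all $(p,a)$, $b\mapsto g(p,a,b)$ is convex and lower semi-continuous. (H5) For $f$ continuous on $X$ and $\alpha\in[0,1]$ let $\Phi(\alpha,f)(p)=\sup_{a\in A}\inf_{b\in B}\big(\alpha g(p,a,b)+(1-\alpha)\tilde f(l(p,a))\big)$. There is a subset $\mathcal D\subset E_1$ containing $\Phi(1,0)$ and such that $\Phi(\alpha,f)\in\mathcal D$ for all $f\in\mathcal D$, $\alpha\in[0,1]$. (H6) For every $p$, $a\mapsto l(p,a)\in\Delta(X)$ is continuous (weak* ) and concave, i.e. $l(p,\lambda a+(1-\lambda)a')\succeq\lambda l(p,a)+(1-\lambda)l(p,a')$ for $\lambda\in[0,1]$. (H7) For every convex combination $p=\sum_{s=1}^S\lambda_sp_s$ in $X$ and $a_1,\dots,a_S\in A$ there is $a\in A$ with $l(p,a)\succeq\sum_s\lambda_sl(p_s,a_s)$ and $\inf_{b\in B}g(p,a,b)\ge\sum_s\lambda_s\inf_{b\in B}g(p_s,a_s,b)$. Payoffs. For $m\ge0,n\ge1$: $\gamma_{m,n}^u(\sigma,\tau)=\mathbb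 E_{\mathbb P_{u,\sigma,\tau}}\big(\frac1n\sum_{t=m+1}^{m+n}g(p_t,a_t,b_t)\big)$ and $\gamma_n^u=\gamma_{0,n}^u$. Uniform value. $\underline v(u)=\sup_{\sigma\in\Sigma}\liminf_n(\inf_{\tau\in\mathcal T}\gamma_n^u(\sigma,\tau))$, $\overline v(u)=\inf_{\tau\in\mathcal T}\limsup_n(\sup_{\sigma\in\Sigma}\gamma_n^u(\sigma,\tau))$; $\Gamma(u)$ has a uniform value if these coincide, and the common quantity is the uniform value. *)

theory Defs
  imports "HOL-Probability.Probability"
begin

text \<open>Topological vector spaces over the reals; no separation axiom is imposed.\<close>

class topological_real_vector = real_vector + topological_ab_group_add +
  assumes tendsto_scaleR_nhds:
    "((\<lambda>z. fst z *\<^sub>R snd z) \<longlongrightarrow> c *\<^sub>R a) (nhds c \<times>\<^sub>F nhds a)"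

definition usc_on :: "'a::topological_space set \<Rightarrow> ('a \<Rightarrow> real) \<Rightarrow> bool" where
  "usc_on S f \<longleftrightarrow> (\<forall>c. openin (top_of_set S) {x \<in> S. f x < c})"

definition lsc_on :: "'a::topological_space set \<Rightarrow> ('a \<Rightarrow> real) \<Rightarrow> bool" where
  "lsc_on S f \<longleftrightarrow> (\<forall>c. openin (top_of_set S) {x \<in> S. c < f x})"


section \<open>Finitely supported probabilities on the state space\<close>

text \<open>
  Functions on \<open>X\<close> are represented by total functions on the ambient space. Their values
  outside \<open>X\<close> are never used: all integrals are taken against laws supported in \<open>X\<close>.
\<close>

definition Delta_f :: "'x set \<Rightarrow> 'x pmf set" where
  "Delta_f X = {u. finite (set_pmf u) \<and> set_pmf u \<subseteq> X}"

text \<open>The real number \<open>u(f)\<close>, i.e. the affine extension of \<open>f\<close> evaluated at \<open>u\<close>.\<close>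

abbreviation lin_ext :: "('x \<Rightarrow> real) \<Rightarrow> 'x pmf \<Rightarrow> real" where
  "lin_ext f u \<equiv> measure_pmf.expectation u f"

text \<open>
  The weak* topology, i.e. the coarsest one making \<open>u \<mapsto> u(f)\<close> continuous for every \<open>f\<close>
  continuous on \<open>X\<close>. Only its trace on \<open>Delta_f X\<close> is needed, since transitions take
  their values there.
\<close>

definition weak_star :: "'x::topological_space set \<Rightarrow> 'x pmf topology" where
  "weak_star X = topology_generated_by
     {{u \<in> Delta_f X. lin_ext f u \<in> U} | f U. continuous_on X f \<and> open U}"

definition E1 :: "'x::metric_space set \<Rightarrow> ('x \<Rightarrow> real) set" where
  "E1 X = {f. 1-lipschitz_on X f}"

definition wasserstein :: "'x::metric_space set \<Rightarrow> 'x pmf \<Rightarrow> 'x pmf \<Rightarrow> real" where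
  "wasserstein X u v = (SUP f\<in>E1 X. \<bar>lin_ext f u - lin_ext f v\<bar>)"

text \<open>\<open>dominates X u v\<close> is the relation written \<open>u \<succeq> v\<close>.\<close>

definition dominates :: "'x::real_normed_vector set \<Rightarrow> 'x pmf \<Rightarrow> 'x pmf \<Rightarrow> bool" where
  "dominates X u v \<longleftrightarrow>
     (\<forall>f. continuous_on X f \<and> concave_on X f \<longrightarrow> lin_ext f u \<ge> lin_ext f v)"

text \<open>
  The transition keeps its third argument \<open>b\<close>; when it does not depend on \<open>b\<close>, the term
  involving \<open>l p a b\<close> below is constant in \<open>b\<close>.
\<close>

definition Phi :: "'a set \<Rightarrow> 'b set \<Rightarrow> ('x \<Rightarrow> 'a \<Rightarrow> 'b \<Rightarrow> real) \<Rightarrow> ('x \<Rightarrow> 'a \<Rightarrow> 'b \<Rightarrow> 'x pmf) \<Rightarrow>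
    real \<Rightarrow> ('x \<Rightarrow> real) \<Rightarrow> 'x \<Rightarrow> real" where
  "Phi A B g l \<alpha> f p =
     (SUP a\<in>A. INF b\<in>B. \<alpha> * g p a b + (1 - \<alpha>) * lin_ext f (l p a b))"


section \<open>Strategies and plays\<close>

text \<open>
  A history lists the past triples (state, action of player 1, action of player 2) in
  chronological order. The sequence of maps indexed by stages \<open>t\<close> is encoded as one
  map on histories of arbitrary length; the stage is \<open>t = length h + 1\<close>. Since players only
  face histories in \<open>X \<times> A \<times> B\<close>, values elsewhere are unconstrained.
\<close>

type_synonym ('x, 'a, 'b, 'c) strategy = "('x \<times> 'a \<times> 'b) list \<Rightarrow> 'x \<Rightarrow> 'c"

definition strategies ::
    "'x set \<Rightarrow> 'a set \<Rightarrow> 'b set \<Rightarrow> 'c set \<Rightarrow> ('x, 'a, 'b, 'c) strategy set" where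
  "strategies X A B C = {\<sigma>. \<forall>h\<in>lists (X \<times> A \<times> B). \<forall>p\<in>X. \<sigma> h p \<in> C}"

text \<open>Markov strategies may depend on the stage, that is, on the length of the history.\<close>

definition markov_strategies ::
    "'x set \<Rightarrow> 'a set \<Rightarrow> 'b set \<Rightarrow> 'c set \<Rightarrow> ('x, 'a, 'b, 'c) strategy set" where
  "markov_strategies X A B C = {\<sigma> \<in> strategies X A B C.
     \<forall>h\<in>lists (X \<times> A \<times> B). \<forall>h'\<in>lists (X \<times> A \<times> B). \<forall>p\<in>X.
       length h = length h' \<longrightarrow> \<sigma> h p = \<sigma> h' p}"

abbreviation "Sigma1 X A B \<equiv> strategies X A B A"
abbreviation "Tau2 X A B \<equiv> strategies X A B B"
abbreviation "Sigma1M X A B \<equiv> markov_strategies X A B A"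
abbreviation "Tau2M X A B \<equiv> markov_strategies X A B B"

text \<open>
  \<open>play l u \<sigma> \<tau> t\<close> is the law of the first \<open>t\<close> triples together with the state of stage
  \<open>t + 1\<close>, i.e. a finite-dimensional marginal of the probability on infinite plays. All
  payoffs considered depend on finitely many stages only.
\<close>

primrec play :: "('x \<Rightarrow> 'a \<Rightarrow> 'b \<Rightarrow> 'x pmf) \<Rightarrow> 'x pmf \<Rightarrow> ('x, 'a, 'b, 'a) strategy \<Rightarrow>
    ('x, 'a, 'b, 'b) strategy \<Rightarrow> nat \<Rightarrow> (('x \<times> 'a \<times> 'b) list \<times> 'x) pmf" where
  "play l u \<sigma> \<tau> 0 = map_pmf (\<lambda>p. ([], p)) u"
| "play l u \<sigma> \<tau> (Suc t) = bind_pmf (play l u \<sigma> \<tau> t)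
     (\<lambda>(h, p). map_pmf (\<lambda>q. (h @ [(p, \<sigma> h p, \<tau> h p)], q)) (l p (\<sigma> h p) (\<tau> h p)))"

definition payoff :: "('x \<Rightarrow> 'a \<Rightarrow> 'b \<Rightarrow> real) \<Rightarrow> ('x \<Rightarrow> 'a \<Rightarrow> 'b \<Rightarrow> 'x pmf) \<Rightarrow> 'x pmf \<Rightarrow>
    nat \<Rightarrow> nat \<Rightarrow> ('x, 'a, 'b, 'a) strategy \<Rightarrow> ('x, 'a, 'b, 'b) strategy \<Rightarrow> real" where
  "payoff g l u m n \<sigma> \<tau> = measure_pmf.expectation (play l u \<sigma> \<tau> (m + n))
     (\<lambda>(h, q). (1 / real n) * (\<Sum>t = m + 1..m + n. case h ! (t - 1) of (p, a, b) \<Rightarrow> g p a b))"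


section \<open>Values\<close>

text \<open>
  Extended reals are used only because \<^const>\<open>liminf\<close> and \<^const>\<open>limsup\<close> require a
  complete lattice; with payoffs in \<open>[0,1]\<close> all these quantities are finite.
\<close>

definition lower_uniform_value :: "'x set \<Rightarrow> 'a set \<Rightarrow> 'b set \<Rightarrow> ('x \<Rightarrow> 'a \<Rightarrow> 'b \<Rightarrow> real) \<Rightarrow>
    ('x \<Rightarrow> 'a \<Rightarrow> 'b \<Rightarrow> 'x pmf) \<Rightarrow> 'x pmf \<Rightarrow> ereal" where
  "lower_uniform_value X A B g l u = (SUP \<sigma>\<in>Sigma1 X A B.
     liminf (\<lambda>n. ereal (INF \<tau>\<in>Tau2 X A B. payoff g l u 0 n \<sigma> \<tau>)))"

definition upper_uniform_value :: "'x set \<Rightarrow> 'a set \<Rightarrow> 'b set \<Rightarrow> ('x \<Rightarrow> 'a \<Rightarrow> 'b \<Rightarrow> real) \<Rightarrow>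
    ('x \<Rightarrow> 'a \<Rightarrow> 'b \<Rightarrow> 'x pmf) \<Rightarrow> 'x pmf \<Rightarrow> ereal" where
  "upper_uniform_value X A B g l u = (INF \<tau>\<in>Tau2 X A B.
     limsup (\<lambda>n. ereal (SUP \<sigma>\<in>Sigma1 X A B. payoff g l u 0 n \<sigma> \<tau>)))"

definition is_uniform_value :: "'x set \<Rightarrow> 'a set \<Rightarrow> 'b set \<Rightarrow> ('x \<Rightarrow> 'a \<Rightarrow> 'b \<Rightarrow> real) \<Rightarrow>
    ('x \<Rightarrow> 'a \<Rightarrow> 'b \<Rightarrow> 'x pmf) \<Rightarrow> 'x pmf \<Rightarrow> real \<Rightarrow> bool" where
  "is_uniform_value X A B g l u v \<longleftrightarrow>
     lower_uniform_value X A B g l u = ereal v \<and> upper_uniform_value X A B g l u = ereal v"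

definition v_tilde :: "'x set \<Rightarrow> 'a set \<Rightarrow> 'b set \<Rightarrow> ('x \<Rightarrow> 'a \<Rightarrow> 'b \<Rightarrow> real) \<Rightarrow>
    ('x \<Rightarrow> 'a \<Rightarrow> 'b \<Rightarrow> 'x pmf) \<Rightarrow> nat \<Rightarrow> nat \<Rightarrow> 'x pmf \<Rightarrow> real" where
  "v_tilde X A B g l m n u =
     (SUP \<sigma>\<in>Sigma1 X A B. INF \<tau>\<in>Tau2 X A B. payoff g l u m n \<sigma> \<tau>)"

definition w_val :: "'x set \<Rightarrow> 'a set \<Rightarrow> 'b set \<Rightarrow> ('x \<Rightarrow> 'a \<Rightarrow> 'b \<Rightarrow> real) \<Rightarrow>
    ('x \<Rightarrow> 'a \<Rightarrow> 'b \<Rightarrow> 'x pmf) \<Rightarrow> nat \<Rightarrow> nat \<Rightarrow> 'x pmf \<Rightarrow> real" where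
  "w_val X A B g l m n u = (SUP \<sigma>\<in>Sigma1 X A B. INF \<tau>\<in>Tau2 X A B.
     Min ((\<lambda>t. payoff g l u m t \<sigma> \<tau>) ` {1..n}))"

end

theory Submission
  imports Defs
begin

text \<open>
  Player 2 does not influence the transitions, so against a known strategy of player 1 nothing
  beats answering each action \<open>a\<close> at state \<open>p\<close> by a minimiser of \<open>g p a\<close>. Player 1 therefore
  faces a decision problem with stage reward \<open>INF b. g p a b\<close>. Playing Markov, he moves the law of
  the current state deterministically: this is a deterministic control problem whose states are the
  laws in \<open>Delta_f X\<close> and whose controls are maps from \<open>X\<close> to \<open>A\<close>. Three facts carry the theorem.
  
  Matching plays (\<open>wasserstein_matched\<close>). If two laws are at Wasserstein distance less than \<open>\<delta>\<close>,
  then the rewards of any play from one of them can be matched from the other, at every stage of a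
  finite horizon simultaneously, with a loss of at most \<open>\<delta>\<close>. The reason is a duality. For weights
  \<open>\<theta> \<ge> 0\<close> let \<open>V n \<theta>\<close> be the value of the problem with payoff \<open>\<Sum>t<n. \<theta> t * reward t\<close>. After
  normalisation it belongs to the stable class of 1-Lipschitz functions, and it is concave, so it
  increases along the order \<open>dominates\<close>. By concavity in the actions the set of reward
  vectors reachable from \<open>u\<close> is convex, up to arbitrarily small errors, and \<open>\<theta> \<mapsto> V n \<theta> u\<close> is
  its support function; hence every vector below all these functionals is nearly reached
  (\<open>reachable_rewards\<close>). The separation argument is a theorem of the alternative for finitely many
  concave-like functions (\<open>concavelike_alternative\<close>). It follows that finite horizon values are
  non expansive, also those of the form \<open>sup inf min\<close>, and that history-dependent strategies earn no
  more than Markov ones even when several averages must be large at once (\<open>w_val_eq\<close>).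
  
  Limit values in the control problem. By compactness of \<open>X\<close>, \<open>Delta_f X\<close> is totally bounded, so up
  to \<open>\<delta>\<close> there are finitely many states. In any long stretch with a good average there is a date
  from which all short averages are good (\<open>good_start\<close>), and total boundedness bounds the
  waiting time before such a date uniformly in the state. This makes the four expressions for the
  limit value agree. Moreover a long good stretch must end its first part in a state whose limit
  value is almost as large (\<open>good_block\<close>), so good blocks can be concatenated, with summable losses,
  into one play whose averages stay near the limit value (\<open>near_optimal_play\<close>). As a Markov
  strategy this play is player 1's guarantee.
  
  Player 2's guarantee (\<open>block_reply\<close>). In the one-stage games defining \<open>V\<close> the minimax equality
  holds (\<open>one_sided_compact_minimax\<close>), so player 2 has nearly optimal Markov strategies for every
  finite horizon. Choosing \<open>n\<close> so that all averages over \<open>n\<close> consecutive stages are at most the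
  limit value up to \<open>\<epsilon>\<close>, he starts afresh an optimal \<open>n\<close>-stage strategy every \<open>n\<close> stages.
\<close>

section \<open>Finite alternatives and a one-sided minimax theorem\<close>

text \<open>
  A weight \<open>\<mu>\<close> works iff it is at least \<open>G z / (G z - F z)\<close> at all points with \<open>G z > 0\<close> and at most
  \<open>- G x / (F x - G x)\<close> at all points with \<open>F x > 0\<close>. If one of the lower bounds exceeded one of the
  upper bounds, a suitable mixture of \<open>x\<close> and \<open>z\<close> would make \<open>F\<close> and \<open>G\<close> positive together.
\<close>

lemma two_concavelike_alternative:
  fixes F G :: "'v \<Rightarrow> real"
  assumes mix: "\<And>x y \<mu>. x \<in> C \<Longrightarrow> y \<in> C \<Longrightarrow> 0 \<le> \<mu> \<Longrightarrow> \<mu> \<le> 1 \<Longrightarrow>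
      \<exists>z\<in>C. F z \<ge> \<mu> * F x + (1 - \<mu>) * F y \<and> G z \<ge> \<mu> * G x + (1 - \<mu>) * G y"
    and no: "\<And>z. z \<in> C \<Longrightarrow> \<not> (F z > 0 \<and> G z > 0)"
  shows "\<exists>\<mu>. 0 \<le> \<mu> \<and> \<mu> \<le> 1 \<and> (\<forall>z\<in>C. \<mu> * F z + (1 - \<mu>) * G z \<le> 0)"
proof -
  define Q where "Q = insert 0 {G z / (G z - F z) | z. z \<in> C \<and> G z > 0}"
  have le1: "q \<le> 1" if "q \<in> Q" for q
  proof -
    consider "q = 0" | x where "x \<in> C" "G x > 0" "q = G x / (G x - F x)"
      using \<open>q \<in> Q\<close> unfolding Q_def by blast
    thus ?thesis
    proof cases
      case (2 x)
      hence "F x \<le> 0" using no by force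
      with 2 show ?thesis by simp
    qed simp
  qed
  have bdd: "bdd_above Q" using le1 by (auto intro!: bdd_aboveI)
  define \<mu> where "\<mu> = Sup Q"
  have "0 \<le> \<mu>" unfolding \<mu>_def by (rule cSup_upper[OF _ bdd]) (simp add: Q_def)
  have "\<mu> \<le> 1" unfolding \<mu>_def by (rule cSup_least) (auto simp: Q_def intro: le1[unfolded Q_def])
  have cross: "G z * F x \<le> G x * F z" if xz: "x \<in> C" "z \<in> C" "F x > 0" "G z > 0" for x z
  proof (rule ccontr)
    assume "\<not> ?thesis"
    hence gt: "G z * F x > G x * F z" by simp
    have Gx: "G x \<le> 0" and Fz: "F z \<le> 0" using no xz by force+
    define s where "s = F x - F z + G z - G x"
    have s: "s > 0" unfolding s_def using xz Gx Fz by linarith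
    have r: "0 \<le> (G z - F z) / s" "(G z - F z) / s \<le> 1"
      using s xz Gx Fz by (auto simp: s_def)
    \<comment> \<open>the weight of \<open>x\<close> for which both mixtures equal \<open>(G z * F x - G x * F z) / s\<close>\<close>
    obtain y where y: "y \<in> C"
      "F y \<ge> (G z - F z) / s * F x + (1 - (G z - F z) / s) * F z"
      "G y \<ge> (G z - F z) / s * G x + (1 - (G z - F z) / s) * G z"
      using mix[OF xz(1,2) r] by blast
    have e: "1 - (G z - F z) / s = (F x - G x) / s" using s by (simp add: field_simps s_def)
    have "(G z - F z) / s * F x + (1 - (G z - F z) / s) * F z = (G z * F x - G x * F z) / s"
      "(G z - F z) / s * G x + (1 - (G z - F z) / s) * G z = (G z * F x - G x * F z) / s"
      unfolding e using s by (simp_all add: field_simps)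
    moreover have "(G z * F x - G x * F z) / s > 0" using gt s by simp
    ultimately show False using no[OF y(1)] y by linarith
  qed
  show ?thesis
  proof (cases "\<exists>x\<in>C. F x > 0")
    case False
    then show ?thesis by (intro exI[of _ 1]) auto
  next
    case True
    have "\<mu> * F z + (1 - \<mu>) * G z \<le> 0" if z: "z \<in> C" for z
    proof -
      consider "F z \<le> 0" "G z \<le> 0" | "G z > 0" | "F z > 0" by linarith
      thus ?thesis
      proof cases
        case 1
        then show ?thesis using \<open>0 \<le> \<mu>\<close> \<open>\<mu> \<le> 1\<close>
          by (smt (verit) mult_nonneg_nonpos)
      next
        case 2
        have F: "F z \<le> 0" using no[OF z] 2 by force
        have "G z / (G z - F z) \<le> \<mu>" unfolding \<mu>_def
          by (rule cSup_upper[OF _ bdd]) (use z 2 in \<open>auto simp: Q_def\<close>)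
        hence "G z \<le> \<mu> * (G z - F z)" using F 2 by (simp add: pos_divide_le_eq)
        thus ?thesis by (simp add: algebra_simps)
      next
        case 3
        have G: "G z \<le> 0" using no[OF z] 3 by force
        have "\<mu> \<le> - G z / (F z - G z)" unfolding \<mu>_def
        proof (rule cSup_least)
          show "Q \<noteq> {}" by (simp add: Q_def)
          fix q assume "q \<in> Q"
          then consider "q = 0" | x where "x \<in> C" "G x > 0" "q = G x / (G x - F x)"
            unfolding Q_def by blast
          thus "q \<le> - G z / (F z - G z)"
          proof cases
            case 1 thus ?thesis using 3 G by (simp add: divide_nonpos_pos)
          next
            case (2 x)
            have "F x \<le> 0" using no 2 by force
            moreover have "G x * F z \<le> G z * F x" using cross[OF z 2(1) 3 2(2)] .
            ultimately have "G x * (F z - G z) \<le> - G z * (G x - F x)" "G x - F x > 0"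
              using 2 by (auto simp: algebra_simps)
            hence "G x * (F z - G z) / (G x - F x) \<le> - G z" by (simp add: pos_divide_le_eq)
            thus ?thesis using 3 G 2 by (intro mult_imp_le_div_pos) auto
          qed
        qed
        moreover have "F z - G z > 0" using 3 G by simp
        ultimately have "\<mu> * (F z - G z) \<le> - G z" by (simp only: pos_le_divide_eq)
        thus ?thesis by (simp add: algebra_simps)
      qed
    qed
    thus ?thesis using \<open>0 \<le> \<mu>\<close> \<open>\<mu> \<le> 1\<close> by blast
  qed
qed

text \<open>
  On the points where a new function \<open>f j\<close> is positive, the functions treated so far satisfy the
  hypothesis and hence admit weights; with these weights they become a single function, and the case
  of two functions finishes the induction. The set \<open>C\<close> will be a set of actions in one application
  and a set of reward vectors in the other.
\<close>

lemma concavelike_alternative: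
  fixes f :: "'i \<Rightarrow> 'v \<Rightarrow> real"
  assumes "finite I" "I \<noteq> {}"
    and "\<And>x y \<mu>. x \<in> C \<Longrightarrow> y \<in> C \<Longrightarrow> 0 \<le> \<mu> \<Longrightarrow> \<mu> \<le> 1 \<Longrightarrow>
      \<exists>z\<in>C. \<forall>i\<in>I. f i z \<ge> \<mu> * f i x + (1 - \<mu>) * f i y"
    and "\<And>z. z \<in> C \<Longrightarrow> \<exists>i\<in>I. f i z \<le> 0"
  shows "\<exists>\<theta>. (\<forall>i\<in>I. \<theta> i \<ge> 0) \<and> sum \<theta> I = 1 \<and> (\<forall>z\<in>C. (\<Sum>i\<in>I. \<theta> i * f i z) \<le> 0)"
  using assms
proof (induction I arbitrary: C rule: finite_ne_induct)
  case (singleton i)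
  then show ?case by (intro exI[of _ "\<lambda>_. 1"]) auto
next
  case (insert j I)
  define C' where "C' = {z\<in>C. f j z > 0}"
  have "\<exists>\<theta>. (\<forall>i\<in>I. \<theta> i \<ge> 0) \<and> sum \<theta> I = 1 \<and> (\<forall>z\<in>C'. (\<Sum>i\<in>I. \<theta> i * f i z) \<le> 0)"
  proof (rule insert.IH)
    fix x y and \<mu> :: real
    assume xy: "x \<in> C'" "y \<in> C'" and \<mu>: "0 \<le> \<mu>" "\<mu> \<le> 1"
    then obtain z where z: "z \<in> C" "\<forall>i\<in>insert j I. f i z \<ge> \<mu> * f i x + (1 - \<mu>) * f i y"
      using insert.prems(1)[of x y \<mu>] by (auto simp: C'_def)
    have "\<mu> * f j x + (1 - \<mu>) * f j y > 0"
    proof (cases "\<mu> = 0")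
      case False
      with xy \<mu> have "\<mu> * f j x > 0" "(1 - \<mu>) * f j y \<ge> 0" by (auto simp: C'_def)
      thus ?thesis by linarith
    qed (use xy in \<open>simp add: C'_def\<close>)
    with z have "z \<in> C'" by (auto simp: C'_def)
    with z show "\<exists>z\<in>C'. \<forall>i\<in>I. f i z \<ge> \<mu> * f i x + (1 - \<mu>) * f i y" by auto
  next
    fix z assume "z \<in> C'"
    with insert.prems(2)[of z] show "\<exists>i\<in>I. f i z \<le> 0" by (auto simp: C'_def)
  qed
  then obtain \<theta> where \<theta>: "\<forall>i\<in>I. \<theta> i \<ge> 0" "sum \<theta> I = 1"
    "\<And>z. z \<in> C' \<Longrightarrow> (\<Sum>i\<in>I. \<theta> i * f i z) \<le> 0" by blast
  define F where "F z = (\<Sum>i\<in>I. \<theta> i * f i z)" for z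
  obtain \<mu> where \<mu>: "0 \<le> \<mu>" "\<mu> \<le> 1" "\<forall>z\<in>C. \<mu> * F z + (1 - \<mu>) * f j z \<le> 0"
  proof (atomize_elim, rule two_concavelike_alternative)
    fix x y and \<mu> :: real
    assume xy: "x \<in> C" "y \<in> C" and \<mu>: "0 \<le> \<mu>" "\<mu> \<le> 1"
    then obtain z where z: "z \<in> C" "\<forall>i\<in>insert j I. f i z \<ge> \<mu> * f i x + (1 - \<mu>) * f i y"
      using insert.prems(1)[of x y \<mu>] by auto
    have "\<mu> * F x + (1 - \<mu>) * F y = (\<Sum>i\<in>I. \<theta> i * (\<mu> * f i x + (1 - \<mu>) * f i y))"
      by (simp add: F_def sum_distrib_left sum.distrib distrib_left mult.left_commute)
    also have "\<dots> \<le> F z" unfolding F_def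
      using z \<theta>(1) by (intro sum_mono mult_left_mono) auto
    finally show "\<exists>z\<in>C. \<mu> * F x + (1 - \<mu>) * F y \<le> F z \<and> \<mu> * f j x + (1 - \<mu>) * f j y \<le> f j z"
      using z by auto
  next
    fix z assume "z \<in> C"
    thus "\<not> (0 < F z \<and> 0 < f j z)" using \<theta>(3)[of z] by (auto simp: F_def C'_def)
  qed
  define \<theta>' where "\<theta>' i = (if i = j then 1 - \<mu> else \<mu> * \<theta> i)" for i
  have sumI: "(\<Sum>i\<in>I. \<theta>' i * h i) = \<mu> * (\<Sum>i\<in>I. \<theta> i * h i)" for h :: "'i \<Rightarrow> real"
  proof -
    have "(\<Sum>i\<in>I. \<theta>' i * h i) = (\<Sum>i\<in>I. \<mu> * (\<theta> i * h i))"
      by (rule sum.cong) (use insert.hyps in \<open>auto simp: \<theta>'_def\<close>)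
    thus ?thesis by (simp add: sum_distrib_left)
  qed
  have "\<forall>i\<in>insert j I. \<theta>' i \<ge> 0" using \<theta> \<mu> by (auto simp: \<theta>'_def)
  moreover have "sum \<theta>' (insert j I) = 1"
    using sumI[of "\<lambda>_. 1"] insert.hyps \<theta>(2) by (simp add: \<theta>'_def)
  moreover have "\<forall>z\<in>C. (\<Sum>i\<in>insert j I. \<theta>' i * f i z) \<le> 0"
    using insert.hyps \<mu>(3) by (auto simp: sumI F_def) (auto simp: \<theta>'_def algebra_simps)
  ultimately show ?case by blast
qed

text \<open>
  Compactness leaves finitely many answers \<open>b\<close> that together keep every \<open>a\<close> below \<open>v\<close>. The
  alternative turns them into a weighted answer good against all \<open>a\<close>, and convexity lets the
  barycentre replace it.
\<close>

lemma one_sided_compact_minimax: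
  fixes f :: "'a::topological_real_vector \<Rightarrow> 'b::real_vector \<Rightarrow> real"
  assumes A: "compact A" "A \<noteq> {}" and convA: "convex A"
    and conc: "\<And>b. b \<in> B \<Longrightarrow> concave_on A (\<lambda>a. f a b)"
    and usc: "\<And>b. b \<in> B \<Longrightarrow> openin (top_of_set A) {a \<in> A. f a b < v}"
    and conv: "\<And>a. a \<in> A \<Longrightarrow> convex_on B (f a)"
    and low: "\<And>a. a \<in> A \<Longrightarrow> \<exists>b\<in>B. f a b < v"
  shows "\<exists>b\<in>B. \<forall>a\<in>A. f a b \<le> v"
proof -
  have "\<forall>b\<in>B. \<exists>U. open U \<and> {a \<in> A. f a b < v} = A \<inter> U"
    using usc by (auto simp: openin_open)
  then obtain U where U: "\<And>b. b \<in> B \<Longrightarrow> open (U b)" "\<And>b. b \<in> B \<Longrightarrow> {a \<in> A. f a b < v} = A \<inter> U b"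
    by metis
  have "A \<subseteq> (\<Union>b\<in>B. U b)" using low U(2) by blast
  then obtain I where I: "I \<subseteq> B" "finite I" "A \<subseteq> (\<Union>b\<in>I. U b)"
    using compactE_image[OF A(1), of B U] U(1) by blast
  have "I \<noteq> {}" using I(3) A(2) by auto
  have "\<exists>\<theta>. (\<forall>b\<in>I. \<theta> b \<ge> 0) \<and> sum \<theta> I = 1 \<and> (\<forall>a\<in>A. (\<Sum>b\<in>I. \<theta> b * (f a b - v)) \<le> 0)"
  proof (rule concavelike_alternative[OF I(2) \<open>I \<noteq> {}\<close>])
    fix x y and \<mu> :: real
    assume xy: "x \<in> A" "y \<in> A" "0 \<le> \<mu>" "\<mu> \<le> 1"
    show "\<exists>z\<in>A. \<forall>b\<in>I. \<mu> * (f x b - v) + (1 - \<mu>) * (f y b - v) \<le> f z b - v"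
    proof (intro bexI[of _ "\<mu> *\<^sub>R x + (1 - \<mu>) *\<^sub>R y"] ballI)
      fix b assume "b \<in> I"
      with I have "concave_on A (\<lambda>a. f a b)" using conc by auto
      hence "f (\<mu> *\<^sub>R x + (1 - \<mu>) *\<^sub>R y) b \<ge> \<mu> * f x b + (1 - \<mu>) * f y b"
        using xy by (simp add: concave_on_iff)
      thus "\<mu> * (f x b - v) + (1 - \<mu>) * (f y b - v) \<le> f (\<mu> *\<^sub>R x + (1 - \<mu>) *\<^sub>R y) b - v"
        by (simp add: algebra_simps)
    qed (use xy convA in \<open>simp add: convex_def\<close>)
  next
    fix a assume "a \<in> A"
    then obtain b where "b \<in> I" "a \<in> U b" using I by auto
    thus "\<exists>b\<in>I. f a b - v \<le> 0" 
      using U(2)[of b] I(1) \<open>a \<in> A\<close> by (intro bexI[of _ b]) force+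
  qed
  then obtain \<theta> where \<theta>: "\<forall>b\<in>I. \<theta> b \<ge> 0" "sum \<theta> I = 1"
    "\<And>a. a \<in> A \<Longrightarrow> (\<Sum>b\<in>I. \<theta> b * (f a b - v)) \<le> 0" by blast
  define b where "b = (\<Sum>b\<in>I. \<theta> b *\<^sub>R b)"
  have convB: "convex B" using conv A(2) convex_on_imp_convex by blast
  have "b \<in> B" unfolding b_def by (rule convex_sum[OF I(2) convB]) (use \<theta> I in auto)
  moreover have "f a b \<le> v" if a: "a \<in> A" for a
  proof -
    have "f a b \<le> (\<Sum>b\<in>I. \<theta> b * f a b)" unfolding b_def
      by (rule convex_on_sum[OF I(2) \<open>I \<noteq> {}\<close> conv[OF a] \<theta>(2)]) (use \<theta> I in auto)
    also have "\<dots> = (\<Sum>b\<in>I. \<theta> b * (f a b - v)) + sum \<theta> I * v"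
      by (simp add: algebra_simps sum_distrib_left sum_subtractf)
    also have "\<dots> \<le> v" using \<theta>(2) \<theta>(3)[OF a] by simp
    finally show ?thesis .
  qed
  ultimately show ?thesis by blast
qed

section \<open>Deterministic control problems\<close>

primrec ctrl_state :: "('z \<Rightarrow> 's \<Rightarrow> 'z) \<Rightarrow> 'z \<Rightarrow> (nat \<Rightarrow> 's) \<Rightarrow> nat \<Rightarrow> 'z" where
  "ctrl_state tr z s 0 = z"
| "ctrl_state tr z s (Suc t) = tr (ctrl_state tr z s t) (s t)"

locale deterministic_control =
  fixes Z :: "'z set" and S :: "'s set" and tr :: "'z \<Rightarrow> 's \<Rightarrow> 'z" and rw :: "'z \<Rightarrow> 's \<Rightarrow> real"
  assumes S_nonempty: "S \<noteq> {}"
    and tr_closed: "z \<in> Z \<Longrightarrow> a \<in> S \<Longrightarrow> tr z a \<in> Z"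
    and rw_range: "z \<in> Z \<Longrightarrow> a \<in> S \<Longrightarrow> 0 \<le> rw z a \<and> rw z a \<le> 1"
begin

definition plays :: "(nat \<Rightarrow> 's) set" where "plays = {s. \<forall>t. s t \<in> S}"

abbreviation "state \<equiv> ctrl_state tr"

definition reward :: "'z \<Rightarrow> (nat \<Rightarrow> 's) \<Rightarrow> nat \<Rightarrow> real" where
  "reward z s t = rw (state z s t) (s t)"

definition avg :: "'z \<Rightarrow> (nat \<Rightarrow> 's) \<Rightarrow> nat \<Rightarrow> nat \<Rightarrow> real" where
  "avg z s m n = (1 / real n) * (\<Sum>t=m..<m+n. reward z s t)"

definition opt_avg :: "nat \<Rightarrow> nat \<Rightarrow> 'z \<Rightarrow> real" where
  "opt_avg m n z = (SUP s\<in>plays. avg z s m n)"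

definition opt_min_avg :: "nat \<Rightarrow> nat \<Rightarrow> 'z \<Rightarrow> real" where
  "opt_min_avg m n z = (SUP s\<in>plays. Min (avg z s m ` {1..n}))"

definition limit_value :: "'z \<Rightarrow> real" where
  "limit_value z = (INF n\<in>{1..}. SUP m. opt_avg m n z)"

text \<open>
  The only form in which a distance between states is used: from \<open>z'\<close> one can do as well as from
  \<open>z\<close> up to \<open>\<delta>\<close>, at each stage and not merely on average, so that all payoff functionals compare.
\<close>

definition matched :: "real \<Rightarrow> 'z \<Rightarrow> 'z \<Rightarrow> bool" where
  "matched \<delta> z z' \<longleftrightarrow>
     (\<forall>s\<in>plays. \<forall>n. \<exists>s'\<in>plays. \<forall>t<n. reward z' s' t \<ge> reward z s t - \<delta>)"

lemma plays_nonempty: "plays \<noteq> {}"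
  using S_nonempty by (auto simp: plays_def)

lemma state_closed: "z \<in> Z \<Longrightarrow> s \<in> plays \<Longrightarrow> state z s t \<in> Z"
  by (induction t) (auto simp: plays_def tr_closed)

lemma reward_range: "z \<in> Z \<Longrightarrow> s \<in> plays \<Longrightarrow> 0 \<le> reward z s t \<and> reward z s t \<le> 1"
  unfolding reward_def using rw_range state_closed by (auto simp: plays_def)

lemma state_cong: "(\<And>i. i < t \<Longrightarrow> s i = s' i) \<Longrightarrow> state z s t = state z s' t"
  by (induction t) auto

lemma state_add: "state z s (m + t) = state (state z s m) (\<lambda>i. s (m + i)) t"
  by (induction t) auto

lemma reward_add: "reward z s (m + t) = reward (state z s m) (\<lambda>i. s (m + i)) t"
  by (simp add: reward_def state_add)

definition splice :: "nat \<Rightarrow> (nat \<Rightarrow> 's) \<Rightarrow> (nat \<Rightarrow> 's) \<Rightarrow> nat \<Rightarrow> 's" where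
  "splice m s s' t = (if t < m then s t else s' (t - m))"

lemma splice_plays: "s \<in> plays \<Longrightarrow> s' \<in> plays \<Longrightarrow> splice m s s' \<in> plays"
  by (auto simp: plays_def splice_def)

lemma shift_plays: "s \<in> plays \<Longrightarrow> (\<lambda>i. s (m + i)) \<in> plays"
  by (auto simp: plays_def)

lemma state_splice: "state z (splice m s s') m = state z s m"
  by (rule state_cong) (auto simp: splice_def)

lemma reward_splice_early: "t < m \<Longrightarrow> reward z (splice m s s') t = reward z s t"
  using state_cong[of t "splice m s s'" s z] by (auto simp: reward_def splice_def)

lemma reward_splice: "reward z (splice m s s') (m + t) = reward (state z s m) s' t"
proof -
  have "(\<lambda>i. splice m s s' (m + i)) = s'" by (auto simp: splice_def)
  thus ?thesis by (simp add: reward_add state_splice)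
qed

lemma sum_shift: "(\<Sum>t=m..<m+n. h t) = (\<Sum>t<n. h (m + t))" for h :: "nat \<Rightarrow> real"
  using sum.shift_bounds_nat_ivl[of h 0 m n] by (simp add: lessThan_atLeast0 add.commute)

lemma avg_alt: "avg z s m n = (\<Sum>t<n. reward z s (m + t)) / real n"
  by (simp add: avg_def sum_shift)

lemma avg_range: "z \<in> Z \<Longrightarrow> s \<in> plays \<Longrightarrow> 0 \<le> avg z s m n \<and> avg z s m n \<le> 1"
proof -
  assume *: "z \<in> Z" "s \<in> plays"
  have "(\<Sum>t<n. reward z s (m + t)) \<le> (\<Sum>t<n. 1)"
    by (rule sum_mono) (use reward_range[OF *] in auto)
  moreover have "(\<Sum>t<n. reward z s (m + t)) \<ge> 0"
    by (rule sum_nonneg) (use reward_range[OF *] in auto)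
  ultimately show ?thesis by (auto simp: avg_alt divide_le_eq)
qed

lemma avg_splice: "avg z (splice m s s') m n = avg (state z s m) s' 0 n"
  by (simp add: avg_alt reward_splice)

lemma avg_shift: "avg z s (m + k) n = avg (state z s m) (\<lambda>i. s (m + i)) k n"
  by (simp add: avg_alt reward_add add.assoc)

lemma avg_mono:
  assumes "\<And>t. t < m + n \<Longrightarrow> reward z' s' t \<ge> reward z s t - \<delta>" "0 \<le> \<delta>"
  shows "avg z' s' m n \<ge> avg z s m n - \<delta>"
proof (cases "n = 0")
  case False
  have "(\<Sum>t<n. reward z' s' (m + t)) \<ge> (\<Sum>t<n. reward z s (m + t) - \<delta>)"
    by (rule sum_mono) (use assms in auto)
  hence "(\<Sum>t<n. reward z' s' (m + t)) / n \<ge> ((\<Sum>t<n. reward z s (m + t)) - n * \<delta>) / n"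
    by (intro divide_right_mono) (auto simp: sum_subtractf)
  thus ?thesis using False by (simp add: avg_alt diff_divide_distrib)
qed (use assms in \<open>simp add: avg_alt\<close>)

lemma avg_le_opt_avg: "z \<in> Z \<Longrightarrow> s \<in> plays \<Longrightarrow> avg z s m n \<le> opt_avg m n z"
  unfolding opt_avg_def using avg_range by (intro cSUP_upper bdd_aboveI2[of _ _ 1]) auto

lemma opt_avg_least: "(\<And>s. s \<in> plays \<Longrightarrow> avg z s m n \<le> c) \<Longrightarrow> opt_avg m n z \<le> c"
  unfolding opt_avg_def using plays_nonempty by (rule cSUP_least)

lemma opt_avg_range: "z \<in> Z \<Longrightarrow> 0 \<le> opt_avg m n z \<and> opt_avg m n z \<le> 1"
  using avg_range avg_le_opt_avg plays_nonempty opt_avg_least[of z m n 1]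
  by (meson ex_in_conv order_trans)

lemma min_avg_ge: "n \<ge> 1 \<Longrightarrow> c \<le> Min (avg z s m ` {1..n}) \<longleftrightarrow> (\<forall>j\<in>{1..n}. c \<le> avg z s m j)"
  by (subst Min_ge_iff) auto

lemma min_avg_le_avg: "n \<ge> 1 \<Longrightarrow> Min (avg z s m ` {1..n}) \<le> avg z s m n"
  by (rule Min_le) auto

lemma min_avg_le_opt_min_avg:
  "z \<in> Z \<Longrightarrow> s \<in> plays \<Longrightarrow> n \<ge> 1 \<Longrightarrow> Min (avg z s m ` {1..n}) \<le> opt_min_avg m n z"
  unfolding opt_min_avg_def
  by (intro cSUP_upper bdd_aboveI2[of _ _ 1])
     (use avg_range min_avg_le_avg order_trans in \<open>blast+\<close>)

lemma opt_min_avg_least: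
  "(\<And>s. s \<in> plays \<Longrightarrow> Min (avg z s m ` {1..n}) \<le> c) \<Longrightarrow> opt_min_avg m n z \<le> c"
  unfolding opt_min_avg_def using plays_nonempty by (rule cSUP_least)

lemma opt_min_avg_le_opt_avg:
  assumes "z \<in> Z" "n \<ge> 1" shows "opt_min_avg m n z \<le> opt_avg m n z"
  using min_avg_le_avg[OF assms(2)] avg_le_opt_avg[OF assms(1)]
  by (intro opt_min_avg_least) (meson order_trans)

lemma opt_min_avg_nonneg: 
  assumes "z \<in> Z" "n \<ge> 1" shows "0 \<le> opt_min_avg m n z"
proof -
  obtain s where "s \<in> plays" using plays_nonempty by auto
  moreover have "0 \<le> Min (avg z s m ` {1..n})"
    using assms avg_range[OF assms(1) \<open>s \<in> plays\<close>] by (subst min_avg_ge) auto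
  ultimately show ?thesis using min_avg_le_opt_min_avg[OF assms(1) _ assms(2)] order_trans by blast
qed

lemma sup_opt_avg_bdd: "z \<in> Z \<Longrightarrow> bdd_above (range (\<lambda>m. opt_avg m n z))"
  using opt_avg_range by (intro bdd_aboveI2[of _ _ 1]) auto

lemma sup_opt_avg_range: "z \<in> Z \<Longrightarrow> 0 \<le> (SUP m. opt_avg m n z) \<and> (SUP m. opt_avg m n z) \<le> 1"
  using opt_avg_range sup_opt_avg_bdd[of z n]
  by (meson UNIV_I UNIV_not_empty cSUP_least cSUP_upper2)

lemma limit_value_bdd: "z \<in> Z \<Longrightarrow> bdd_below ((\<lambda>n. SUP m. opt_avg m n z) ` {1..})"
  using sup_opt_avg_range by (intro bdd_belowI2[of _ 0]) auto

lemma limit_value_le: "z \<in> Z \<Longrightarrow> n \<ge> 1 \<Longrightarrow> limit_value z \<le> (SUP m. opt_avg m n z)"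
  unfolding limit_value_def by (intro cINF_lower limit_value_bdd) auto

lemma limit_value_greatest: "(\<And>n. n \<ge> 1 \<Longrightarrow> c \<le> (SUP m. opt_avg m n z)) \<Longrightarrow> c \<le> limit_value z"
  unfolding limit_value_def by (rule cINF_greatest) auto

lemma limit_value_range: "z \<in> Z \<Longrightarrow> 0 \<le> limit_value z \<and> limit_value z \<le> 1"
  using limit_value_greatest[of 0 z] limit_value_le[of z 1] sup_opt_avg_range[of z]
  by (meson order_refl order_trans)

lemma matched_opt_avg:
  assumes "matched \<delta> z z'" "0 \<le> \<delta>" "z' \<in> Z"
  shows "opt_avg m n z \<le> opt_avg m n z' + \<delta>"
proof (rule opt_avg_least)
  fix s assume "s \<in> plays"
  then obtain s' where s': "s' \<in> plays" "\<forall>t<m+n. reward z' s' t \<ge> reward z s t - \<delta>"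
    using assms(1) unfolding matched_def by blast
  have "avg z' s' m n \<ge> avg z s m n - \<delta>" using s' assms by (intro avg_mono) auto
  thus "avg z s m n \<le> opt_avg m n z' + \<delta>" using avg_le_opt_avg[OF assms(3) s'(1), of m n] by simp
qed

lemma matched_opt_min_avg:
  assumes "matched \<delta> z z'" "0 \<le> \<delta>" "z' \<in> Z" "n \<ge> 1"
  shows "opt_min_avg m n z \<le> opt_min_avg m n z' + \<delta>"
proof (rule opt_min_avg_least)
  fix s assume "s \<in> plays"
  then obtain s' where s': "s' \<in> plays" "\<forall>t<m+n. reward z' s' t \<ge> reward z s t - \<delta>"
    using assms(1) unfolding matched_def by blast
  have j: "Min (avg z s m ` {1..n}) - \<delta> \<le> avg z' s' m j" if "j \<in> {1..n}" for j
  proof -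
    have "avg z s m j - \<delta> \<le> avg z' s' m j" using s' assms that by (intro avg_mono) auto
    moreover have "Min (avg z s m ` {1..n}) \<le> avg z s m j" using that by (intro Min_le) auto
    ultimately show ?thesis by linarith
  qed
  have "Min (avg z s m ` {1..n}) - \<delta> \<le> Min (avg z' s' m ` {1..n})"
    using j min_avg_ge[OF assms(4)] by blast
  thus "Min (avg z s m ` {1..n}) \<le> opt_min_avg m n z' + \<delta>"
    using min_avg_le_opt_min_avg[OF assms(3) s'(1) assms(4), of m] by linarith
qed

lemma matched_limit_value:
  assumes "matched \<delta> z z'" "0 \<le> \<delta>" "z \<in> Z" "z' \<in> Z"
  shows "limit_value z \<le> limit_value z' + \<delta>"
proof -
  have "limit_value z - \<delta> \<le> limit_value z'"
  proof (rule limit_value_greatest)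
    fix n :: nat assume "n \<ge> 1"
    have "(SUP m. opt_avg m n z) \<le> (SUP m. opt_avg m n z') + \<delta>"
      by (intro cSUP_least order_trans[OF matched_opt_avg[OF assms(1,2,4)]] add_right_mono
          cSUP_upper sup_opt_avg_bdd assms) auto
    thus "limit_value z - \<delta> \<le> (SUP m. opt_avg m n z')"
      using limit_value_le[OF assms(3) \<open>n \<ge> 1\<close>] by simp
  qed
  thus ?thesis by simp
qed

text \<open>
  Otherwise the \<open>n\<close> stages could be cut into pieces of length at most \<open>k\<close> whose averages lie below
  the bound, except for a last piece of fewer than \<open>k\<close> stages with rewards at most 1; the total would
  be too small.
\<close>

lemma good_start:
  assumes z: "z \<in> Z" "s \<in> plays" and n: "n \<ge> 1" and k: "k \<ge> 1"
  shows "\<exists>l. \<forall>j\<in>{1..k}. avg z s l j \<ge> avg z s m n - k / n"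
proof (rule ccontr)
  define c where "c = avg z s m n - k / n"
  assume "\<not> ?thesis"
  hence "\<forall>l. \<exists>j\<in>{1..k}. avg z s l j < c" by (auto simp: c_def not_le)
  then obtain J where "\<forall>l. J l \<in> {1..k} \<and> avg z s l (J l) < c" by metis
  hence J: "1 \<le> J l" "J l \<le> k" "avg z s l (J l) < c" for l by auto
  have "c \<ge> 0" using J(3)[of 0] avg_range[OF z, of 0 "J 0"] by linarith
  have "(\<Sum>t<N. reward z s (l + t)) < c * N + k" for N l
  proof (induction N arbitrary: l rule: less_induct)
    case (less N)
    show ?case
    proof (cases "N < k")
      case True
      have "(\<Sum>t<N. reward z s (l + t)) \<le> (\<Sum>t<N. 1)"
        by (rule sum_mono) (use reward_range[OF z] in auto)
      moreover have "c * N \<ge> 0" using \<open>c \<ge> 0\<close> by simp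
      ultimately show ?thesis using True by simp
    next
      case False
      define j where "j = J l"
      have j: "1 \<le> j" "j \<le> N" using J(1)[of l] J(2)[of l] False by (auto simp: j_def)
      have "(\<Sum>t<N. reward z s (l + t)) = (\<Sum>t<j. reward z s (l + t)) + (\<Sum>t=j..<j + (N - j). reward z s (l + t))"
        using j sum.atLeastLessThan_concat[of 0 j N "\<lambda>t. reward z s (l + t)"]
        by (simp add: lessThan_atLeast0)
      also have "(\<Sum>t=j..<j + (N - j). reward z s (l + t)) = (\<Sum>t<N - j. reward z s ((l + j) + t))"
        by (subst sum_shift) (simp add: add.assoc)
      also have "\<dots> < c * (N - j) + k" using less.IH[of "N - j" "l + j"] j by simp
      also have "(\<Sum>t<j. reward z s (l + t)) < c * j"
        using J(3)[of l] j by (simp add: avg_alt divide_less_eq flip: j_def)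
      finally show ?thesis using j by (simp add: of_nat_diff algebra_simps)
    qed
  qed
  from this[where N = n and l = m] have "avg z s m n < (c * n + k) / n"
    using n by (simp add: avg_alt divide_strict_right_mono)
  also have "\<dots> = c + k / n" using n by (simp add: add_divide_distrib)
  finally show False by (simp add: c_def)
qed

text \<open>
  The limit value is at most the supremum of averages over any fixed long window, and a good long
  window contains the start of a good stretch.
\<close>

lemma good_stretch:
  assumes z: "z \<in> Z" and "\<epsilon> > 0"
  shows "\<exists>l. \<exists>s\<in>plays. \<forall>j\<in>{1..k}. avg z s l j \<ge> limit_value z - \<epsilon>"
proof (cases "k = 0")
  case False
  obtain n :: nat where n: "2 * k / \<epsilon> < n" using reals_Archimedean2 by blast
  hence n1: "n \<ge> 1" using assms(2) by (cases n) (auto simp: divide_less_eq)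
  have "limit_value z - \<epsilon> / 4 < (SUP m. opt_avg m n z)"
    using limit_value_le[OF z n1] \<open>\<epsilon> > 0\<close> by simp
  then obtain m where "limit_value z - \<epsilon> / 4 < opt_avg m n z"
    using less_cSUP_iff[OF _ sup_opt_avg_bdd[OF z]] by auto
  then obtain s where s: "s \<in> plays" "limit_value z - \<epsilon> / 4 < avg z s m n"
    using opt_avg_least[of z m n "limit_value z - \<epsilon> / 4"] by force
  obtain l where l: "\<forall>j\<in>{1..k}. avg z s l j \<ge> avg z s m n - k / n"
    using good_start[OF z s(1) n1] False by (metis less_one not_less)
  have "k / n \<le> \<epsilon> / 2" using n n1 \<open>\<epsilon> > 0\<close> by (simp add: field_simps)
  with s l \<open>\<epsilon> > 0\<close> show ?thesis by (intro exI[of _ l] bexI[of _ s]) force+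
qed (use plays_nonempty in auto)

text \<open>
  Some window length \<open>k\<close> has all its averages below the limit value up to \<open>\<epsilon>/2\<close>, and a window
  much longer than \<open>k\<close> cannot do better, as it would contain a good window of length \<open>k\<close>.
\<close>

lemma long_average_le_pointwise:
  assumes z: "z \<in> Z" and "\<epsilon> > 0"
  shows "\<exists>N\<ge>1. \<forall>n\<ge>N. \<forall>m. \<forall>s\<in>plays. avg z s m n \<le> limit_value z + \<epsilon>"
proof -
  have "\<exists>k\<ge>1. (SUP m. opt_avg m k z) < limit_value z + \<epsilon> / 2"
  proof (rule ccontr)
    assume "\<not> ?thesis"
    hence "limit_value z + \<epsilon> / 2 \<le> limit_value z"
      by (intro limit_value_greatest) (auto simp: not_less)
    thus False using \<open>\<epsilon> > 0\<close> by simp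
  qed
  then obtain k :: nat where k: "k \<ge> 1" "(SUP m. opt_avg m k z) < limit_value z + \<epsilon> / 2" by blast
  obtain N :: nat where N: "2 * k / \<epsilon> < N" using reals_Archimedean2 by blast
  hence N1: "N \<ge> 1" using assms(2) by (cases N) (auto simp: divide_less_eq)
  have "avg z s m n \<le> limit_value z + \<epsilon>" if n: "n \<ge> N" and s: "s \<in> plays" for n m s
  proof -
    obtain l where l: "\<forall>j\<in>{1..k}. avg z s l j \<ge> avg z s m n - k / n"
      using good_start[OF z s _ k(1)] n N1 by (meson order_trans)
    have "avg z s m n - k / n \<le> avg z s l k" using l k by auto
    also have "\<dots> \<le> opt_avg l k z" by (rule avg_le_opt_avg[OF z s])
    also have "\<dots> \<le> (SUP m. opt_avg m k z)" by (rule cSUP_upper[OF _ sup_opt_avg_bdd[OF z]]) simp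
    also have "\<dots> < limit_value z + \<epsilon> / 2" by (rule k)
    also have "k / n \<le> k / N" using n N1 by (intro divide_left_mono) auto
    moreover have "k / N \<le> \<epsilon> / 2" using N N1 \<open>\<epsilon> > 0\<close> by (simp add: field_simps)
    ultimately show ?thesis by linarith
  qed
  with N1 show ?thesis by blast
qed

end

text \<open>
  Total boundedness, phrased through \<^term>\<open>deterministic_control.matched\<close>: finitely many classes
  of states, any two states of the same class being matched up to \<open>\<delta>\<close>.
\<close>

locale precompact_control = deterministic_control Z S tr rw
  for Z :: "'z set" and S :: "'s set" and tr rw +
  assumes finite_matching: "\<delta> > 0 \<Longrightarrow>
    \<exists>P. finite P \<and> Z \<subseteq> \<Union>P \<and> (\<forall>K\<in>P. \<forall>z\<in>K \<inter> Z. \<forall>z'\<in>K \<inter> Z. matched \<delta> z z')"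
begin

lemma finite_representatives:
  assumes "\<delta> > 0" "W \<subseteq> Z"
  shows "\<exists>R. finite R \<and> R \<subseteq> W \<and> (\<forall>z\<in>W. \<exists>z'\<in>R. matched \<delta> z z' \<and> matched \<delta> z' z)"
proof -
  obtain P where P: "finite P" "Z \<subseteq> \<Union>P" "\<And>K z z'. K\<in>P \<Longrightarrow> z\<in>K \<inter> Z \<Longrightarrow> z'\<in>K \<inter> Z \<Longrightarrow> matched \<delta> z z'"
    using finite_matching[OF assms(1)] by blast
  define R where "R = (\<lambda>K. SOME z. z \<in> K \<inter> W) ` {K\<in>P. K \<inter> W \<noteq> {}}"
  have sel: "(SOME z. z \<in> K \<inter> W) \<in> K \<inter> W" if "K \<inter> W \<noteq> {}" for K
    using that by (meson ex_in_conv someI_ex)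
  have "finite R" "R \<subseteq> W" using P(1) sel by (auto simp: R_def)
  moreover have "\<exists>z'\<in>R. matched \<delta> z z' \<and> matched \<delta> z' z" if z: "z \<in> W" for z
  proof -
    obtain K where K: "K \<in> P" "z \<in> K" using P(2) z assms(2) by blast
    hence ne: "K \<inter> W \<noteq> {}" using z by auto
    have "(SOME z. z \<in> K \<inter> W) \<in> R" using K ne by (auto simp: R_def)
    thus ?thesis using P(3)[OF K(1)] sel[OF ne] K z assms(2) by blast
  qed
  ultimately show ?thesis by blast
qed

text \<open>
  All states reachable from \<open>z\<close> are matched with finitely many representatives, each of which is
  reached at some fixed date; the latest of these dates bounds the start, whatever the length \<open>k\<close>.
\<close>

lemma good_stretch_bounded_start:
  assumes z: "z \<in> Z" and e: "\<epsilon> > 0"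
  shows "\<exists>M. \<forall>k. \<exists>l\<le>M. \<exists>s\<in>plays. \<forall>j\<in>{1..k}. avg z s l j \<ge> limit_value z - \<epsilon>"
proof -
  define W where "W = {state z s m | s m. s \<in> plays}"
  have "W \<subseteq> Z" using state_closed[OF z] by (auto simp: W_def)
  moreover have "\<epsilon> / 2 > 0" using e by simp
  ultimately obtain R where R: "finite R" "R \<subseteq> W" "\<And>y. y \<in> W \<Longrightarrow> \<exists>y'\<in>R. matched (\<epsilon>/2) y y'"
    using finite_representatives by metis
  have "\<forall>y\<in>R. \<exists>s m. s \<in> plays \<and> y = state z s m" using R(2) unfolding W_def by blast
  then obtain sf mf where sm: "\<And>y. y \<in> R \<Longrightarrow> sf y \<in> plays \<and> y = state z (sf y) (mf y)" by metis
  define M where "M = Max (mf ` R)"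
  show ?thesis
  proof (rule exI[of _ M], intro allI)
    fix k :: nat
    obtain l s where ls: "s \<in> plays" "\<forall>j\<in>{1..k}. avg z s l j \<ge> limit_value z - \<epsilon>/2"
      using good_stretch[OF z, of "\<epsilon>/2" k] e by auto
    have "state z s l \<in> W" using ls by (auto simp: W_def)
    then obtain y where y: "y \<in> R" "matched (\<epsilon>/2) (state z s l) y" using R(3) by blast
    obtain s' where s': "s' \<in> plays"
      "\<forall>t<k. reward y s' t \<ge> reward (state z s l) (\<lambda>i. s (l + i)) t - \<epsilon>/2"
      using y(2) shift_plays[OF ls(1)] unfolding matched_def by blast
    have sp: "splice (mf y) (sf y) s' \<in> plays" using sm[OF y(1)] s' by (intro splice_plays) auto
    have "avg z (splice (mf y) (sf y) s') (mf y) j \<ge> limit_value z - \<epsilon>" if j: "j \<in> {1..k}" for j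
    proof -
      have "avg z (splice (mf y) (sf y) s') (mf y) j = avg y s' 0 j"
        unfolding avg_splice using sm[OF y(1)] by simp
      also have "\<dots> \<ge> avg (state z s l) (\<lambda>i. s (l + i)) 0 j - \<epsilon>/2"
        by (rule avg_mono) (use s' j e in auto)
      also have "avg (state z s l) (\<lambda>i. s (l + i)) 0 j = avg z s l j"
        using avg_shift[of z s l 0 j] by simp
      finally show ?thesis using ls j by force
    qed
    moreover have "mf y \<le> M" unfolding M_def using R(1) y(1) by simp
    ultimately show "\<exists>l\<le>M. \<exists>s\<in>plays. \<forall>j\<in>{1..k}. avg z s l j \<ge> limit_value z - \<epsilon>" using sp by blast
  qed
qed

text \<open>
  The bound of the previous lemma for finitely many representatives serves for all states: a play
  from the representative is copied from \<open>z\<close>, and the limit values differ by at most \<open>\<epsilon>/3\<close>.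
\<close>

lemma good_stretch_uniform_start:
  assumes e: "\<epsilon> > 0"
  shows "\<exists>M. \<forall>z\<in>Z. \<forall>k. \<exists>l\<le>M. \<exists>s\<in>plays. \<forall>j\<in>{1..k}. avg z s l j \<ge> limit_value z - \<epsilon>"
proof -
  have d: "\<epsilon> / 3 > 0" using e by simp
  then obtain R where R: "finite R" "R \<subseteq> Z"
    "\<And>y. y \<in> Z \<Longrightarrow> \<exists>y'\<in>R. matched (\<epsilon>/3) y y' \<and> matched (\<epsilon>/3) y' y"
    using finite_representatives[OF _ order_refl] by metis
  have "\<forall>y\<in>R. \<exists>M. \<forall>k. \<exists>l\<le>M. \<exists>s\<in>plays. \<forall>j\<in>{1..k}. avg y s l j \<ge> limit_value y - \<epsilon>/3"
    using good_stretch_bounded_start[OF _ d] R(2) by blast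
  then obtain Mf where Mf: "\<And>y k. y \<in> R \<Longrightarrow>
      \<exists>l\<le>Mf y. \<exists>s\<in>plays. \<forall>j\<in>{1..k}. avg y s l j \<ge> limit_value y - \<epsilon>/3" by metis
  show ?thesis
  proof (rule exI[of _ "Max (Mf ` R)"], intro ballI allI)
    fix z and k :: nat assume z: "z \<in> Z"
    then obtain y where y: "y \<in> R" "matched (\<epsilon>/3) z y" "matched (\<epsilon>/3) y z" using R(3) by blast
    obtain l s where ls: "l \<le> Mf y" "s \<in> plays" "\<forall>j\<in>{1..k}. avg y s l j \<ge> limit_value y - \<epsilon>/3"
      using Mf[OF y(1)] by blast
    obtain s' where s': "s' \<in> plays" "\<forall>t<l+k. reward z s' t \<ge> reward y s t - \<epsilon>/3"
      using y(3) ls(2) unfolding matched_def by blast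
    have vv: "limit_value z \<le> limit_value y + \<epsilon>/3"
      using matched_limit_value[OF y(2)] z R(2) y(1) d by auto
    have "avg z s' l j \<ge> limit_value z - \<epsilon>" if j: "j \<in> {1..k}" for j
    proof -
      have "avg z s' l j \<ge> avg y s l j - \<epsilon>/3"
        by (rule avg_mono) (use s' j d in auto)
      thus ?thesis using ls(3) j vv by force
    qed
    moreover have "l \<le> Max (Mf ` R)"
      using ls(1) R(1) y(1) by (meson Max_ge finite_imageI imageI order_trans)
    ultimately show "\<exists>l\<le>Max (Mf ` R). \<exists>s\<in>plays. \<forall>j\<in>{1..k}. avg z s l j \<ge> limit_value z - \<epsilon>"
      using s' by blast
  qed
qed

lemma long_average_le:
  assumes e: "\<epsilon> > 0"
  shows "\<exists>N\<ge>1. \<forall>z\<in>Z. \<forall>n\<ge>N. \<forall>m. \<forall>s\<in>plays. avg z s m n \<le> limit_value z + \<epsilon>"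
proof -
  have d: "\<epsilon> / 3 > 0" using e by simp
  then obtain R where R: "finite R" "R \<subseteq> Z"
    "\<And>y. y \<in> Z \<Longrightarrow> \<exists>y'\<in>R. matched (\<epsilon>/3) y y' \<and> matched (\<epsilon>/3) y' y"
    using finite_representatives[OF _ order_refl] by metis
  have "\<forall>y\<in>R. \<exists>N. \<forall>n\<ge>N. \<forall>m. \<forall>s\<in>plays. avg y s m n \<le> limit_value y + \<epsilon>/3"
    using long_average_le_pointwise[OF _ d] R(2) by blast
  then obtain Nf where Nf: "\<And>y n m s. y \<in> R \<Longrightarrow> n \<ge> Nf y \<Longrightarrow> s \<in> plays \<Longrightarrow>
      avg y s m n \<le> limit_value y + \<epsilon>/3" by metis
  show ?thesis
  proof (rule exI[of _ "max 1 (Max (Nf ` R))"], intro conjI ballI allI impI)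
    fix z n m s assume z: "z \<in> Z" and n: "max 1 (Max (Nf ` R)) \<le> n" and s: "s \<in> plays"
    then obtain y where y: "y \<in> R" "matched (\<epsilon>/3) z y" "matched (\<epsilon>/3) y z" using R(3) by blast
    obtain s' where s': "s' \<in> plays" "\<forall>t<m+n. reward y s' t \<ge> reward z s t - \<epsilon>/3"
      using y(2) s unfolding matched_def by blast
    have vv: "limit_value y \<le> limit_value z + \<epsilon>/3"
      using matched_limit_value[OF y(3)] z R(2) y(1) d by auto
    have "Nf y \<le> n" using n R(1) y(1) by (meson Max_ge finite_imageI imageI max.boundedE order_trans)
    hence "avg y s' m n \<le> limit_value y + \<epsilon>/3" using Nf[OF y(1) _ s'(1)] by blast
    moreover have "avg y s' m n \<ge> avg z s m n - \<epsilon>/3"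
      by (rule avg_mono) (use s' d in auto)
    ultimately show "avg z s m n \<le> limit_value z + \<epsilon>" using vv by linarith
  qed simp
qed

text \<open>
  Take a good stretch of length \<open>n + q\<close> with \<open>q\<close> much larger than \<open>n\<close>. Its last \<open>q\<close> stages still
  average nearly the limit value of \<open>z\<close>, and by \<open>long_average_le\<close> they cannot average more than the
  limit value of the state reached after the first \<open>n\<close> stages.
\<close>

lemma good_block:
  assumes e: "\<epsilon> > 0"
  shows "\<exists>M. \<forall>z\<in>Z. \<forall>n. \<exists>l\<le>M. \<exists>s\<in>plays. (\<forall>j\<in>{1..n}. avg z s l j \<ge> limit_value z - \<epsilon>) \<and>
           limit_value (state z s (l + n)) \<ge> limit_value z - \<epsilon>"
proof -
  have d: "\<epsilon> / 4 > 0" using e by simp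
  obtain N where N: "N \<ge> 1" "\<And>z n m s. z \<in> Z \<Longrightarrow> n \<ge> N \<Longrightarrow> s \<in> plays \<Longrightarrow> avg z s m n \<le> limit_value z + \<epsilon>/4"
    using long_average_le[OF d] by blast
  obtain M where M: "\<And>z k. z \<in> Z \<Longrightarrow>
      \<exists>l\<le>M. \<exists>s\<in>plays. \<forall>j\<in>{1..k}. avg z s l j \<ge> limit_value z - \<epsilon>/4"
    using good_stretch_uniform_start[OF d] by blast
  show ?thesis
  proof (rule exI[of _ M], intro ballI allI)
    fix z and n :: nat assume z: "z \<in> Z"
    obtain N' :: nat where N': "4 * n / \<epsilon> < N'" using reals_Archimedean2 by blast
    define q where "q = max N N'"
    have q: "q \<ge> 1" "q \<ge> N" "4 * n / \<epsilon> < q" using N(1) N' by (auto simp: q_def)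
    obtain l s where ls: "l \<le> M" "s \<in> plays" "\<forall>j\<in>{1..n+q}. avg z s l j \<ge> limit_value z - \<epsilon>/4"
      using M[OF z] by blast
    define y where "y = state z s (l + n)"
    have y: "y \<in> Z" unfolding y_def by (rule state_closed[OF z ls(2)])
    have "limit_value y \<ge> limit_value z - \<epsilon>"
    proof (cases "limit_value z - \<epsilon>/4 \<ge> 0")
      case True
      define c where "c = limit_value z - \<epsilon>/4"
      have "c \<le> avg z s l (n + q)" using ls(3) q by (auto simp: c_def)
      hence "c * (n + q) \<le> (\<Sum>t<n+q. reward z s (l + t))"
        using q by (simp add: avg_alt le_divide_eq)
      also have "\<dots> = (\<Sum>t<n. reward z s (l + t)) + (\<Sum>t=n..<n+q. reward z s (l + t))"
        using sum.atLeastLessThan_concat[of 0 n "n+q" "\<lambda>t. reward z s (l + t)"]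
        by (simp add: lessThan_atLeast0)
      also have "(\<Sum>t=n..<n+q. reward z s (l + t)) = (\<Sum>t<q. reward z s ((l + n) + t))"
        by (subst sum_shift) (simp add: add.assoc)
      also have "\<dots> = q * avg z s (l + n) q" using q by (simp add: avg_alt)
      also have "avg z s (l + n) q = avg y (\<lambda>i. s (l + n + i)) 0 q"
        using avg_shift[of z s "l + n" 0 q] by (simp add: y_def)
      also have "(\<Sum>t<n. reward z s (l + t)) \<le> (\<Sum>t<n. 1)"
        by (rule sum_mono) (use reward_range[OF z ls(2)] in auto)
      finally have "c * (n + q) \<le> n + q * avg y (\<lambda>i. s (l + n + i)) 0 q" by simp
      also have "\<dots> \<le> n + q * (limit_value y + \<epsilon>/4)"
        using N(2)[OF y q(2) shift_plays[OF ls(2)]] q by (intro add_left_mono mult_left_mono) auto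
      also have "real n \<le> q * (\<epsilon>/4)" using q e by (simp add: field_simps)
      finally have "c * n + c * q \<le> q * (limit_value y + \<epsilon>/2)" by (simp add: algebra_simps)
      moreover have "c * n \<ge> 0" using True by (simp add: c_def)
      ultimately have "q * c \<le> q * (limit_value y + \<epsilon>/2)" by (simp add: mult.commute)
      hence "c \<le> limit_value y + \<epsilon>/2" using q by simp
      thus ?thesis using e by (simp add: c_def)
    next
      case False
      thus ?thesis using limit_value_range[OF y] e by linarith
    qed
    moreover have "avg z s l j \<ge> limit_value z - \<epsilon>" if "j \<in> {1..n}" for j
      using ls(3) that e by force
    ultimately show "\<exists>l\<le>M. \<exists>s\<in>plays. (\<forall>j\<in>{1..n}. avg z s l j \<ge> limit_value z - \<epsilon>) \<and>
           limit_value (state z s (l + n)) \<ge> limit_value z - \<epsilon>"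
      using ls y_def by blast
  qed
qed

end

text \<open>
  Plan \<open>i\<close>, started at \<open>z\<close>, consists of the first \<open>L i z + 1\<close> controls of \<open>s i z\<close>; then plan \<open>i + 1\<close>
  is started at the state reached. Plans are never empty, which makes the recursion on the date
  terminate.
\<close>

function follow_plans :: "('z \<Rightarrow> 's \<Rightarrow> 'z) \<Rightarrow> (nat \<Rightarrow> 'z \<Rightarrow> nat) \<Rightarrow> (nat \<Rightarrow> 'z \<Rightarrow> nat \<Rightarrow> 's) \<Rightarrow>
    nat \<Rightarrow> 'z \<Rightarrow> nat \<Rightarrow> 's" where
  "follow_plans tr L s i z t = (if t \<le> L i z then s i z t
     else follow_plans tr L s (Suc i) (ctrl_state tr z (s i z) (Suc (L i z))) (t - Suc (L i z)))"
  by auto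
termination by (relation "Wellfounded.measure (\<lambda>(tr, L, s, i, z, t). t)") auto

declare follow_plans.simps [simp del]

context precompact_control
begin

lemma follow_plans_splice:
  "follow_plans tr L s i z = splice (Suc (L i z)) (s i z)
     (follow_plans tr L s (Suc i) (state z (s i z) (Suc (L i z))))"
  by (rule ext, subst follow_plans.simps) (auto simp: splice_def)

lemma follow_plans_plays:
  assumes "\<And>i z. z \<in> Z \<Longrightarrow> s i z \<in> plays" "z \<in> Z"
  shows "follow_plans tr L s i z \<in> plays"
proof -
  have "follow_plans tr L s i z t \<in> S" for t
    using assms(2)
  proof (induction t arbitrary: i z rule: less_induct)
    case (less t)
    show ?case
    proof (cases "t \<le> L i z")
      case True
      thus ?thesis using assms(1)[OF less.prems] by (subst follow_plans.simps) (auto simp: plays_def)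
    next
      case False
      have "state z (s i z) (Suc (L i z)) \<in> Z" by (intro state_closed less.prems assms(1))
      from less.IH[OF _ this, of "t - Suc (L i z)" "Suc i"] False
      show ?thesis by (subst follow_plans.simps) auto
    qed
  qed
  thus ?thesis by (auto simp: plays_def)
qed

text \<open>
  Block \<open>i\<close> waits at most \<open>M i\<close> stages, then collects nearly the limit value during \<open>n i\<close> stages and
  loses at most \<open>ei i\<close> of limit value. The losses \<open>ei i = \<eta> / 2 ^ i\<close> are summable, the potential
  \<open>limit_value z - 2 * ei i\<close> does not decrease from block to block, and \<open>n i\<close> is chosen so large that
  the waiting of block \<open>i + 1\<close> is paid by an \<open>\<eta>\<close> per stage of block \<open>i\<close>. Only the first waiting time
  remains, and it vanishes in the average.
\<close>

theorem near_optimal_play: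
  assumes z: "z \<in> Z" and e: "\<epsilon> > 0"
  shows "\<exists>s\<in>plays. \<exists>N0\<ge>1. \<forall>N\<ge>N0. avg z s 0 N \<ge> limit_value z - \<epsilon>"
proof -
  define \<eta> where "\<eta> = \<epsilon> / 4"
  have \<eta>: "\<eta> > 0" using e by (simp add: \<eta>_def)
  define ei where "ei i = \<eta> / 2 ^ i" for i :: nat
  have ei: "ei i > 0" "2 * ei (Suc i) = ei i" for i using \<eta> by (auto simp: ei_def)
  obtain M where M: "\<And>i z n. z \<in> Z \<Longrightarrow> \<exists>l\<le>M i. \<exists>s\<in>plays.
      (\<forall>j\<in>{1..n}. avg z s l j \<ge> limit_value z - ei i) \<and>
      limit_value (state z s (l + n)) \<ge> limit_value z - ei i"
    using good_block[OF ei(1)] by metis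
  have "\<exists>n::nat\<ge>1. n * \<eta> \<ge> M (Suc i)" for i
  proof -
    obtain n :: nat where "M (Suc i) / \<eta> < n" using reals_Archimedean2 by blast
    hence "M (Suc i) < n * \<eta>" using \<eta> by (simp add: divide_less_eq)
    moreover from this have "n \<ge> 1" by (cases n) auto
    ultimately show ?thesis by (intro exI[of _ n]) auto
  qed
  then obtain n :: "nat \<Rightarrow> nat" where n: "\<And>i. n i \<ge> 1" "\<And>i. n i * \<eta> \<ge> M (Suc i)" by metis
  have "\<forall>i z. \<exists>l s. z \<in> Z \<longrightarrow> l \<le> M i \<and> s \<in> plays \<and>
      (\<forall>j\<in>{1..n i}. avg z s l j \<ge> limit_value z - ei i) \<and>
      limit_value (state z s (l + n i)) \<ge> limit_value z - ei i"
    using M by blast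
  then obtain l s where "\<forall>i z. z \<in> Z \<longrightarrow> l i z \<le> M i \<and> s i z \<in> plays \<and>
      (\<forall>j\<in>{1..n i}. avg z (s i z) (l i z) j \<ge> limit_value z - ei i) \<and>
      limit_value (state z (s i z) (l i z + n i)) \<ge> limit_value z - ei i"
    unfolding choice_iff by blast
  hence ls: "l i z \<le> M i" "s i z \<in> plays"
    "j \<in> {1..n i} \<Longrightarrow> avg z (s i z) (l i z) j \<ge> limit_value z - ei i"
    "limit_value (state z (s i z) (l i z + n i)) \<ge> limit_value z - ei i"
    if "z \<in> Z" for i z j using that by blast+
  define L where "L i z = l i z + n i - 1" for i z
  have L: "Suc (L i z) = l i z + n i" for i z using n(1)[of i] by (simp add: L_def)
  define pl where "pl = follow_plans tr L s"
  have pl: "pl i z = splice (l i z + n i) (s i z) (pl (Suc i) (state z (s i z) (l i z + n i)))" for i z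
    unfolding pl_def by (subst follow_plans_splice) (simp only: L)
  have plp: "pl i z \<in> plays" if "z \<in> Z" for i z
    unfolding pl_def by (rule follow_plans_plays[OF ls(2) that])
  have bound: "(\<Sum>t<T. reward z (pl i z) t) \<ge> (limit_value z - 2 * ei i - \<eta>) * T - M i" if "z \<in> Z" for i z T
    using that
  proof (induction T arbitrary: i z rule: less_induct)
    case (less T)
    note z = less.prems
    define C where "C = limit_value z - 2 * ei i - \<eta>"
    define p where "p = pl i z"
    have rr: "0 \<le> reward z p t" "reward z p t \<le> 1" for t
      using reward_range[OF z plp[OF z]] by (auto simp: p_def)
    have nn: "(\<Sum>t\<in>Q. reward z p t) \<ge> 0" for Q by (rule sum_nonneg) (use rr in auto)
    have C1: "C \<le> 1" using limit_value_range[OF z] ei(1)[of i] \<eta> by (simp add: C_def)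
    have good: "(\<Sum>t<l i z + j. reward z p t) \<ge> (limit_value z - ei i) * j" if j: "j \<le> n i" for j
    proof (cases "j = 0")
      case True thus ?thesis using nn by simp
    next
      case False
      have "(\<Sum>t<l i z + j. reward z p t) = (\<Sum>t<l i z. reward z p t) + (\<Sum>t=l i z..<l i z+j. reward z p t)"
        using sum.atLeastLessThan_concat[of 0 "l i z" "l i z + j" "reward z p"] by (simp add: lessThan_atLeast0)
      also have "\<dots> \<ge> (\<Sum>t=l i z..<l i z+j. reward z p t)" using nn[of "{..<l i z}"] by simp
      also have "(\<Sum>t=l i z..<l i z+j. reward z p t) = (\<Sum>t=l i z..<l i z+j. reward z (s i z) t)"
        by (rule sum.cong) (use j in \<open>auto simp: p_def pl[of i z] reward_splice_early\<close>)
      also have "\<dots> = j * avg z (s i z) (l i z) j" using False by (simp add: avg_def)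
      also have "\<dots> \<ge> j * (limit_value z - ei i)"
        using ls(3)[OF z, of j i] False j by (intro mult_left_mono) auto
      finally show ?thesis by (simp add: mult.commute)
    qed
    have lM: "real (l i z) \<le> M i" using ls(1)[OF z, of i] by simp
    show ?case
    proof (cases "C \<le> 0")
      case True
      hence "C * T \<le> 0" by (simp add: mult_nonpos_nonneg)
      thus ?thesis using nn[of "{..<T}"] by (simp add: C_def p_def)
    next
      case C0: False
      have Cl: "C * l i z \<le> M i"
        using mult_right_mono[OF C1, of "real (l i z)"] lM by simp
      consider "T < l i z" | "l i z \<le> T" "T < l i z + n i" | "l i z + n i \<le> T" by linarith
      hence "C * T - M i \<le> (\<Sum>t<T. reward z p t)"
      proof cases
        case 1
        have "C * T \<le> C * l i z" using 1 C0 by (intro mult_left_mono) auto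
        thus ?thesis using Cl nn[of "{..<T}"] by linarith
      next
        case 2
        define j where "j = T - l i z"
        have T: "T = l i z + j" and j: "j \<le> n i" using 2 by (auto simp: j_def)
        have "C * j \<le> (limit_value z - ei i) * j"
          using ei(1)[of i] \<eta> by (intro mult_right_mono) (auto simp: C_def)
        thus ?thesis using good[OF j] Cl T by (simp add: algebra_simps)
      next
        case 3
        define y where "y = state z (s i z) (l i z + n i)"
        define T' where "T' = T - (l i z + n i)"
        have T: "T = (l i z + n i) + T'" using 3 by (simp add: T'_def)
        have y: "y \<in> Z" unfolding y_def by (rule state_closed[OF z ls(2)[OF z]])
        have vy: "limit_value y \<ge> limit_value z - ei i" using ls(4)[OF z] by (simp add: y_def)
        have "T' < T" using T n(1)[of i] by simp
        note IH = less.IH[OF this y, of "Suc i"]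
        have tail: "(\<Sum>t=l i z + n i..<l i z + n i + T'. reward z p t) = (\<Sum>t<T'. reward y (pl (Suc i) y) t)"
          unfolding sum_shift p_def by (subst pl) (simp add: reward_splice y_def)
        have "C * T' \<le> (limit_value y - 2 * ei (Suc i) - \<eta>) * T'"
          using vy ei(2)[of i] by (intro mult_right_mono) (auto simp: C_def)
        hence t2: "C * T' - M (Suc i) \<le> (\<Sum>t=l i z + n i..<l i z + n i + T'. reward z p t)"
          using IH tail by linarith
        have "(C + \<eta>) * n i \<le> (limit_value z - ei i) * n i"
          using ei(1)[of i] by (intro mult_right_mono) (auto simp: C_def)
        also have "\<dots> \<le> (\<Sum>t<l i z + n i. reward z p t)" by (rule good) simp
        finally have t1: "C * n i + M (Suc i) \<le> (\<Sum>t<l i z + n i. reward z p t)"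
          using n(2)[of i] by (simp add: algebra_simps)
        have "(\<Sum>t<T. reward z p t) = (\<Sum>t<l i z + n i. reward z p t) + (\<Sum>t=l i z + n i..<l i z + n i + T'. reward z p t)"
          using sum.atLeastLessThan_concat[of 0 "l i z + n i" "l i z + n i + T'" "reward z p"]
          by (simp add: lessThan_atLeast0 T)
        also have "\<dots> \<ge> C * n i + C * T'" using t1 t2 by linarith
        finally show ?thesis using Cl T by (simp add: algebra_simps)
      qed
      thus ?thesis by (simp add: C_def p_def)
    qed
  qed
  obtain N0 :: nat where N0: "M 0 / \<eta> < N0" using reals_Archimedean2 by blast
  have "avg z (pl 0 z) 0 N \<ge> limit_value z - \<epsilon>" if N: "N \<ge> max 1 N0" for N
  proof -
    have "M 0 / \<eta> < N" using N0 N by linarith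
    hence "M 0 \<le> \<eta> * N" using \<eta> by (simp add: divide_less_eq mult.commute)
    moreover have "(limit_value z - 3 * \<eta>) * N - M 0 \<le> (\<Sum>t<N. reward z (pl 0 z) t)"
      using bound[OF z, of 0 N] by (simp add: ei_def)
    ultimately have "(limit_value z - \<epsilon>) * N \<le> (\<Sum>t<N. reward z (pl 0 z) t)"
      by (simp add: \<eta>_def algebra_simps)
    thus ?thesis using N by (simp add: avg_alt le_divide_eq)
  qed
  thus ?thesis using plp[OF z] by (intro bexI[of _ "pl 0 z"] exI[of _ "max 1 N0"]) auto
qed

lemma opt_min_avg_ge_of_good:
  assumes "z \<in> Z" "s \<in> plays" "n \<ge> 1" "\<And>j. j \<in> {1..n} \<Longrightarrow> avg z s l j \<ge> c"
  shows "opt_min_avg l n z \<ge> c"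
proof -
  have "c \<le> Min (avg z s l ` {1..n})" using assms by (subst min_avg_ge) auto
  thus ?thesis using min_avg_le_opt_min_avg[OF assms(1-3), of l] by simp
qed

text \<open>
  For each length some start below a fixed bound is good, and a start that is good for a length is
  good for all smaller lengths; one of the finitely many starts is good for all lengths.
\<close>

lemma eventually_good_start:
  assumes z: "z \<in> Z" and e: "\<epsilon> > 0"
  shows "\<exists>l. \<forall>n\<ge>1. opt_min_avg l n z \<ge> limit_value z - \<epsilon>"
proof (rule ccontr)
  assume "\<not> ?thesis"
  then obtain k where k: "\<And>l. k l \<ge> 1" "\<And>l. opt_min_avg l (k l) z < limit_value z - \<epsilon>"
    by (metis not_le)
  obtain M where M: "\<And>k. \<exists>l\<le>M. \<exists>s\<in>plays. \<forall>j\<in>{1..k}. avg z s l j \<ge> limit_value z - \<epsilon>"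
    using good_stretch_bounded_start[OF z e] by blast
  define K where "K = Max (k ` {..M})"
  obtain l s where ls: "l \<le> M" "s \<in> plays" "\<And>j. j\<in>{1..K} \<Longrightarrow> avg z s l j \<ge> limit_value z - \<epsilon>"
    using M by blast
  have "k l \<le> K" unfolding K_def using ls(1) by (intro Max_ge) auto
  hence "opt_min_avg l (k l) z \<ge> limit_value z - \<epsilon>"
    using ls k(1) by (intro opt_min_avg_ge_of_good[OF z ls(2)]) auto
  thus False using k(2)[of l] by simp
qed

theorem limit_value_formulas:
  assumes z: "z \<in> Z"
  shows "limit_value z = (SUP m. INF n\<in>{1..}. opt_avg m n z)"
    and "limit_value z = (INF n\<in>{1..}. SUP m. opt_min_avg m n z)"
    and "limit_value z = (SUP m. INF n\<in>{1..}. opt_min_avg m n z)"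
proof -
  have wr: "0 \<le> opt_min_avg m n z" "opt_min_avg m n z \<le> opt_avg m n z" "opt_min_avg m n z \<le> 1"
    if "n \<ge> 1" for m n
    using opt_min_avg_nonneg[OF z that, of m] opt_min_avg_le_opt_avg[OF z that, of m]
      opt_avg_range[OF z, of m n] by linarith+
  have bw: "bdd_below ((\<lambda>n. opt_min_avg m n z) ` {1..})" and bv: "bdd_below ((\<lambda>n. opt_avg m n z) ` {1..})" for m
    using wr opt_avg_range[OF z] by (auto intro!: bdd_belowI2[of _ 0])
  have sw: "bdd_above (range (\<lambda>m. opt_min_avg m n z))" if "n \<ge> 1" for n
    using wr[OF that] by (intro bdd_aboveI2[of _ _ 1])
  have iw1: "(INF n\<in>{1..}. opt_min_avg m n z) \<le> (INF n\<in>{1..}. opt_avg m n z)" for m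
    using wr by (intro cINF_mono[OF _ bw]) (auto intro!: bexI)
  have iv1: "(INF n\<in>{1..}. opt_avg m n z) \<le> 1" for m
    using opt_avg_range[OF z, of m 1] by (intro cINF_lower2[OF bv, of 1]) auto
  have biv: "bdd_above (range (\<lambda>m. INF n\<in>{1..}. opt_avg m n z))"
    and biw: "bdd_above (range (\<lambda>m. INF n\<in>{1..}. opt_min_avg m n z))"
    using iv1 iw1 by (auto intro!: bdd_aboveI2[of _ _ 1] intro: order_trans)
  have a: "limit_value z \<le> (SUP m. INF n\<in>{1..}. opt_min_avg m n z)"
  proof (rule field_le_epsilon)
    fix \<epsilon> :: real assume "\<epsilon> > 0"
    then obtain l where l: "\<forall>n\<ge>1. opt_min_avg l n z \<ge> limit_value z - \<epsilon>"
      using eventually_good_start[OF z] by blast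
    hence "limit_value z - \<epsilon> \<le> (INF n\<in>{1..}. opt_min_avg l n z)" by (intro cINF_greatest) auto
    also have "\<dots> \<le> (SUP m. INF n\<in>{1..}. opt_min_avg m n z)" by (rule cSUP_upper[OF _ biw]) simp
    finally show "limit_value z \<le> (SUP m. INF n\<in>{1..}. opt_min_avg m n z) + \<epsilon>" by simp
  qed
  have b: "(SUP m. INF n\<in>{1..}. opt_min_avg m n z) \<le> (SUP m. INF n\<in>{1..}. opt_avg m n z)"
    by (rule cSUP_mono[OF _ biv]) (use iw1 in auto)
  have c: "(SUP m. INF n\<in>{1..}. opt_avg m n z) \<le> limit_value z"
    by (rule cSUP_least, simp, rule limit_value_greatest)
       (intro cINF_lower2[OF bv] cSUP_upper[OF _ sup_opt_avg_bdd[OF z]] | simp)+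
  have d: "(SUP m. INF n\<in>{1..}. opt_min_avg m n z) \<le> (INF n\<in>{1..}. SUP m. opt_min_avg m n z)"
  proof (rule cSUP_least, simp, rule cINF_greatest, simp)
    fix m k :: nat assume "k \<in> {1..}"
    hence "(INF n\<in>{1..}. opt_min_avg m n z) \<le> opt_min_avg m k z" by (rule cINF_lower[OF bw])
    also have "\<dots> \<le> (SUP m. opt_min_avg m k z)"
      using sw[of k] \<open>k \<in> {1..}\<close> by (intro cSUP_upper) auto
    finally show "(INF n\<in>{1..}. opt_min_avg m n z) \<le> (SUP m. opt_min_avg m k z)" .
  qed
  have bws: "bdd_below ((\<lambda>n. SUP m. opt_min_avg m n z) ` {1..})"
    using wr sw by (intro bdd_belowI2[of _ 0]) (auto intro!: cSUP_upper2)
  have e: "(INF n\<in>{1..}. SUP m. opt_min_avg m n z) \<le> limit_value z"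
  proof (rule limit_value_greatest)
    fix n :: nat assume n: "n \<ge> 1"
    hence "(INF n\<in>{1..}. SUP m. opt_min_avg m n z) \<le> (SUP m. opt_min_avg m n z)"
      by (intro cINF_lower[OF bws]) auto
    also have "\<dots> \<le> (SUP m. opt_avg m n z)"
      by (rule cSUP_mono[OF _ sup_opt_avg_bdd[OF z]]) (use wr(2)[OF n] in auto)
    finally show "(INF n\<in>{1..}. SUP m. opt_min_avg m n z) \<le> (SUP m. opt_avg m n z)" .
  qed
  show "limit_value z = (SUP m. INF n\<in>{1..}. opt_avg m n z)" using a b c by linarith
  show "limit_value z = (INF n\<in>{1..}. SUP m. opt_min_avg m n z)" using a d e by linarith
  show "limit_value z = (SUP m. INF n\<in>{1..}. opt_min_avg m n z)" using a b c by linarith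
qed

text \<open>
  From below, the bounded waiting time before a good stretch is negligible in long averages.
\<close>

theorem opt_avg_uniform_limit:
  "uniform_limit Z (\<lambda>n z. opt_avg 0 n z) limit_value sequentially"
proof (rule uniform_limitI)
  fix \<epsilon> :: real assume e: "\<epsilon> > 0"
  have d: "\<epsilon> / 4 > 0" using e by simp
  obtain N where N: "\<And>z n m s. z \<in> Z \<Longrightarrow> n \<ge> N \<Longrightarrow> s \<in> plays \<Longrightarrow> avg z s m n \<le> limit_value z + \<epsilon>/4"
    using long_average_le[OF d] by blast
  obtain M where M: "\<And>z k. z \<in> Z \<Longrightarrow>
      \<exists>l\<le>M. \<exists>s\<in>plays. \<forall>j\<in>{1..k}. avg z s l j \<ge> limit_value z - \<epsilon>/4"
    using good_stretch_uniform_start[OF d] by blast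
  obtain N' :: nat where N': "4 * M / \<epsilon> < N'" using reals_Archimedean2 by blast
  define N0 where "N0 = Max {N, N', M + 1}"
  have "dist (opt_avg 0 n z) (limit_value z) < \<epsilon>" if n: "n \<ge> N0" and z: "z \<in> Z" for n z
  proof -
    have n': "n \<ge> N" "4 * M / \<epsilon> < n" "M < n" using n N' by (auto simp: N0_def)
    have up: "opt_avg 0 n z \<le> limit_value z + \<epsilon>/4" by (rule opt_avg_least) (rule N[OF z n'(1)])
    obtain l s where ls: "l \<le> M" "s \<in> plays" "\<forall>j\<in>{1..n}. avg z s l j \<ge> limit_value z - \<epsilon>/4"
      using M[OF z] by blast
    define j where "j = n - l"
    have j: "1 \<le> j" "n = l + j" using ls(1) n'(3) by (auto simp: j_def)
    have "limit_value z - \<epsilon>/4 \<le> avg z s l j" using ls(3) j by auto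
    hence "(limit_value z - \<epsilon>/4) * j \<le> (\<Sum>t=l..<l+j. reward z s t)"
      using j by (simp add: avg_def le_divide_eq)
    also have "\<dots> \<le> (\<Sum>t<n. reward z s t)"
      by (rule sum_mono2) (use j reward_range[OF z ls(2)] in auto)
    also have "\<dots> = n * avg z s 0 n" using n'(3) by (simp add: avg_alt)
    also have "\<dots> \<le> n * opt_avg 0 n z" by (intro mult_left_mono avg_le_opt_avg z ls(2)) simp
    finally have 1: "(limit_value z - \<epsilon>/4) * j \<le> n * opt_avg 0 n z" .
    have "(limit_value z - \<epsilon>/4) * l \<le> 1 * real l"
      using limit_value_range[OF z] d by (intro mult_right_mono) auto
    hence "(limit_value z - \<epsilon>/4) * l \<le> real M" using ls(1) by simp
    also have "real M \<le> n * (\<epsilon>/4)" using n'(2) e by (simp add: field_simps)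
    finally have "(limit_value z - \<epsilon>/4) * (real l + real j) \<le> n * opt_avg 0 n z + n * (\<epsilon>/4)"
      using 1 unfolding distrib_left[of "limit_value z - \<epsilon>/4"] by linarith
    moreover have "real l + real j = n" using j(2) by simp
    ultimately have "n * (limit_value z - \<epsilon>/4) \<le> n * (opt_avg 0 n z + \<epsilon>/4)"
      by (simp only: distrib_left mult.commute[of "real n"])
    hence "limit_value z - \<epsilon>/4 \<le> opt_avg 0 n z + \<epsilon>/4" using n'(3) by simp
    thus ?thesis using up e by (simp add: dist_real_def)
  qed
  thus "\<forall>\<^sub>F n in sequentially. \<forall>z\<in>Z. dist (opt_avg 0 n z) (limit_value z) < \<epsilon>"
    unfolding eventually_sequentially by blast
qed

end

section \<open>Finitely supported laws and the Wasserstein distance\<close>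

declare integrable_measure_pmf_finite [simp]

lemma lin_ext_mono:
  assumes "finite (set_pmf u)" "\<And>p. p \<in> set_pmf u \<Longrightarrow> f p \<le> h p"
  shows "lin_ext f u \<le> lin_ext h u"
  using assms by (intro integral_mono_AE) (auto simp: AE_measure_pmf_iff)

lemma lin_ext_cong: "(\<And>p. p \<in> set_pmf u \<Longrightarrow> f p = h p) \<Longrightarrow> lin_ext f u = lin_ext h u"
  by (intro integral_cong_AE) (auto simp: AE_measure_pmf_iff)

lemma lin_ext_const: "lin_ext (\<lambda>_. c) u = (c :: real)"
  by simp

lemma lin_ext_add: "finite (set_pmf u) \<Longrightarrow> lin_ext (\<lambda>p. f p + h p) u = lin_ext f u + lin_ext h u"
  by simp

lemma lin_ext_diff: "finite (set_pmf u) \<Longrightarrow> lin_ext (\<lambda>p. f p - h p) u = lin_ext f u - lin_ext h u"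
  by simp

lemma lin_ext_cmult: "lin_ext (\<lambda>p. c * f p) u = c * lin_ext f u"
  by simp

lemma lin_ext_le: "finite (set_pmf u) \<Longrightarrow> (\<And>p. p \<in> set_pmf u \<Longrightarrow> f p \<le> c) \<Longrightarrow> lin_ext f u \<le> c"
  using lin_ext_mono[of u f "\<lambda>_. c"] by simp

lemma lin_ext_ge: "finite (set_pmf u) \<Longrightarrow> (\<And>p. p \<in> set_pmf u \<Longrightarrow> c \<le> f p) \<Longrightarrow> c \<le> lin_ext f u"
  using lin_ext_mono[of u "\<lambda>_. c" f] by simp

lemma lin_ext_bind:
  assumes "finite (set_pmf u)" "\<And>p. p \<in> set_pmf u \<Longrightarrow> finite (set_pmf (K p))"
  shows "lin_ext f (bind_pmf u K) = lin_ext (\<lambda>p. lin_ext f (K p)) u"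
proof -
  have "lin_ext (\<lambda>p. lin_ext f (K p)) u = (\<Sum>p\<in>set_pmf u. pmf u p *\<^sub>R lin_ext f (K p))"
    by (rule integral_measure_pmf[OF assms(1)])
  thus ?thesis using pmf_expectation_bind[OF assms(1,2) order_refl, where h = f] by simp
qed

lemma lin_ext_map: "lin_ext f (map_pmf h u) = lin_ext (\<lambda>p. f (h p)) u"
  by simp

lemma lin_ext_bernoulli_mixture:
  assumes "0 \<le> r" "r \<le> 1" "finite (set_pmf u)" "finite (set_pmf v)"
  shows "lin_ext f (bind_pmf (bernoulli_pmf r) (\<lambda>c. if c then u else v)) = r * lin_ext f u + (1 - r) * lin_ext f v"
  using assms by (subst lin_ext_bind) auto

lemma cSUP_affine:
  fixes f :: "'i \<Rightarrow> real"
  assumes "I \<noteq> {}" "bdd_above (f ` I)" "0 \<le> c"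
  shows "(SUP i\<in>I. c * f i + d) = c * (SUP i\<in>I. f i) + d"
proof -
  have "(\<lambda>x. c * x + d) (Sup (f ` I)) = (SUP x\<in>f ` I. c * x + d)"
    by (rule continuous_at_Sup_mono)
       (use assms in \<open>auto intro!: monoI mult_left_mono continuous_intros\<close>)
  thus ?thesis by (simp add: image_image)
qed

lemma cINF_affine:
  fixes f :: "'i \<Rightarrow> real"
  assumes "I \<noteq> {}" "bdd_below (f ` I)" "0 \<le> c"
  shows "(INF i\<in>I. c * f i + d) = c * (INF i\<in>I. f i) + d"
proof -
  have "(\<lambda>x. c * x + d) (Inf (f ` I)) = (INF x\<in>f ` I. c * x + d)"
    by (rule continuous_at_Inf_mono)
       (use assms in \<open>auto intro!: monoI mult_left_mono continuous_intros\<close>)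
  thus ?thesis by (simp add: image_image)
qed

lemma Delta_f_finite: "u \<in> Delta_f X \<Longrightarrow> finite (set_pmf u)"
  by (simp add: Delta_f_def)

lemma Delta_f_subset: "u \<in> Delta_f X \<Longrightarrow> p \<in> set_pmf u \<Longrightarrow> p \<in> X"
  by (auto simp: Delta_f_def)

lemma E1_bound:
  fixes X :: "'x::metric_space set"
  assumes "f \<in> E1 X" "p \<in> X" "q \<in> X" shows "\<bar>f p - f q\<bar> \<le> dist p q"
  using assms lipschitz_onD[of 1 X f p q] by (auto simp: E1_def dist_real_def)

lemma wasserstein_bdd:
  fixes X :: "'x::metric_space set"
  assumes "compact X" "u \<in> Delta_f X" "v \<in> Delta_f X"
  shows "bdd_above ((\<lambda>f. \<bar>lin_ext f u - lin_ext f v\<bar>) ` E1 X)"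
proof (rule bdd_aboveI2)
  fix f assume f: "f \<in> E1 X"
  obtain x where "x \<in> set_pmf u" using set_pmf_not_empty[of u] by blast
  hence x: "x \<in> X" by (rule Delta_f_subset[OF assms(2)])
  have *: "\<bar>lin_ext f w - f x\<bar> \<le> diameter X" if w: "w \<in> Delta_f X" for w
  proof -
    have near: "f x - diameter X \<le> f p" "f p \<le> f x + diameter X" if "p \<in> set_pmf w" for p
      using E1_bound[OF f Delta_f_subset[OF w that] x]
        diameter_bounded_bound[OF compact_imp_bounded[OF assms(1)] Delta_f_subset[OF w that] x]
      by linarith+
    have "lin_ext f w \<le> f x + diameter X"
      by (rule lin_ext_le[OF Delta_f_finite[OF w]]) (rule near)
    moreover have "f x - diameter X \<le> lin_ext f w"
      by (rule lin_ext_ge[OF Delta_f_finite[OF w]]) (rule near)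
    ultimately show ?thesis by linarith
  qed
  show "\<bar>lin_ext f u - lin_ext f v\<bar> \<le> 2 * diameter X" using *[OF assms(2)] *[OF assms(3)] by linarith
qed

lemma lin_ext_le_wasserstein:
  fixes X :: "'x::metric_space set"
  assumes "compact X" "u \<in> Delta_f X" "v \<in> Delta_f X" "f \<in> E1 X"
  shows "lin_ext f u - lin_ext f v \<le> wasserstein X u v"
proof -
  have "\<bar>lin_ext f u - lin_ext f v\<bar> \<le> wasserstein X u v"
    unfolding wasserstein_def by (rule cSUP_upper[OF assms(4) wasserstein_bdd[OF assms(1-3)]])
  thus ?thesis by linarith
qed

lemma E1_nonempty: "E1 X \<noteq> {}"
proof -
  have "1-lipschitz_on X (\<lambda>_. 0 :: real)"
    by (rule lipschitz_onI) simp_all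
  hence "(\<lambda>_. 0) \<in> E1 X" by (simp add: E1_def)
  thus ?thesis by fast
qed

lemma wasserstein_least:
  assumes "\<And>f. f \<in> E1 X \<Longrightarrow> \<bar>lin_ext f u - lin_ext f v\<bar> \<le> c"
  shows "wasserstein X u v \<le> c"
  unfolding wasserstein_def by (rule cSUP_least[OF E1_nonempty assms])

lemma wasserstein_nonneg:
  fixes X :: "'x::metric_space set"
  assumes "compact X" "u \<in> Delta_f X" "v \<in> Delta_f X"
  shows "0 \<le> wasserstein X u v"
proof -
  obtain f :: "'x \<Rightarrow> real" where f: "f \<in> E1 X" using E1_nonempty[of X] by blast
  have "\<bar>lin_ext f u - lin_ext f v\<bar> \<le> wasserstein X u v"
    unfolding wasserstein_def by (rule cSUP_upper[OF f wasserstein_bdd[OF assms(1-3)]])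
  thus ?thesis by linarith
qed

text \<open>
  Move every point to a finite net of mesh \<open>\<delta>/4\<close> and round the weights of the net points. Laws
  with the same rounded weights are close, since 1-Lipschitz functions vary by at most the diameter
  of \<open>X\<close>.
\<close>

lemma wasserstein_totally_bounded:
  fixes X :: "'x::metric_space set"
  assumes X: "compact X" and \<delta>: "\<delta> > 0"
  shows "\<exists>P. finite P \<and> Delta_f X \<subseteq> \<Union>P \<and>
     (\<forall>K\<in>P. \<forall>u\<in>K \<inter> Delta_f X. \<forall>v\<in>K \<inter> Delta_f X. wasserstein X u v < \<delta>)"
proof -
  have "\<delta> / 4 > 0" using \<delta> by simp
  then obtain F where F: "finite F" "F \<subseteq> X" "X \<subseteq> (\<Union>x\<in>F. ball x (\<delta>/4))"
    using compactE_image[OF X, of X "\<lambda>x. ball x (\<delta>/4)"] by (metis UN_I centre_in_ball open_ball subsetI)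
  define \<pi> where "\<pi> p = (SOME x. x \<in> F \<and> dist x p < \<delta>/4)" for p
  have \<pi>: "\<pi> p \<in> F" "dist (\<pi> p) p < \<delta>/4" if "p \<in> X" for p
  proof -
    have "\<exists>x. x \<in> F \<and> dist x p < \<delta>/4" using subsetD[OF F(3) that] by (auto simp only: UN_iff mem_ball)
    from someI_ex[OF this] show "\<pi> p \<in> F" "dist (\<pi> p) p < \<delta>/4" by (simp_all add: \<pi>_def)
  qed
  define D where "D = diameter X"
  have D: "D \<ge> 0" unfolding D_def by (rule diameter_ge_0[OF compact_imp_bounded[OF X]])
  \<comment> \<open>rounding errors of \<open>1 / k\<close> on \<open>card F\<close> points cost at most \<open>card F * D / k < \<delta>/4\<close>\<close>
  obtain k :: nat where k: "4 * (card F * D) / \<delta> < k" using reals_Archimedean2 by blast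
  have "4 * (card F * D) / \<delta> \<ge> 0" using D \<delta> by simp
  with k have k0: "real k > 0" by linarith
  define c where "c u = restrict (\<lambda>x. \<lfloor>k * pmf (map_pmf \<pi> u) x\<rfloor>) F" for u
  define P where "P = (\<lambda>h. {u \<in> Delta_f X. c u = h}) ` (F \<rightarrow>\<^sub>E {0..int k})"
  have "finite P" unfolding P_def by (intro finite_imageI finite_PiE F) auto
  moreover have "c u \<in> F \<rightarrow>\<^sub>E {0..int k}" for u
  proof -
    have "0 \<le> \<lfloor>k * pmf (map_pmf \<pi> u) x\<rfloor> \<and> \<lfloor>k * pmf (map_pmf \<pi> u) x\<rfloor> \<le> int k" for x
      using k0 pmf_le_1[of "map_pmf \<pi> u" x] by (simp add: floor_le_iff mult_left_le add.commute add_strict_increasing)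
    thus ?thesis by (auto simp: c_def)
  qed
  hence "Delta_f X \<subseteq> \<Union>P" unfolding P_def by blast
  moreover have "wasserstein X u v < \<delta>" if uv: "u \<in> Delta_f X" "v \<in> Delta_f X" "c u = c v" for u v
  proof -
    have "\<bar>lin_ext f u - lin_ext f v\<bar> \<le> 3 * \<delta> / 4" if f: "f \<in> E1 X" for f
    proof -
      obtain x0 where "x0 \<in> set_pmf u" using set_pmf_not_empty[of u] by blast
      hence x0: "x0 \<in> X" by (rule Delta_f_subset[OF uv(1)])
      have proj: "\<bar>lin_ext f w - lin_ext f (map_pmf \<pi> w)\<bar> \<le> \<delta>/4" if w: "w \<in> Delta_f X" for w
      proof -
        have near: "f (\<pi> p) - \<delta>/4 \<le> f p" "f p \<le> f (\<pi> p) + \<delta>/4" if "p \<in> set_pmf w" for p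
        proof -
          have p: "p \<in> X" by (rule Delta_f_subset[OF w that])
          have "\<bar>f (\<pi> p) - f p\<bar> \<le> dist (\<pi> p) p" using \<pi>(1)[OF p] F(2) p by (intro E1_bound[OF f]) auto
          thus "f (\<pi> p) - \<delta>/4 \<le> f p" "f p \<le> f (\<pi> p) + \<delta>/4" using \<pi>(2)[OF p] by linarith+
        qed
        have "lin_ext f w \<le> lin_ext (\<lambda>p. f (\<pi> p) + \<delta>/4) w"
          by (rule lin_ext_mono[OF Delta_f_finite[OF w]]) (rule near)
        moreover have "lin_ext (\<lambda>p. f (\<pi> p) - \<delta>/4) w \<le> lin_ext f w"
          by (rule lin_ext_mono[OF Delta_f_finite[OF w]]) (rule near)
        ultimately show ?thesis using Delta_f_finite[OF w]
          unfolding lin_ext_map by (simp only: lin_ext_add lin_ext_diff lin_ext_const)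
      qed
      have expand: "lin_ext f (map_pmf \<pi> w) - f x0 = (\<Sum>x\<in>F. pmf (map_pmf \<pi> w) x * (f x - f x0))"
        if w: "w \<in> Delta_f X" for w
      proof -
        have sub: "set_pmf (map_pmf \<pi> w) \<subseteq> F" using \<pi>(1) Delta_f_subset[OF w] by auto
        have "lin_ext f (map_pmf \<pi> w) - f x0 = lin_ext (\<lambda>x. f x - f x0) (map_pmf \<pi> w)"
          using Delta_f_finite[OF w] by simp
        also have "\<dots> = (\<Sum>x\<in>F. pmf (map_pmf \<pi> w) x * (f x - f x0))"
          by (subst integral_measure_pmf_real[OF F(1)]) (use sub in \<open>auto simp: mult.commute\<close>)
        finally show ?thesis .
      qed
      have close: "\<bar>pmf (map_pmf \<pi> u) x - pmf (map_pmf \<pi> v) x\<bar> \<le> 1 / k" if x: "x \<in> F" for x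
      proof -
        have "\<lfloor>k * pmf (map_pmf \<pi> u) x\<rfloor> = \<lfloor>k * pmf (map_pmf \<pi> v) x\<rfloor>"
          using fun_cong[OF uv(3), of x] x by (simp add: c_def)
        hence "\<bar>k * pmf (map_pmf \<pi> u) x - k * pmf (map_pmf \<pi> v) x\<bar> \<le> 1" by linarith
        hence "k * \<bar>pmf (map_pmf \<pi> u) x - pmf (map_pmf \<pi> v) x\<bar> \<le> 1"
          using k0 by (simp add: abs_mult flip: right_diff_distrib)
        thus ?thesis using k0 by (simp add: pos_le_divide_eq mult.commute)
      qed
      have "lin_ext f (map_pmf \<pi> u) - lin_ext f (map_pmf \<pi> v) =
          (\<Sum>x\<in>F. (pmf (map_pmf \<pi> u) x - pmf (map_pmf \<pi> v) x) * (f x - f x0))"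
        using expand[OF uv(1)] expand[OF uv(2)] by (simp add: left_diff_distrib sum_subtractf)
      also have "\<bar>\<dots>\<bar> \<le> (\<Sum>x\<in>F. 1 / k * D)"
      proof (rule order_trans[OF sum_abs sum_mono])
        fix x assume x: "x \<in> F"
        have "\<bar>f x - f x0\<bar> \<le> D"
          using E1_bound[OF f subsetD[OF F(2) x] x0]
            diameter_bounded_bound[OF compact_imp_bounded[OF X] subsetD[OF F(2) x] x0]
          unfolding D_def by linarith
        thus "\<bar>(pmf (map_pmf \<pi> u) x - pmf (map_pmf \<pi> v) x) * (f x - f x0)\<bar> \<le> 1 / k * D"
          unfolding abs_mult using close[OF x] D by (intro mult_mono) auto
      qed
      also have "\<dots> \<le> \<delta>/4" using k k0 \<delta> by (simp add: field_simps)
      finally show ?thesis using proj[OF uv(1)] proj[OF uv(2)] by linarith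
    qed
    hence "wasserstein X u v \<le> 3 * \<delta> / 4" by (rule wasserstein_least)
    thus ?thesis using \<delta> by linarith
  qed
  hence "\<forall>K\<in>P. \<forall>u\<in>K \<inter> Delta_f X. \<forall>v\<in>K \<inter> Delta_f X. wasserstein X u v < \<delta>"
    unfolding P_def by auto
  ultimately show ?thesis by blast
qed

section \<open>Finite horizon values\<close>

locale controlled_game =
  fixes X :: "'x::real_normed_vector set"
    and A :: "'a::topological_real_vector set"
    and B :: "'b::topological_real_vector set"
    and g :: "'x \<Rightarrow> 'a \<Rightarrow> 'b \<Rightarrow> real"
    and l :: "'x \<Rightarrow> 'a \<Rightarrow> 'b \<Rightarrow> 'x pmf"
  assumes nonempty: "X \<noteq> {}" "A \<noteq> {}" "B \<noteq> {}"
    and g_range: "\<And>p a b. p \<in> X \<Longrightarrow> a \<in> A \<Longrightarrow> b \<in> B \<Longrightarrow> 0 \<le> g p a b \<and> g p a b \<le> 1"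
    and l_range: "\<And>p a b. p \<in> X \<Longrightarrow> a \<in> A \<Longrightarrow> b \<in> B \<Longrightarrow> l p a b \<in> Delta_f X"
    and l_indep: "\<And>p a b b'. p \<in> X \<Longrightarrow> a \<in> A \<Longrightarrow> b \<in> B \<Longrightarrow> b' \<in> B \<Longrightarrow> l p a b = l p a b'"
    and X: "compact X" "convex X"
    and A: "compact A" "convex A"
    and g_concave: "\<And>p b. p \<in> X \<Longrightarrow> b \<in> B \<Longrightarrow> concave_on A (\<lambda>a. g p a b)"
    and g_usc: "\<And>p b. p \<in> X \<Longrightarrow> b \<in> B \<Longrightarrow> usc_on A (\<lambda>a. g p a b)"
    and g_convex: "\<And>p a. p \<in> X \<Longrightarrow> a \<in> A \<Longrightarrow> convex_on B (\<lambda>b. g p a b)"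
    and stable: "\<exists>D \<subseteq> E1 X. Phi A B g l 1 (\<lambda>_. 0) \<in> D \<and>
               (\<forall>f\<in>D. \<forall>\<alpha>\<in>{0..1}. Phi A B g l \<alpha> f \<in> D)"
    and l_continuous: "\<And>p b. p \<in> X \<Longrightarrow> b \<in> B \<Longrightarrow>
               continuous_map (top_of_set A) (weak_star X) (\<lambda>a. l p a b)"
    and l_concave: "\<And>p b a a' r. p \<in> X \<Longrightarrow> b \<in> B \<Longrightarrow> a \<in> A \<Longrightarrow> a' \<in> A \<Longrightarrow> 0 \<le> r \<Longrightarrow> r \<le> 1 \<Longrightarrow>
               dominates X (l p (r *\<^sub>R a + (1 - r) *\<^sub>R a') b)
                 (bind_pmf (bernoulli_pmf r) (\<lambda>c. if c then l p a b else l p a' b))"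
    and splitting: "\<And>(w :: nat pmf) ps as (n::nat).
               set_pmf w \<subseteq> {1..n} \<Longrightarrow> (\<forall>s\<in>{1..n}. ps s \<in> X \<and> as s \<in> A) \<Longrightarrow>
               (\<exists>a\<in>A.
                 (\<forall>b\<in>B. dominates X (l (\<Sum>s=1..n. pmf w s *\<^sub>R ps s) a b)
                                  (bind_pmf w (\<lambda>s. l (ps s) (as s) b))) \<and>
                 (INF b\<in>B. g (\<Sum>s=1..n. pmf w s *\<^sub>R ps s) a b)
                   \<ge> (\<Sum>s=1..n. pmf w s * (INF b\<in>B. g (ps s) (as s) b)))"
begin

text \<open>
  The payoff that action \<open>a\<close> secures at \<open>p\<close>. A reply that minimises the current payoff costs player
  2 nothing later, because he does not act on the transitions.
\<close>

definition secured :: "'x \<Rightarrow> 'a \<Rightarrow> real" where "secured p a = (INF b\<in>B. g p a b)"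

definition next_law :: "'x \<Rightarrow> 'a \<Rightarrow> 'x pmf" where "next_law p a = l p a (SOME b. b \<in> B)"

text \<open>
  The value of the \<open>n\<close>-stage game in which stage \<open>t\<close> has weight \<open>\<theta> t\<close>. The weights are arbitrary
  because these values are also the support functions used in \<open>reachable_rewards\<close>.
\<close>

primrec V :: "nat \<Rightarrow> (nat \<Rightarrow> real) \<Rightarrow> 'x \<Rightarrow> real" where
  "V 0 \<theta> p = 0"
| "V (Suc n) \<theta> p = (SUP a\<in>A. \<theta> 0 * secured p a + lin_ext (V n (\<lambda>t. \<theta> (Suc t))) (next_law p a))"

lemma l_eq: "p \<in> X \<Longrightarrow> a \<in> A \<Longrightarrow> b \<in> B \<Longrightarrow> l p a b = next_law p a"
  unfolding next_law_def by (rule l_indep) (simp_all add: some_in_eq nonempty)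

lemma next_law_range: "p \<in> X \<Longrightarrow> a \<in> A \<Longrightarrow> next_law p a \<in> Delta_f X"
  using l_range l_eq nonempty(3) by (metis ex_in_conv)

lemma next_law_finite: "p \<in> X \<Longrightarrow> a \<in> A \<Longrightarrow> finite (set_pmf (next_law p a))"
  using next_law_range Delta_f_finite by blast

lemma g_bdd: "p \<in> X \<Longrightarrow> a \<in> A \<Longrightarrow> bdd_below (g p a ` B)"
  using g_range by (intro bdd_belowI2[of _ 0]) auto

lemma secured_le: "p \<in> X \<Longrightarrow> a \<in> A \<Longrightarrow> b \<in> B \<Longrightarrow> secured p a \<le> g p a b"
  unfolding secured_def by (rule cINF_lower[OF g_bdd])

lemma secured_greatest: "(\<And>b. b \<in> B \<Longrightarrow> c \<le> g p a b) \<Longrightarrow> c \<le> secured p a"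
  unfolding secured_def using nonempty(3) by (rule cINF_greatest)

lemma secured_range: "p \<in> X \<Longrightarrow> a \<in> A \<Longrightarrow> 0 \<le> secured p a \<and> secured p a \<le> 1"
  using secured_greatest[of 0 p a] g_range secured_le nonempty(3) by (meson ex_in_conv order_trans)

lemma secured_near:
  assumes "p \<in> X" "a \<in> A" "\<epsilon> > 0" shows "\<exists>b\<in>B. g p a b < secured p a + \<epsilon>"
  using secured_greatest[of "secured p a + \<epsilon>" p a] assms(3) by (force simp: not_less)

lemma secured_concave:
  assumes p: "p \<in> X" and a: "a \<in> A" "a' \<in> A" and \<mu>: "0 \<le> \<mu>" "\<mu> \<le> 1"
  shows "secured p (\<mu> *\<^sub>R a + (1 - \<mu>) *\<^sub>R a') \<ge> \<mu> * secured p a + (1 - \<mu>) * secured p a'"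
proof (rule secured_greatest)
  fix b assume b: "b \<in> B"
  have "\<mu> * secured p a + (1 - \<mu>) * secured p a' \<le> \<mu> * g p a b + (1 - \<mu>) * g p a' b"
    using secured_le[OF p _ b] a \<mu> by (intro add_mono mult_left_mono) auto
  also have "\<dots> \<le> g p (\<mu> *\<^sub>R a + (1 - \<mu>) *\<^sub>R a') b"
    using g_concave[OF p b] a \<mu> by (simp add: concave_on_iff)
  finally show "\<mu> * secured p a + (1 - \<mu>) * secured p a' \<le> g p (\<mu> *\<^sub>R a + (1 - \<mu>) *\<^sub>R a') b" .
qed

lemma V_step_range:
  assumes "\<And>p. p \<in> X \<Longrightarrow> 0 \<le> f p \<and> f p \<le> (c :: real)" "0 \<le> d" "p \<in> X" "a \<in> A"
  shows "0 \<le> d * secured p a + lin_ext f (next_law p a) \<and> d * secured p a + lin_ext f (next_law p a) \<le> d + c"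
proof -
  have s: "q \<in> X" if "q \<in> set_pmf (next_law p a)" for q
    using Delta_f_subset[OF next_law_range[OF assms(3,4)] that] .
  have "0 \<le> lin_ext f (next_law p a)" "lin_ext f (next_law p a) \<le> c"
    using assms(1) s next_law_finite[OF assms(3,4)] by (auto intro!: lin_ext_le lin_ext_ge)
  moreover have "0 \<le> d * secured p a" "d * secured p a \<le> d"
    using secured_range[OF assms(3,4)] assms(2) by (auto simp: mult_left_le)
  ultimately show ?thesis by linarith
qed

lemma V_range:
  assumes "\<forall>t. 0 \<le> \<theta> t" "p \<in> X"
  shows "0 \<le> V n \<theta> p \<and> V n \<theta> p \<le> (\<Sum>t<n. \<theta> t)"
  using assms
proof (induction n arbitrary: \<theta> p)
  case (Suc n)
  have step: "0 \<le> \<theta> 0 * secured p a + lin_ext (V n (\<lambda>t. \<theta> (Suc t))) (next_law p a) \<and>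
     \<theta> 0 * secured p a + lin_ext (V n (\<lambda>t. \<theta> (Suc t))) (next_law p a) \<le> \<theta> 0 + (\<Sum>t<n. \<theta> (Suc t))"
    if "a \<in> A" for a
    using Suc that by (intro V_step_range) auto
  obtain a where a: "a \<in> A" using nonempty by auto
  have "bdd_above ((\<lambda>a. \<theta> 0 * secured p a + lin_ext (V n (\<lambda>t. \<theta> (Suc t))) (next_law p a)) ` A)"
    using step by (auto intro!: bdd_aboveI2)
  moreover have "(\<Sum>t<Suc n. \<theta> t) = \<theta> 0 + (\<Sum>t<n. \<theta> (Suc t))" by (rule sum.lessThan_Suc_shift)
  ultimately show ?case
    using step nonempty(2) a unfolding V.simps
    by (auto intro!: cSUP_least cSUP_upper2[where x = a])
qed simp

lemma V_bdd:
  assumes "\<forall>t. 0 \<le> \<theta> t" "p \<in> X"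
  shows "bdd_above ((\<lambda>a. \<theta> 0 * secured p a + lin_ext (V n (\<lambda>t. \<theta> (Suc t))) (next_law p a)) ` A)"
proof (rule bdd_aboveI2)
  fix a assume "a \<in> A"
  thus "\<theta> 0 * secured p a + lin_ext (V n (\<lambda>t. \<theta> (Suc t))) (next_law p a) \<le> \<theta> 0 + (\<Sum>t<n. \<theta> (Suc t))"
    using V_step_range[of "V n (\<lambda>t. \<theta> (Suc t))" "\<Sum>t<n. \<theta> (Suc t)" "\<theta> 0" p a]
      V_range[of "\<lambda>t. \<theta> (Suc t)"] assms by auto
qed

lemma V_upper:
  assumes "\<forall>t. 0 \<le> \<theta> t" "p \<in> X" "a \<in> A"
  shows "\<theta> 0 * secured p a + lin_ext (V n (\<lambda>t. \<theta> (Suc t))) (next_law p a) \<le> V (Suc n) \<theta> p"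
  unfolding V.simps by (rule cSUP_upper[OF assms(3) V_bdd[OF assms(1,2)]])

lemma V_select:
  assumes "\<forall>t. 0 \<le> \<theta> t" "p \<in> X" "\<epsilon> > 0"
  shows "\<exists>a\<in>A. V (Suc n) \<theta> p - \<epsilon> < \<theta> 0 * secured p a + lin_ext (V n (\<lambda>t. \<theta> (Suc t))) (next_law p a)"
proof -
  have "V (Suc n) \<theta> p - \<epsilon> < (SUP a\<in>A. \<theta> 0 * secured p a + lin_ext (V n (\<lambda>t. \<theta> (Suc t))) (next_law p a))"
    using assms(3) by simp
  thus ?thesis using less_cSUP_iff[OF nonempty(2) V_bdd[OF assms(1,2)]] by blast
qed

lemma Phi_eq:
  assumes "0 \<le> \<alpha>" "p \<in> X"
  shows "Phi A B g l \<alpha> f p = (SUP a\<in>A. \<alpha> * secured p a + (1 - \<alpha>) * lin_ext f (next_law p a))"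
  unfolding Phi_def
proof (rule SUP_cong[OF refl])
  fix a assume a: "a \<in> A"
  have "(INF b\<in>B. \<alpha> * g p a b + (1 - \<alpha>) * lin_ext f (l p a b)) =
      (INF b\<in>B. \<alpha> * g p a b + (1 - \<alpha>) * lin_ext f (next_law p a))"
    by (rule INF_cong) (simp_all add: l_eq assms a)
  also have "\<dots> = \<alpha> * secured p a + (1 - \<alpha>) * lin_ext f (next_law p a)"
    unfolding secured_def by (rule cINF_affine[OF nonempty(3) g_bdd[OF assms(2) a] assms(1)])
  finally show "(INF b\<in>B. \<alpha> * g p a b + (1 - \<alpha>) * lin_ext f (l p a b)) =
    \<alpha> * secured p a + (1 - \<alpha>) * lin_ext f (next_law p a)" .
qed

text \<open>
  After division by the total weight the recursion for \<open>V\<close> is one application of \<^const>\<open>Phi\<close> whose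
  parameter is the share of the first stage in the total weight, so it never leaves the stable class.
\<close>

lemma V_scaled_E1:
  assumes "\<forall>t. 0 \<le> \<theta> t"
  shows "\<exists>f\<in>E1 X. \<forall>p\<in>X. V n \<theta> p = (\<Sum>t<n. \<theta> t) * f p"
proof -
  obtain D where D: "D \<subseteq> E1 X" "Phi A B g l 1 (\<lambda>_. 0) \<in> D"
    "\<And>f \<alpha>. f\<in>D \<Longrightarrow> 0 \<le> \<alpha> \<Longrightarrow> \<alpha> \<le> 1 \<Longrightarrow> Phi A B g l \<alpha> f \<in> D"
    using stable by auto
  have "\<exists>f\<in>D. \<forall>p\<in>X. V n \<theta> p = (\<Sum>t<n. \<theta> t) * f p" using assms
  proof (induction n arbitrary: \<theta>)
    case 0
    thus ?case using D(2) by auto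
  next
    case (Suc n)
    define c where "c = (\<Sum>t<n. \<theta> (Suc t))"
    define d where "d = \<theta> 0 + c"
    have c: "c \<ge> 0" using Suc.prems by (auto simp: c_def intro: sum_nonneg)
    have d: "(\<Sum>t<Suc n. \<theta> t) = d" unfolding d_def c_def by (rule sum.lessThan_Suc_shift)
    obtain f where f: "f \<in> D" "\<forall>p\<in>X. V n (\<lambda>t. \<theta> (Suc t)) p = c * f p"
      using Suc.IH[of "\<lambda>t. \<theta> (Suc t)"] Suc.prems unfolding c_def by auto
    show ?case
    proof (cases "d = 0")
      case True
      hence "\<forall>p\<in>X. V (Suc n) \<theta> p = 0" using V_range[OF Suc.prems, of _ "Suc n"] unfolding d by force
      thus ?thesis using D(2) unfolding d True by auto
    next
      case False
      hence d0: "d > 0" using c spec[OF Suc.prems, of 0] by (simp add: d_def)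
      define \<alpha> where "\<alpha> = \<theta> 0 / d"
      have \<alpha>: "0 \<le> \<alpha>" "\<alpha> \<le> 1" "d * \<alpha> = \<theta> 0" "d * (1 - \<alpha>) = c"
        using d0 c spec[OF Suc.prems, of 0] by (auto simp: \<alpha>_def d_def field_simps)
      have "V (Suc n) \<theta> p = d * Phi A B g l \<alpha> f p" if p: "p \<in> X" for p
      proof -
        have eq: "\<theta> 0 * secured p a + lin_ext (V n (\<lambda>t. \<theta> (Suc t))) (next_law p a) =
            d * (\<alpha> * secured p a + (1 - \<alpha>) * lin_ext f (next_law p a)) + 0" if a: "a \<in> A" for a
        proof -
          have "lin_ext (V n (\<lambda>t. \<theta> (Suc t))) (next_law p a) = lin_ext (\<lambda>q. c * f q) (next_law p a)"
            using f(2) Delta_f_subset[OF next_law_range[OF p a]] by (intro lin_ext_cong) auto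
          also have "\<dots> = (d * (1 - \<alpha>)) * lin_ext f (next_law p a)" by (simp add: \<alpha>(4))
          finally show ?thesis by (simp add: distrib_left flip: \<alpha>(3))
        qed
        have "bdd_above ((\<lambda>a. \<theta> 0 * secured p a + lin_ext (V n (\<lambda>t. \<theta> (Suc t))) (next_law p a)) ` A)"
          by (rule V_bdd[OF Suc.prems p])
        hence "\<exists>K. \<forall>a\<in>A. d * (\<alpha> * secured p a + (1 - \<alpha>) * lin_ext f (next_law p a)) \<le> K"
          using eq by (auto simp: bdd_above_def)
        then obtain K where K: "\<forall>a\<in>A. d * (\<alpha> * secured p a + (1 - \<alpha>) * lin_ext f (next_law p a)) \<le> K" by blast
        have bdd: "bdd_above ((\<lambda>a. \<alpha> * secured p a + (1 - \<alpha>) * lin_ext f (next_law p a)) ` A)"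
          using K d0 by (intro bdd_aboveI2[of _ _ "K / d"]) (simp add: pos_le_divide_eq mult.commute)
        have "V (Suc n) \<theta> p = (SUP a\<in>A. d * (\<alpha> * secured p a + (1 - \<alpha>) * lin_ext f (next_law p a)) + 0)"
          unfolding V.simps by (rule SUP_cong[OF refl eq])
        also have "\<dots> = d * Phi A B g l \<alpha> f p"
          using cSUP_affine[OF nonempty(2) bdd, of d 0] d0 by (simp add: Phi_eq[OF \<alpha>(1) p])
        finally show ?thesis .
      qed
      thus ?thesis using D(3)[OF f(1) \<alpha>(1,2)] unfolding d by blast
    qed
  qed
  thus ?thesis using D(1) by blast
qed

lemma V_continuous:
  assumes "\<forall>t. 0 \<le> \<theta> t" shows "continuous_on X (V n \<theta>)"
proof -
  obtain f where f: "f \<in> E1 X" "\<forall>p\<in>X. V n \<theta> p = (\<Sum>t<n. \<theta> t) * f p"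
    using V_scaled_E1[OF assms] by blast
  have "continuous_on X f" using f(1) by (auto simp: E1_def intro: lipschitz_on_continuous_on)
  hence "continuous_on X (\<lambda>p. (\<Sum>t<n. \<theta> t) * f p)" by (intro continuous_intros)
  thus ?thesis using f(2) by (simp cong: continuous_on_cong)
qed

lemma V_wasserstein:
  assumes "\<forall>t. 0 \<le> \<theta> t" "u \<in> Delta_f X" "v \<in> Delta_f X"
  shows "lin_ext (V n \<theta>) u \<le> lin_ext (V n \<theta>) v + (\<Sum>t<n. \<theta> t) * wasserstein X u v"
proof -
  obtain f where f: "f \<in> E1 X" "\<forall>p\<in>X. V n \<theta> p = (\<Sum>t<n. \<theta> t) * f p"
    using V_scaled_E1[OF assms(1)] by blast
  have eq: "lin_ext (V n \<theta>) w = (\<Sum>t<n. \<theta> t) * lin_ext f w" if "w \<in> Delta_f X" for w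
    using f(2) Delta_f_subset[OF that] lin_ext_cong[of w "V n \<theta>" "\<lambda>p. (\<Sum>t<n. \<theta> t) * f p"] by simp
  have "(\<Sum>t<n. \<theta> t) * (lin_ext f u - lin_ext f v) \<le> (\<Sum>t<n. \<theta> t) * wasserstein X u v"
    using lin_ext_le_wasserstein[OF X(1) assms(2,3) f(1)] assms(1)
    by (intro mult_left_mono sum_nonneg) auto
  thus ?thesis unfolding eq[OF assms(2)] eq[OF assms(3)] by (simp add: algebra_simps)
qed

text \<open>
  The splitting hypothesis provides, at a mixture of two states, an action that secures the mixture of
  the payoffs and whose transition dominates the mixture of the transitions; the concave continuation
  value, given by induction, respects this order.
\<close>

lemma V_concave:
  assumes "\<forall>t. 0 \<le> \<theta> t" shows "concave_on X (V n \<theta>)"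
  using assms
proof (induction n arbitrary: \<theta>)
  case 0
  show ?case using X(2) by (simp add: concave_on_iff)
next
  case (Suc n)
  note \<theta> = Suc.prems
  let ?\<theta> = "\<lambda>t. \<theta> (Suc t)"
  have IH: "concave_on X (V n ?\<theta>)" by (rule Suc.IH) (use \<theta> in simp)
  have cont: "continuous_on X (V n ?\<theta>)" by (rule V_continuous) (use \<theta> in simp)
  have main: "\<mu> * V (Suc n) \<theta> p + (1 - \<mu>) * V (Suc n) \<theta> q \<le> V (Suc n) \<theta> (\<mu> *\<^sub>R p + (1 - \<mu>) *\<^sub>R q)"
    if pq: "p \<in> X" "q \<in> X" and \<mu>: "0 \<le> \<mu>" "\<mu> \<le> 1" for p q \<mu>
  proof (rule field_le_epsilon)
    fix \<epsilon> :: real assume e: "\<epsilon> > 0"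
    obtain a where a: "a \<in> A" "V (Suc n) \<theta> p - \<epsilon> < \<theta> 0 * secured p a + lin_ext (V n ?\<theta>) (next_law p a)"
      using V_select[OF \<theta> pq(1) e] by blast
    obtain a' where a': "a' \<in> A" "V (Suc n) \<theta> q - \<epsilon> < \<theta> 0 * secured q a' + lin_ext (V n ?\<theta>) (next_law q a')"
      using V_select[OF \<theta> pq(2) e] by blast
    \<comment> \<open>the mixture of \<open>p\<close> and \<open>q\<close> as a convex combination indexed by \<open>{1..2}\<close>\<close>
    define w where "w = map_pmf (\<lambda>c. if c then 1 else 2 :: nat) (bernoulli_pmf \<mu>)"
    define ps where "ps s = (if s = 1 then p else q)" for s :: nat
    define as where "as s = (if s = 1 then a else a')" for s :: nat
    have w: "pmf w 1 = \<mu>" "pmf w 2 = 1 - \<mu>"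
    proof -
      have "inj (\<lambda>c. if c then 1 else 2 :: nat)" by (auto simp: inj_def split: if_splits)
      from pmf_map_inj'[OF this] show "pmf w 1 = \<mu>" "pmf w 2 = 1 - \<mu>"
        using \<mu> by (metis (full_types) pmf_bernoulli_True pmf_bernoulli_False w_def)+
    qed
    have sum2: "(\<Sum>s=1..2. h s) = h 1 + h 2" for h :: "nat \<Rightarrow> 'y::comm_monoid_add"
      by (simp add: numeral_2_eq_2)
    have "set_pmf w \<subseteq> {1..2}" by (auto simp: w_def)
    moreover have "\<forall>s\<in>{1..2}. ps s \<in> X \<and> as s \<in> A" using pq a a' by (simp add: ps_def as_def)
    ultimately obtain c where c: "c \<in> A"
      "\<forall>b\<in>B. dominates X (l (\<Sum>s=1..2. pmf w s *\<^sub>R ps s) c b) (bind_pmf w (\<lambda>s. l (ps s) (as s) b))"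
      "(INF b\<in>B. g (\<Sum>s=1..2. pmf w s *\<^sub>R ps s) c b) \<ge> (\<Sum>s=1..2. pmf w s * (INF b\<in>B. g (ps s) (as s) b))"
      using splitting by blast
    define m where "m = \<mu> *\<^sub>R p + (1 - \<mu>) *\<^sub>R q"
    have m: "m \<in> X" using X(2) pq \<mu> by (simp add: m_def convex_def)
    have sm: "(\<Sum>s=1..2. pmf w s *\<^sub>R ps s) = m" unfolding sum2 w by (simp add: ps_def m_def)
    have rm: "\<mu> * secured p a + (1 - \<mu>) * secured q a' \<le> secured m c"
      using c(3) unfolding sm unfolding sum2 w by (simp add: ps_def as_def secured_def)
    obtain b where b: "b \<in> B" using nonempty(3) by auto
    have "lin_ext (V n ?\<theta>) (bind_pmf w (\<lambda>s. l (ps s) (as s) b)) \<le> lin_ext (V n ?\<theta>) (l m c b)"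
      using c(2) b cont IH unfolding dominates_def sm by blast
    also have "bind_pmf w (\<lambda>s. l (ps s) (as s) b) =
        bind_pmf (bernoulli_pmf \<mu>) (\<lambda>c. if c then l p a b else l q a' b)"
      unfolding w_def bind_map_pmf by (rule bind_pmf_cong) (auto simp: ps_def as_def)
    also have "\<dots> = bind_pmf (bernoulli_pmf \<mu>) (\<lambda>c. if c then next_law p a else next_law q a')"
      unfolding l_eq[OF pq(1) a(1) b] l_eq[OF pq(2) a'(1) b] by (rule refl)
    also have "lin_ext (V n ?\<theta>) \<dots> = \<mu> * lin_ext (V n ?\<theta>) (next_law p a) + (1 - \<mu>) * lin_ext (V n ?\<theta>) (next_law q a')"
      using pq a a' \<mu> by (intro lin_ext_bernoulli_mixture next_law_finite)
    finally have lm: "\<mu> * lin_ext (V n ?\<theta>) (next_law p a) + (1 - \<mu>) * lin_ext (V n ?\<theta>) (next_law q a')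
        \<le> lin_ext (V n ?\<theta>) (next_law m c)" using m c(1) b by (simp add: l_eq)
    have "\<mu> * (V (Suc n) \<theta> p - \<epsilon>) + (1 - \<mu>) * (V (Suc n) \<theta> q - \<epsilon>) \<le>
       \<mu> * (\<theta> 0 * secured p a + lin_ext (V n ?\<theta>) (next_law p a)) +
       (1 - \<mu>) * (\<theta> 0 * secured q a' + lin_ext (V n ?\<theta>) (next_law q a'))"
      using a(2) a'(2) \<mu> by (intro add_mono mult_left_mono) auto
    also have "\<dots> = \<theta> 0 * (\<mu> * secured p a + (1 - \<mu>) * secured q a') +
       (\<mu> * lin_ext (V n ?\<theta>) (next_law p a) + (1 - \<mu>) * lin_ext (V n ?\<theta>) (next_law q a'))"
      by (simp add: algebra_simps)
    also have "\<dots> \<le> \<theta> 0 * secured m c + lin_ext (V n ?\<theta>) (next_law m c)"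
      using rm lm \<theta> by (intro add_mono mult_left_mono) auto
    also have "\<dots> \<le> V (Suc n) \<theta> m" by (rule V_upper[OF \<theta> m c(1)])
    finally show "\<mu> * V (Suc n) \<theta> p + (1 - \<mu>) * V (Suc n) \<theta> q
        \<le> V (Suc n) \<theta> (\<mu> *\<^sub>R p + (1 - \<mu>) *\<^sub>R q) + \<epsilon>"
      unfolding m_def[symmetric] by (simp add: algebra_simps)
  qed
  show ?case unfolding concave_on_iff
  proof (intro conjI ballI allI impI)
    fix p q :: 'x and \<mu> \<nu> :: real
    assume "p \<in> X" "q \<in> X" "0 \<le> \<mu>" "0 \<le> \<nu>" "\<mu> + \<nu> = 1"
    moreover from this have "\<nu> = 1 - \<mu>" "\<mu> \<le> 1" by auto
    ultimately show "\<mu> * V (Suc n) \<theta> p + \<nu> * V (Suc n) \<theta> q \<le> V (Suc n) \<theta> (\<mu> *\<^sub>R p + \<nu> *\<^sub>R q)"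
      using main[of p q \<mu>] by simp
  qed (rule X(2))
qed

text \<open>
  Continuation values are concave and continuous, hence monotone for \<^const>\<open>dominates\<close>.
\<close>

lemma next_law_concave:
  assumes \<theta>: "\<forall>t. 0 \<le> \<theta> t" and p: "p \<in> X" and a: "a \<in> A" "a' \<in> A" and \<mu>: "0 \<le> \<mu>" "\<mu> \<le> 1"
  shows "\<mu> * lin_ext (V n \<theta>) (next_law p a) + (1 - \<mu>) * lin_ext (V n \<theta>) (next_law p a')
     \<le> lin_ext (V n \<theta>) (next_law p (\<mu> *\<^sub>R a + (1 - \<mu>) *\<^sub>R a'))"
proof -
  obtain b where b: "b \<in> B" using nonempty(3) by auto
  have m: "\<mu> *\<^sub>R a + (1 - \<mu>) *\<^sub>R a' \<in> A" using A(2) a \<mu> by (simp add: convex_def)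
  have "lin_ext (V n \<theta>) (bind_pmf (bernoulli_pmf \<mu>) (\<lambda>c. if c then l p a b else l p a' b))
      \<le> lin_ext (V n \<theta>) (l p (\<mu> *\<^sub>R a + (1 - \<mu>) *\<^sub>R a') b)"
    using l_concave[OF p b a \<mu>] V_continuous[OF \<theta>] V_concave[OF \<theta>] unfolding dominates_def by blast
  also have "bind_pmf (bernoulli_pmf \<mu>) (\<lambda>c. if c then l p a b else l p a' b) =
      bind_pmf (bernoulli_pmf \<mu>) (\<lambda>c. if c then next_law p a else next_law p a')"
    unfolding l_eq[OF p a(1) b] l_eq[OF p a(2) b] by (rule refl)
  also have "lin_ext (V n \<theta>) \<dots> = \<mu> * lin_ext (V n \<theta>) (next_law p a) + (1 - \<mu>) * lin_ext (V n \<theta>) (next_law p a')"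
    using p a \<mu> by (intro lin_ext_bernoulli_mixture next_law_finite)
  finally show ?thesis using l_eq[OF p m b] by simp
qed

lemma next_law_open:
  assumes f: "continuous_on X f" and p: "p \<in> X"
  shows "openin (top_of_set A) {a \<in> A. lin_ext f (next_law p a) < c}"
proof -
  obtain b where b: "b \<in> B" using nonempty(3) by auto
  have "openin (weak_star X) {u \<in> Delta_f X. lin_ext f u \<in> {..<c}}"
    unfolding weak_star_def by (rule topology_generated_by_Basis) (use f open_lessThan in blast)
  from openin_continuous_map_preimage[OF l_continuous[OF p b] this]
  have "openin (top_of_set A) {a \<in> A. l p a b \<in> {u \<in> Delta_f X. lin_ext f u \<in> {..<c}}}" by simp
  also have "{a \<in> A. l p a b \<in> {u \<in> Delta_f X. lin_ext f u \<in> {..<c}}} = {a \<in> A. lin_ext f (next_law p a) < c}"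
    using l_eq[OF p _ b] next_law_range[OF p] by auto
  finally show ?thesis .
qed

text \<open>
  Upper semicontinuity of a sum: a sum lies below \<open>c\<close> iff some \<open>y\<close> separates its two terms.
\<close>

lemma stage_open:
  assumes f: "continuous_on X f" and p: "p \<in> X" and b: "b \<in> B" and d: "0 \<le> d"
  shows "openin (top_of_set A) {a \<in> A. d * g p a b + lin_ext f (next_law p a) < c}"
proof -
  have g: "openin (top_of_set A) {a \<in> A. d * g p a b < y}" for y
  proof (cases "d = 0")
    case True
    have "{a \<in> A. d * g p a b < y} = (if 0 < y then A else {})" using True by auto
    thus ?thesis by (simp add: openin_subtopology_self)
  next
    case False
    hence "{a \<in> A. d * g p a b < y} = {a \<in> A. g p a b < y / d}"
      using d by (auto simp: pos_less_divide_eq mult.commute)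
    thus ?thesis using g_usc[OF p b] unfolding usc_on_def by simp
  qed
  have "{a \<in> A. d * g p a b + lin_ext f (next_law p a) < c} =
      (\<Union>y. {a \<in> A. d * g p a b < y} \<inter> {a \<in> A. lin_ext f (next_law p a) < c - y})"
  proof (intro equalityI subsetI)
    fix a assume a: "a \<in> {a \<in> A. d * g p a b + lin_ext f (next_law p a) < c}"
    then obtain y where "d * g p a b < y" "y < c - lin_ext f (next_law p a)"
      using dense[of "d * g p a b" "c - lin_ext f (next_law p a)"] by auto
    with a show "a \<in> (\<Union>y. {a \<in> A. d * g p a b < y} \<inter> {a \<in> A. lin_ext f (next_law p a) < c - y})"
      by force
  qed force
  moreover have "openin (top_of_set A) \<dots>"
    using g next_law_open[OF f p] by (intro openin_Union) auto
  ultimately show ?thesis by simp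
qed

text \<open>
  The one-stage game with continuation value is concave in \<open>a\<close> and convex in \<open>b\<close>, so it has a value,
  and player 2 has a reply that is nearly optimal against all actions at once.
\<close>

lemma optimal_reply:
  assumes \<theta>: "\<forall>t. 0 \<le> \<theta> t" and p: "p \<in> X" and e: "\<epsilon> > 0"
  shows "\<exists>b\<in>B. \<forall>a\<in>A. \<theta> 0 * g p a b + lin_ext (V n (\<lambda>t. \<theta> (Suc t))) (next_law p a) \<le> V (Suc n) \<theta> p + \<epsilon>"
proof -
  let ?F = "\<lambda>a. lin_ext (V n (\<lambda>t. \<theta> (Suc t))) (next_law p a)"
  have \<theta>': "\<forall>t. 0 \<le> \<theta> (Suc t)" using \<theta> by simp
  show ?thesis
  proof (rule one_sided_compact_minimax[where f = "\<lambda>a b. \<theta> 0 * g p a b + ?F a"])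
    show "compact A" "A \<noteq> {}" "convex A" using A nonempty by auto
  next
    fix b assume b: "b \<in> B"
    show "concave_on A (\<lambda>a. \<theta> 0 * g p a b + ?F a)"
      unfolding concave_on_iff
    proof (intro conjI ballI allI impI)
      fix a a' :: 'a and \<mu> \<nu> :: real
      assume h: "a \<in> A" "a' \<in> A" "0 \<le> \<mu>" "0 \<le> \<nu>" "\<mu> + \<nu> = 1"
      hence \<nu>: "\<nu> = 1 - \<mu>" "\<mu> \<le> 1" by auto
      have "\<mu> * g p a b + \<nu> * g p a' b \<le> g p (\<mu> *\<^sub>R a + \<nu> *\<^sub>R a') b"
        using g_concave[OF p b] h by (simp add: concave_on_iff)
      hence "\<theta> 0 * (\<mu> * g p a b + \<nu> * g p a' b) \<le> \<theta> 0 * g p (\<mu> *\<^sub>R a + \<nu> *\<^sub>R a') b"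
        using spec[OF \<theta>] by (rule mult_left_mono)
      moreover have "\<mu> * ?F a + \<nu> * ?F a' \<le> ?F (\<mu> *\<^sub>R a + \<nu> *\<^sub>R a')"
        using next_law_concave[OF \<theta>' p h(1,2,3) \<nu>(2)] by (simp add: \<nu>)
      ultimately show "\<mu> * (\<theta> 0 * g p a b + ?F a) + \<nu> * (\<theta> 0 * g p a' b + ?F a') \<le>
        \<theta> 0 * g p (\<mu> *\<^sub>R a + \<nu> *\<^sub>R a') b + ?F (\<mu> *\<^sub>R a + \<nu> *\<^sub>R a')"
        by (simp add: algebra_simps)
    qed (rule A(2))
    show "openin (top_of_set A) {a \<in> A. \<theta> 0 * g p a b + ?F a < V (Suc n) \<theta> p + \<epsilon>}"
      by (rule stage_open[OF V_continuous[OF \<theta>'] p b spec[OF \<theta>]])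
  next
    fix a assume a: "a \<in> A"
    show "convex_on B (\<lambda>b. \<theta> 0 * g p a b + ?F a)"
      using g_convex[OF p a] spec[OF \<theta>, of 0]
      by (intro convex_on_add convex_on_cmul) (auto simp: convex_on_imp_convex convex_on_const)
    have "\<exists>b\<in>B. g p a b < secured p a + \<epsilon> / (\<theta> 0 + 1)"
      using e spec[OF \<theta>, of 0] by (intro secured_near[OF p a]) (simp add: add_nonneg_pos)
    then obtain b where b: "b \<in> B" "g p a b < secured p a + \<epsilon> / (\<theta> 0 + 1)" by blast
    have "\<theta> 0 * g p a b \<le> \<theta> 0 * (secured p a + \<epsilon> / (\<theta> 0 + 1))" using b(2) \<theta> by (intro mult_left_mono) auto
    also have "\<dots> = \<theta> 0 * secured p a + \<epsilon> * (\<theta> 0 / (\<theta> 0 + 1))" by (simp add: algebra_simps)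
    also have "\<dots> < \<theta> 0 * secured p a + \<epsilon>" using e spec[OF \<theta>, of 0] by (simp add: divide_less_eq add_nonneg_pos)
    finally have "\<theta> 0 * g p a b + ?F a < V (Suc n) \<theta> p + \<epsilon>" using V_upper[OF \<theta> p a, of n] by linarith
    thus "\<exists>b\<in>B. \<theta> 0 * g p a b + ?F a < V (Suc n) \<theta> p + \<epsilon>" using b(1) by blast
  qed
qed

section \<open>The control problem on laws\<close>

definition decisions :: "('x \<Rightarrow> 'a) set" where "decisions = {s. \<forall>p\<in>X. s p \<in> A}"

definition law_step :: "'x pmf \<Rightarrow> ('x \<Rightarrow> 'a) \<Rightarrow> 'x pmf" where
  "law_step u s = bind_pmf u (\<lambda>p. next_law p (s p))"

definition law_reward :: "'x pmf \<Rightarrow> ('x \<Rightarrow> 'a) \<Rightarrow> real" where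
  "law_reward u s = lin_ext (\<lambda>p. secured p (s p)) u"

lemma law_step_closed: "u \<in> Delta_f X \<Longrightarrow> s \<in> decisions \<Longrightarrow> law_step u s \<in> Delta_f X"
  unfolding Delta_f_def law_step_def decisions_def
  using next_law_range[unfolded Delta_f_def] by (fastforce simp: set_bind_pmf)

lemma lin_ext_law_step:
  assumes "u \<in> Delta_f X" "s \<in> decisions"
  shows "lin_ext f (law_step u s) = lin_ext (\<lambda>p. lin_ext f (next_law p (s p))) u"
  unfolding law_step_def using assms
  by (intro lin_ext_bind) (auto simp: decisions_def Delta_f_def dest: next_law_finite)

end

text \<open>
  A play of this control problem is a Markov strategy of player 1, and its rewards are the expected
  payoffs that the strategy secures.
\<close>

sublocale controlled_game \<subseteq> mdp: deterministic_control "Delta_f X" decisions law_step law_reward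
proof
  show "decisions \<noteq> {}" using nonempty(2) by (auto simp: decisions_def)
  fix u s assume us: "u \<in> Delta_f X" "s \<in> decisions"
  show "law_step u s \<in> Delta_f X" by (rule law_step_closed[OF us])
  have "0 \<le> secured p (s p) \<and> secured p (s p) \<le> 1" if "p \<in> set_pmf u" for p
    using us that by (intro secured_range) (auto simp: decisions_def Delta_f_def)
  thus "0 \<le> law_reward u s \<and> law_reward u s \<le> 1"
    unfolding law_reward_def using Delta_f_finite[OF us(1)] by (auto intro!: lin_ext_le lin_ext_ge)
qed

context controlled_game
begin

lemma reward_0: "mdp.reward u s 0 = law_reward u (s 0)"
  by (simp add: mdp.reward_def)

lemma reward_Suc: "mdp.reward u s (Suc t) = mdp.reward (law_step u (s 0)) (\<lambda>i. s (Suc i)) t"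
  using mdp.reward_add[of u s 1 t] by simp

lemma weighted_reward_Suc:
  "(\<Sum>t<Suc n. \<theta> t * mdp.reward u s t) = \<theta> 0 * law_reward u (s 0) +
     (\<Sum>t<n. \<theta> (Suc t) * mdp.reward (law_step u (s 0)) (\<lambda>i. s (Suc i)) t)"
  by (subst sum.lessThan_Suc_shift) (simp add: reward_0 reward_Suc)

lemma lin_ext_stage:
  assumes "u \<in> Delta_f X" "s \<in> decisions"
  shows "d * law_reward u s + lin_ext f (law_step u s) =
    lin_ext (\<lambda>p. d * secured p (s p) + lin_ext f (next_law p (s p))) u"
  using Delta_f_finite[OF assms(1)] by (simp add: lin_ext_law_step[OF assms] law_reward_def)

lemma weighted_reward_le:
  assumes "\<forall>t. 0 \<le> \<theta> t" "u \<in> Delta_f X" "s \<in> mdp.plays"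
  shows "(\<Sum>t<n. \<theta> t * mdp.reward u s t) \<le> lin_ext (V n \<theta>) u"
  using assms
proof (induction n arbitrary: \<theta> u s)
  case (Suc n)
  have s0: "s 0 \<in> decisions" using Suc.prems(3) by (simp add: mdp.plays_def)
  have "(\<Sum>t<n. \<theta> (Suc t) * mdp.reward (law_step u (s 0)) (\<lambda>i. s (Suc i)) t)
      \<le> lin_ext (V n (\<lambda>t. \<theta> (Suc t))) (law_step u (s 0))"
    using Suc.prems s0 by (intro Suc.IH law_step_closed) (auto simp: mdp.plays_def)
  hence "(\<Sum>t<Suc n. \<theta> t * mdp.reward u s t) \<le> \<theta> 0 * law_reward u (s 0) + lin_ext (V n (\<lambda>t. \<theta> (Suc t))) (law_step u (s 0))"
    unfolding weighted_reward_Suc by simp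
  also have "\<dots> = lin_ext (\<lambda>p. \<theta> 0 * secured p (s 0 p) + lin_ext (V n (\<lambda>t. \<theta> (Suc t))) (next_law p (s 0 p))) u"
    by (rule lin_ext_stage[OF Suc.prems(2) s0])
  also have "\<dots> \<le> lin_ext (V (Suc n) \<theta>) u"
    using Suc.prems s0 by (intro lin_ext_mono V_upper) (auto simp: Delta_f_def decisions_def)
  finally show ?case .
qed simp

text \<open>
  The actions are chosen state by state, so the play does not depend on the initial law.
\<close>

lemma near_optimal_weighted:
  assumes "\<forall>t. 0 \<le> \<theta> t" "\<epsilon> > 0"
  shows "\<exists>s\<in>mdp.plays. \<forall>u\<in>Delta_f X. (\<Sum>t<n. \<theta> t * mdp.reward u s t) \<ge> lin_ext (V n \<theta>) u - \<epsilon>"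
  using assms
proof (induction n arbitrary: \<theta> \<epsilon>)
  case 0
  thus ?case using mdp.plays_nonempty by auto
next
  case (Suc n)
  let ?\<theta> = "\<lambda>t. \<theta> (Suc t)"
  have "\<epsilon> / 2 > 0" using Suc.prems by simp
  from Suc.IH[of ?\<theta>, OF _ this] Suc.prems(1)
  obtain s' where s': "s' \<in> mdp.plays"
    "\<And>u. u\<in>Delta_f X \<Longrightarrow> (\<Sum>t<n. ?\<theta> t * mdp.reward u s' t) \<ge> lin_ext (V n ?\<theta>) u - \<epsilon>/2" by blast
  obtain s0 where s0: "\<And>p. p \<in> X \<Longrightarrow> s0 p \<in> A"
    "\<And>p. p \<in> X \<Longrightarrow> V (Suc n) \<theta> p - \<epsilon>/2 < \<theta> 0 * secured p (s0 p) + lin_ext (V n ?\<theta>) (next_law p (s0 p))"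
    using V_select[OF Suc.prems(1) _ \<open>\<epsilon>/2 > 0\<close>, where n = n] by metis
  define s where "s = case_nat s0 s'"
  have s0d: "s0 \<in> decisions" using s0(1) by (simp add: decisions_def)
  have "s \<in> mdp.plays" using s' s0d by (auto simp: mdp.plays_def s_def split: nat.splits)
  moreover have "(\<Sum>t<Suc n. \<theta> t * mdp.reward u s t) \<ge> lin_ext (V (Suc n) \<theta>) u - \<epsilon>" if u: "u \<in> Delta_f X" for u
  proof -
    have "lin_ext (V (Suc n) \<theta>) u - \<epsilon>/2 = lin_ext (\<lambda>p. V (Suc n) \<theta> p - \<epsilon>/2) u"
      using Delta_f_finite[OF u] by (simp del: V.simps)
    also have "\<dots> \<le> lin_ext (\<lambda>p. \<theta> 0 * secured p (s0 p) + lin_ext (V n ?\<theta>) (next_law p (s0 p))) u"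
      using s0 u by (intro lin_ext_mono) (auto simp: Delta_f_def intro!: less_imp_le)
    also have "\<dots> = \<theta> 0 * law_reward u s0 + lin_ext (V n ?\<theta>) (law_step u s0)"
      by (rule lin_ext_stage[OF u s0d, symmetric])
    finally show ?thesis
      unfolding weighted_reward_Suc using s'(2)[OF law_step_closed[OF u s0d]] by (simp add: s_def)
  qed
  ultimately show ?case by blast
qed

text \<open>
  The vectors that are nearly reached from \<open>u\<close> form a set \<open>C\<close> that is convex: given two plays, use
  the average decision at the first stage. It secures at least the average reward, and its law
  dominates the average of the two next laws, so all \<open>V n \<theta>\<close> are at least the average of the
  continuation values; by induction the averaged later rewards are nearly reached from there. If no
  vector of \<open>C\<close> were close to \<open>x\<close>, the alternative would yield weights \<open>\<theta>\<close> for which \<open>V\<close> at \<open>u\<close> is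
  smaller than \<open>\<Sum>t. \<theta> t * x t\<close>.
\<close>

lemma reachable_rewards:
  assumes "u \<in> Delta_f X"
    and "\<And>\<theta>. \<forall>t. 0 \<le> \<theta> t \<Longrightarrow> (\<Sum>t<n. \<theta> t * x t) \<le> lin_ext (V n \<theta>) u"
    and "\<epsilon> > 0"
  shows "\<exists>s\<in>mdp.plays. \<forall>t<n. mdp.reward u s t \<ge> x t - \<epsilon>"
  using assms
proof (induction n arbitrary: u x \<epsilon>)
  case 0
  thus ?case using mdp.plays_nonempty by auto
next
  case (Suc n)
  note u = Suc.prems(1)
  define C where "C = {y :: nat \<Rightarrow> real. \<forall>\<delta>>0. \<exists>s\<in>mdp.plays. \<forall>t<Suc n. mdp.reward u s t \<ge> y t - \<delta>}"
  have mixture: "(\<lambda>t. \<mu> * y t + (1 - \<mu>) * y' t) \<in> C"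
    if yy: "y \<in> C" "y' \<in> C" and \<mu>: "0 \<le> \<mu>" "\<mu> \<le> 1" for y y' and \<mu> :: real
    unfolding C_def
  proof (intro CollectI allI impI)
    fix \<delta> :: real assume d: "\<delta> > 0"
    hence d2: "\<delta> / 2 > 0" by simp
    obtain s where s: "s \<in> mdp.plays" "\<And>t. t < Suc n \<Longrightarrow> mdp.reward u s t \<ge> y t - \<delta>/2"
      using yy(1) d2 unfolding C_def by blast
    obtain s' where s': "s' \<in> mdp.plays" "\<And>t. t < Suc n \<Longrightarrow> mdp.reward u s' t \<ge> y' t - \<delta>/2"
      using yy(2) d2 unfolding C_def by blast
    define m where "m p = \<mu> *\<^sub>R s 0 p + (1 - \<mu>) *\<^sub>R s' 0 p" for p
    have dec: "s 0 \<in> decisions" "s' 0 \<in> decisions" using s(1) s'(1) by (auto simp: mdp.plays_def)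
    have m: "m \<in> decisions" using dec A(2) \<mu> by (auto simp: decisions_def m_def convex_def)
    define z where "z t = \<mu> * mdp.reward u s t + (1 - \<mu>) * mdp.reward u s' t" for t
    have first: "law_reward u m \<ge> z 0"
    proof -
      have "z 0 = lin_ext (\<lambda>p. \<mu> * secured p (s 0 p) + (1 - \<mu>) * secured p (s' 0 p)) u"
        using Delta_f_finite[OF u] by (simp add: z_def reward_0 law_reward_def)
      also have "\<dots> \<le> law_reward u m" unfolding law_reward_def m_def
        using u dec \<mu> by (intro lin_ext_mono secured_concave) (auto simp: Delta_f_def decisions_def)
      finally show ?thesis .
    qed
    have "\<exists>s''\<in>mdp.plays. \<forall>t<n. mdp.reward (law_step u m) s'' t \<ge> z (Suc t) - \<delta>/2"
    proof (rule Suc.IH[OF law_step_closed[OF u m] _ d2])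
      fix \<theta> :: "nat \<Rightarrow> real" assume \<theta>: "\<forall>t. 0 \<le> \<theta> t"
      have "(\<Sum>t<n. \<theta> t * z (Suc t)) =
          \<mu> * (\<Sum>t<n. \<theta> t * mdp.reward (law_step u (s 0)) (\<lambda>i. s (Suc i)) t) +
          (1 - \<mu>) * (\<Sum>t<n. \<theta> t * mdp.reward (law_step u (s' 0)) (\<lambda>i. s' (Suc i)) t)"
        by (simp add: z_def reward_Suc distrib_left sum.distrib sum_distrib_left mult.left_commute)
      also have "\<dots> \<le> \<mu> * lin_ext (V n \<theta>) (law_step u (s 0)) + (1 - \<mu>) * lin_ext (V n \<theta>) (law_step u (s' 0))"
        using \<mu> s(1) s'(1) dec
        by (intro add_mono mult_left_mono weighted_reward_le \<theta> law_step_closed u)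
           (auto simp: mdp.plays_def)
      also have "\<dots> = lin_ext (\<lambda>p. \<mu> * lin_ext (V n \<theta>) (next_law p (s 0 p)) +
          (1 - \<mu>) * lin_ext (V n \<theta>) (next_law p (s' 0 p))) u"
        using Delta_f_finite[OF u] by (simp add: lin_ext_law_step[OF u] dec)
      also have "\<dots> \<le> lin_ext (\<lambda>p. lin_ext (V n \<theta>) (next_law p (m p))) u" unfolding m_def
        using u dec \<mu> by (intro lin_ext_mono next_law_concave \<theta>) (auto simp: Delta_f_def decisions_def)
      also have "\<dots> = lin_ext (V n \<theta>) (law_step u m)" by (simp add: lin_ext_law_step[OF u m])
      finally show "(\<Sum>t<n. \<theta> t * z (Suc t)) \<le> lin_ext (V n \<theta>) (law_step u m)" .
    qed
    then obtain s'' where s'': "s'' \<in> mdp.plays"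
      "\<And>t. t < n \<Longrightarrow> mdp.reward (law_step u m) s'' t \<ge> z (Suc t) - \<delta>/2" by blast
    have "case_nat m s'' \<in> mdp.plays" using s''(1) m by (auto simp: mdp.plays_def split: nat.splits)
    moreover have "mdp.reward u (case_nat m s'') t \<ge> \<mu> * y t + (1 - \<mu>) * y' t - \<delta>" if t: "t < Suc n" for t
    proof -
      have "mdp.reward u (case_nat m s'') t \<ge> z t - \<delta>/2"
      proof (cases t)
        case 0
        thus ?thesis using first d by (simp add: reward_0)
      next
        case (Suc k)
        thus ?thesis using s''(2)[of k] t by (simp add: reward_Suc)
      qed
      moreover have "z t \<ge> \<mu> * (y t - \<delta>/2) + (1 - \<mu>) * (y' t - \<delta>/2)"
        unfolding z_def using s(2)[OF t] s'(2)[OF t] \<mu> by (intro add_mono mult_left_mono) auto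
      moreover have "\<mu> * (y t - \<delta>/2) + (1 - \<mu>) * (y' t - \<delta>/2) = \<mu> * y t + (1 - \<mu>) * y' t - \<delta>/2"
        by (simp add: field_simps)
      ultimately show ?thesis by linarith
    qed
    ultimately show "\<exists>s\<in>mdp.plays. \<forall>t<Suc n. mdp.reward u s t \<ge> \<mu> * y t + (1 - \<mu>) * y' t - \<delta>" by blast
  qed
  have shift: "\<mu> * (a - c) + (1 - \<mu>) * (b - c) = \<mu> * a + (1 - \<mu>) * b - c" for a b c \<mu> :: real
    by (simp add: algebra_simps)
  have "\<exists>y\<in>C. \<forall>t<Suc n. y t > x t - \<epsilon>/2"
  proof (rule ccontr)
    assume neg: "\<not> ?thesis"
    have "\<exists>\<theta>. (\<forall>t\<in>{..<Suc n}. \<theta> t \<ge> 0) \<and> sum \<theta> {..<Suc n} = 1 \<and>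
        (\<forall>y\<in>C. (\<Sum>t<Suc n. \<theta> t * (y t - (x t - \<epsilon>/2))) \<le> 0)"
    proof (rule concavelike_alternative)
      fix y y' and \<mu> :: real assume "y \<in> C" "y' \<in> C" "0 \<le> \<mu>" "\<mu> \<le> 1"
      thus "\<exists>z\<in>C. \<forall>i\<in>{..<Suc n}. \<mu> * (y i - (x i - \<epsilon>/2)) + (1 - \<mu>) * (y' i - (x i - \<epsilon>/2)) \<le> z i - (x i - \<epsilon>/2)"
        using mixture shift by (intro bexI[of _ "\<lambda>t. \<mu> * y t + (1 - \<mu>) * y' t"]) simp_all
    next
      fix y assume "y \<in> C"
      with neg obtain t where "t < Suc n" "y t \<le> x t - \<epsilon>/2" by (auto simp: not_less)
      thus "\<exists>i\<in>{..<Suc n}. y i - (x i - \<epsilon>/2) \<le> 0" by (intro bexI[of _ t]) auto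
    qed auto
    then obtain \<theta>0 where \<theta>0: "\<forall>t\<in>{..<Suc n}. \<theta>0 t \<ge> 0" "sum \<theta>0 {..<Suc n} = 1"
        "\<And>y. y\<in>C \<Longrightarrow> (\<Sum>t<Suc n. \<theta>0 t * (y t - (x t - \<epsilon>/2))) \<le> 0" by blast
    define \<theta> where "\<theta> t = (if t < Suc n then \<theta>0 t else 0)" for t
    have \<theta>: "\<forall>t. 0 \<le> \<theta> t" using \<theta>0(1) by (simp add: \<theta>_def)
    have eq: "(\<Sum>t<Suc n. \<theta>0 t * h t) = (\<Sum>t<Suc n. \<theta> t * h t)" for h
      by (rule sum.cong) (auto simp: \<theta>_def)
    have "\<epsilon>/4 > 0" using Suc.prems(3) by simp
    then obtain s where s: "s \<in> mdp.plays"
      "(\<Sum>t<Suc n. \<theta> t * mdp.reward u s t) \<ge> lin_ext (V (Suc n) \<theta>) u - \<epsilon>/4"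
      using near_optimal_weighted[OF \<theta>, of "\<epsilon>/4" "Suc n"] u by blast
    have "mdp.reward u s \<in> C" using s(1) unfolding C_def by force
    from \<theta>0(3)[OF this] have "(\<Sum>t<Suc n. \<theta> t * mdp.reward u s t) \<le> (\<Sum>t<Suc n. \<theta> t * (x t - \<epsilon>/2))"
      unfolding eq by (simp only: right_diff_distrib sum_subtractf)
    also have "\<dots> = (\<Sum>t<Suc n. \<theta> t * x t) - (\<Sum>t<Suc n. \<theta>0 t * (\<epsilon>/2))"
      unfolding eq by (simp only: right_diff_distrib sum_subtractf)
    also have "(\<Sum>t<Suc n. \<theta>0 t * (\<epsilon>/2)) = \<epsilon>/2" using \<theta>0(2) by (simp only: flip: sum_distrib_right) 
    finally have "(\<Sum>t<Suc n. \<theta> t * mdp.reward u s t) \<le> (\<Sum>t<Suc n. \<theta> t * x t) - \<epsilon>/2" .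
    thus False using s(2) Suc.prems(2)[OF \<theta>] Suc.prems(3) by linarith
  qed
  then obtain y where y: "y \<in> C" "\<And>t. t < Suc n \<Longrightarrow> y t > x t - \<epsilon>/2" by blast
  have "\<epsilon>/2 > 0" using Suc.prems(3) by simp
  with y(1) obtain s where s: "s \<in> mdp.plays" "\<And>t. t < Suc n \<Longrightarrow> mdp.reward u s t \<ge> y t - \<epsilon>/2"
    unfolding C_def by blast
  have "mdp.reward u s t \<ge> x t - \<epsilon>" if "t < Suc n" for t using s(2)[OF that] y(2)[OF that] by linarith
  thus ?case using s(1) by blast
qed

text \<open>
  The rewards of a play from \<open>u\<close>, lowered by the distance, satisfy at \<open>v\<close> the inequalities of
  \<open>reachable_rewards\<close>, because \<open>V n \<theta>\<close> is Lipschitz with constant the total weight.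
\<close>

lemma wasserstein_matched:
  assumes uv: "u \<in> Delta_f X" "v \<in> Delta_f X" and d: "wasserstein X u v < \<delta>"
  shows "mdp.matched \<delta> u v"
  unfolding mdp.matched_def
proof (intro ballI allI)
  fix s and n :: nat assume s: "s \<in> mdp.plays"
  have "\<exists>s'\<in>mdp.plays. \<forall>t<n. mdp.reward v s' t \<ge> (mdp.reward u s t - wasserstein X u v) - (\<delta> - wasserstein X u v)"
  proof (rule reachable_rewards[OF uv(2)])
    fix \<theta> :: "nat \<Rightarrow> real" assume \<theta>: "\<forall>t. 0 \<le> \<theta> t"
    have "(\<Sum>t<n. \<theta> t * (mdp.reward u s t - wasserstein X u v)) =
       (\<Sum>t<n. \<theta> t * mdp.reward u s t) - (\<Sum>t<n. \<theta> t) * wasserstein X u v"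
      by (simp add: right_diff_distrib sum_subtractf sum_distrib_right)
    also have "\<dots> \<le> lin_ext (V n \<theta>) v"
      using weighted_reward_le[OF \<theta> uv(1) s, of n] V_wasserstein[OF \<theta> uv, of n] by linarith
    finally show "(\<Sum>t<n. \<theta> t * (mdp.reward u s t - wasserstein X u v)) \<le> lin_ext (V n \<theta>) v" .
  qed (use d in simp)
  thus "\<exists>s'\<in>mdp.plays. \<forall>t<n. mdp.reward u s t - \<delta> \<le> mdp.reward v s' t" by simp
qed

end

sublocale controlled_game \<subseteq> mdp: precompact_control "Delta_f X" decisions law_step law_reward
proof
  fix \<delta> :: real assume "\<delta> > 0"
  from wasserstein_totally_bounded[OF X(1) this] obtain P where P: "finite P" "Delta_f X \<subseteq> \<Union>P"
     "\<forall>K\<in>P. \<forall>u\<in>K \<inter> Delta_f X. \<forall>v\<in>K \<inter> Delta_f X. wasserstein X u v < \<delta>"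
    by (elim exE conjE)
  show "\<exists>P. finite P \<and> Delta_f X \<subseteq> \<Union>P \<and>
      (\<forall>K\<in>P. \<forall>z\<in>K \<inter> Delta_f X. \<forall>z'\<in>K \<inter> Delta_f X. mdp.matched \<delta> z z')"
  proof (intro exI[of _ P] conjI ballI)
    fix K u v assume "K \<in> P" "u \<in> K \<inter> Delta_f X" "v \<in> K \<inter> Delta_f X"
    thus "mdp.matched \<delta> u v" using P(3) by (intro wasserstein_matched) auto
  qed (rule P)+
qed

section \<open>Strategies, plays and payoffs\<close>

context controlled_game
begin

abbreviation "S1 \<equiv> strategies X A B A"
abbreviation "S2 \<equiv> strategies X A B B"

lemma strategyD: "\<sigma> \<in> strategies X A B C \<Longrightarrow> h \<in> lists (X \<times> A \<times> B) \<Longrightarrow> p \<in> X \<Longrightarrow> \<sigma> h p \<in> C"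
  by (auto simp: strategies_def)

lemma play_support:
  assumes "u \<in> Delta_f X" "\<sigma> \<in> S1" "\<tau> \<in> S2"
  shows "finite (set_pmf (play l u \<sigma> \<tau> t))"
    and "(h, p) \<in> set_pmf (play l u \<sigma> \<tau> t) \<Longrightarrow> h \<in> lists (X \<times> A \<times> B)"
    and "(h, p) \<in> set_pmf (play l u \<sigma> \<tau> t) \<Longrightarrow> length h = t"
    and "(h, p) \<in> set_pmf (play l u \<sigma> \<tau> t) \<Longrightarrow> p \<in> X"
    and "(h, p) \<in> set_pmf (play l u \<sigma> \<tau> t) \<Longrightarrow> \<sigma> h p \<in> A"
    and "(h, p) \<in> set_pmf (play l u \<sigma> \<tau> t) \<Longrightarrow> \<tau> h p \<in> B"
proof -
  have main: "finite (set_pmf (play l u \<sigma> \<tau> t)) \<and> (\<forall>h p. (h, p) \<in> set_pmf (play l u \<sigma> \<tau> t) \<longrightarrow>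
      h \<in> lists (X \<times> A \<times> B) \<and> length h = t \<and> p \<in> X)"
  proof (induction t)
    case 0
    thus ?case using assms(1) by (auto simp: Delta_f_def)
  next
    case (Suc t)
    have hist: "h \<in> lists (X \<times> A \<times> B)" "length h = t" "p \<in> X" "\<sigma> h p \<in> A" "\<tau> h p \<in> B"
      "l p (\<sigma> h p) (\<tau> h p) \<in> Delta_f X" if "(h, p) \<in> set_pmf (play l u \<sigma> \<tau> t)" for h p
    proof -
      show h: "h \<in> lists (X \<times> A \<times> B)" "length h = t" "p \<in> X" using Suc that by blast+
      show "\<sigma> h p \<in> A" "\<tau> h p \<in> B"
        by (rule strategyD[OF assms(2) h(1,3)], rule strategyD[OF assms(3) h(1,3)])
      thus "l p (\<sigma> h p) (\<tau> h p) \<in> Delta_f X" by (rule l_range[OF h(3)])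
    qed
    have "finite (set_pmf (play l u \<sigma> \<tau> (Suc t)))"
      using Suc Delta_f_finite[OF hist(6)] by auto
    moreover have "h \<in> lists (X \<times> A \<times> B) \<and> length h = Suc t \<and> p \<in> X"
      if hp: "(h, p) \<in> set_pmf (play l u \<sigma> \<tau> (Suc t))" for h p
    proof -
      obtain h' p' where h': "(h', p') \<in> set_pmf (play l u \<sigma> \<tau> t)" "p \<in> set_pmf (l p' (\<sigma> h' p') (\<tau> h' p'))"
        "h = h' @ [(p', \<sigma> h' p', \<tau> h' p')]"
        using hp by auto
      show ?thesis using hist[OF h'(1)] h'(3) Delta_f_subset[OF hist(6)[OF h'(1)] h'(2)] by auto
    qed
    ultimately show ?case by blast
  qed
  show "finite (set_pmf (play l u \<sigma> \<tau> t))" using main by blast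
  assume "(h, p) \<in> set_pmf (play l u \<sigma> \<tau> t)"
  thus h: "h \<in> lists (X \<times> A \<times> B)" "length h = t" "p \<in> X" using main by blast+
  show "\<sigma> h p \<in> A" "\<tau> h p \<in> B"
    by (rule strategyD[OF assms(2) h(1,3)], rule strategyD[OF assms(3) h(1,3)])
qed

definition stage :: "'x pmf \<Rightarrow> ('x, 'a, 'b, 'a) strategy \<Rightarrow> ('x, 'a, 'b, 'b) strategy \<Rightarrow> nat \<Rightarrow>
    ('x \<Rightarrow> 'a \<Rightarrow> 'b \<Rightarrow> real) \<Rightarrow> real" where
  "stage u \<sigma> \<tau> t G = lin_ext (\<lambda>(h, p). G p (\<sigma> h p) (\<tau> h p)) (play l u \<sigma> \<tau> t)"

lemma lin_ext_play_Suc: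
  assumes "u \<in> Delta_f X" "\<sigma> \<in> S1" "\<tau> \<in> S2"
  shows "lin_ext f (play l u \<sigma> \<tau> (Suc t)) = lin_ext (\<lambda>(h, p).
     lin_ext (\<lambda>q. f (h @ [(p, \<sigma> h p, \<tau> h p)], q)) (next_law p (\<sigma> h p))) (play l u \<sigma> \<tau> t)"
proof -
  note sup = play_support(1)[OF assms, of t]
  note ab = play_support(5,6,4)[OF assms, of _ _ t]
  have "lin_ext f (play l u \<sigma> \<tau> (Suc t)) = lin_ext (\<lambda>y. lin_ext f
      (case y of (h, p) \<Rightarrow> map_pmf (\<lambda>q. (h @ [(p, \<sigma> h p, \<tau> h p)], q)) (l p (\<sigma> h p) (\<tau> h p)))) (play l u \<sigma> \<tau> t)"
    unfolding play.simps
    by (rule lin_ext_bind) (use sup Delta_f_finite[OF l_range[OF ab(3) ab(1) ab(2)]] in auto)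
  also have "\<dots> = lin_ext (\<lambda>(h, p).
     lin_ext (\<lambda>q. f (h @ [(p, \<sigma> h p, \<tau> h p)], q)) (next_law p (\<sigma> h p))) (play l u \<sigma> \<tau> t)"
    by (rule lin_ext_cong) (auto simp: l_eq[OF ab(3) ab(1) ab(2)])
  finally show ?thesis .
qed

lemma lin_ext_past_triple:
  assumes "u \<in> Delta_f X" "\<sigma> \<in> S1" "\<tau> \<in> S2" "t < T"
  shows "lin_ext (\<lambda>(h, q). case h ! t of (p, a, b) \<Rightarrow> G p a b) (play l u \<sigma> \<tau> T) = stage u \<sigma> \<tau> t G"
  using assms(4)
proof (induction T)
  case (Suc T)
  note len = play_support(3)[OF assms(1-3), of _ _ T]
  show ?case
  proof (cases "t = T")
    case True
    show ?thesis unfolding lin_ext_play_Suc[OF assms(1-3)] stage_def True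
      by (rule lin_ext_cong) (auto simp: nth_append dest: len)
  next
    case False
    have "lin_ext (\<lambda>(h, q). case h ! t of (p, a, b) \<Rightarrow> G p a b) (play l u \<sigma> \<tau> (Suc T)) =
      lin_ext (\<lambda>(h, q). case h ! t of (p, a, b) \<Rightarrow> G p a b) (play l u \<sigma> \<tau> T)"
      unfolding lin_ext_play_Suc[OF assms(1-3)]
      by (rule lin_ext_cong) (use False Suc.prems in \<open>auto simp: nth_append dest: len\<close>)
    thus ?thesis using Suc False by simp
  qed
qed simp

lemma payoff_eq_stages:
  assumes "u \<in> Delta_f X" "\<sigma> \<in> S1" "\<tau> \<in> S2"
  shows "payoff g l u m n \<sigma> \<tau> = (\<Sum>t=m..<m+n. stage u \<sigma> \<tau> t g) / n"
proof -
  let ?P = "play l u \<sigma> \<tau> (m + n)"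
  let ?H = "\<lambda>t (h, q :: 'x). case h ! t of (p, a, b) \<Rightarrow> g p a b"
  have fin: "finite (set_pmf ?P)" using play_support(1)[OF assms] by auto
  have "payoff g l u m n \<sigma> \<tau> = lin_ext (\<lambda>x. (1 / n) * (\<Sum>t=m+1..m+n. ?H (t - 1) x)) ?P"
    unfolding payoff_def by (rule lin_ext_cong) auto
  also have "\<dots> = (1 / n) * (\<Sum>t=m+1..m+n. lin_ext (?H (t - 1)) ?P)"
    unfolding lin_ext_cmult by (subst Bochner_Integration.integral_sum) (simp_all add: fin)
  also have "(\<Sum>t=m+1..m+n. lin_ext (?H (t - 1)) ?P) = (\<Sum>t=m..<m+n. lin_ext (?H t) ?P)"
    by (rule sum.reindex_bij_witness[of _ Suc "\<lambda>t. t - 1"]) auto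
  also have "\<dots> = (\<Sum>t=m..<m+n. stage u \<sigma> \<tau> t g)"
    by (rule sum.cong[OF refl lin_ext_past_triple[OF assms]]) auto
  finally show ?thesis by simp
qed

lemma stage_mono:
  assumes "u \<in> Delta_f X" "\<sigma> \<in> S1" "\<tau> \<in> S2"
    and "\<And>h p. h \<in> lists (X \<times> A \<times> B) \<Longrightarrow> p \<in> X \<Longrightarrow>
      G p (\<sigma> h p) (\<tau> h p) \<le> G' p (\<sigma> h p) (\<tau> h p) + c"
  shows "stage u \<sigma> \<tau> t G \<le> stage u \<sigma> \<tau> t G' + c"
proof -
  note sup = play_support(1)[OF assms(1-3), of t]
  note hist = play_support(2,4)[OF assms(1-3), of _ _ t]
  have "stage u \<sigma> \<tau> t G \<le> lin_ext (\<lambda>y. (case y of (h, p) \<Rightarrow> G' p (\<sigma> h p) (\<tau> h p)) + c) (play l u \<sigma> \<tau> t)"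
    unfolding stage_def by (rule lin_ext_mono) (use sup in \<open>auto intro!: assms(4) dest: hist\<close>)
  also have "\<dots> = stage u \<sigma> \<tau> t G' + c" unfolding stage_def using sup by simp
  finally show ?thesis .
qed

lemma stage_secured_le:
  assumes "u \<in> Delta_f X" "\<sigma> \<in> S1" "\<tau> \<in> S2"
  shows "stage u \<sigma> \<tau> t (\<lambda>p a b. secured p a) \<le> stage u \<sigma> \<tau> t g"
  using stage_mono[OF assms, of "\<lambda>p a b. secured p a" g 0 t] secured_le strategyD[OF assms(2)] strategyD[OF assms(3)]
  by simp

lemma stage_g_range:
  assumes "u \<in> Delta_f X" "\<sigma> \<in> S1" "\<tau> \<in> S2"
  shows "0 \<le> stage u \<sigma> \<tau> t g \<and> stage u \<sigma> \<tau> t g \<le> 1"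
  unfolding stage_def
  using g_range[OF play_support(4,5,6)[OF assms, of _ _ t]] play_support(1)[OF assms, of t]
  by (auto intro!: lin_ext_le lin_ext_ge)

lemma payoff_range:
  assumes "u \<in> Delta_f X" "\<sigma> \<in> S1" "\<tau> \<in> S2"
  shows "0 \<le> payoff g l u m n \<sigma> \<tau> \<and> payoff g l u m n \<sigma> \<tau> \<le> 1"
proof -
  have "(\<Sum>t=m..<m+n. stage u \<sigma> \<tau> t g) \<le> (\<Sum>t=m..<m+n. 1)"
    by (rule sum_mono) (use stage_g_range[OF assms] in auto)
  moreover have "0 \<le> (\<Sum>t=m..<m+n. stage u \<sigma> \<tau> t g)"
    by (rule sum_nonneg) (use stage_g_range[OF assms] in auto)
  ultimately show ?thesis unfolding payoff_eq_stages[OF assms] by (auto simp: divide_le_eq)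
qed

text \<open>
  If the expected potential plus the weighted payoff grows by at most \<open>e t\<close> at stage \<open>t\<close>, then the
  growth accumulates along the play. It is applied with values as potentials: for any pair of
  strategies to bound what is secured, and for replies of player 2 to bound what is paid.
\<close>

lemma potential_bound:
  assumes u: "u \<in> Delta_f X" "\<sigma> \<in> S1" "\<tau> \<in> S2"
    and drift: "\<And>t h p. t < T \<Longrightarrow> h \<in> lists (X \<times> A \<times> B) \<Longrightarrow> length h = t \<Longrightarrow> p \<in> X \<Longrightarrow>
      c t * G p (\<sigma> h p) (\<tau> h p) + lin_ext (F (Suc t)) (next_law p (\<sigma> h p)) \<le> F t p + e t"
  shows "(\<Sum>t<T. c t * stage u \<sigma> \<tau> t G) + lin_ext (\<lambda>(h, p). F T p) (play l u \<sigma> \<tau> T)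
    \<le> lin_ext (F 0) u + (\<Sum>t<T. e t)"
  using drift
proof (induction T)
  case (Suc T)
  note sup = play_support(1)[OF u, of T]
  note hist = play_support(2-4)[OF u, of _ _ T]
  let ?P = "play l u \<sigma> \<tau> T"
  have "c T * stage u \<sigma> \<tau> T G + lin_ext (\<lambda>(h, p). F (Suc T) p) (play l u \<sigma> \<tau> (Suc T)) =
    lin_ext (\<lambda>y. c T * (case y of (h, p) \<Rightarrow> G p (\<sigma> h p) (\<tau> h p)) +
      (case y of (h, p) \<Rightarrow> lin_ext (F (Suc T)) (next_law p (\<sigma> h p)))) ?P"
    unfolding lin_ext_play_Suc[OF u] stage_def using sup by simp
  also have "\<dots> \<le> lin_ext (\<lambda>y. (case y of (h, p) \<Rightarrow> F T p) + e T) ?P"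
    by (rule lin_ext_mono) (use sup in \<open>auto intro!: Suc.prems dest: hist\<close>)
  also have "\<dots> = lin_ext (\<lambda>(h, p). F T p) ?P + e T" using sup by simp
  finally show ?case using Suc.IH Suc.prems by simp
qed simp

text \<open>
  Strategies that depend on the history do not increase weighted rewards.
\<close>

lemma weighted_secured_le:
  assumes u: "u \<in> Delta_f X" "\<sigma> \<in> S1" "\<tau> \<in> S2" and \<theta>: "\<forall>t. 0 \<le> \<theta> t"
  shows "(\<Sum>t<n. \<theta> t * stage u \<sigma> \<tau> t (\<lambda>p a b. secured p a)) \<le> lin_ext (V n \<theta>) u"
proof -
  have "(\<Sum>t<n. \<theta> t * stage u \<sigma> \<tau> t (\<lambda>p a b. secured p a)) +
     lin_ext (\<lambda>(h, p). V (n - n) (\<lambda>i. \<theta> (n + i)) p) (play l u \<sigma> \<tau> n) \<le>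
     lin_ext (V (n - 0) (\<lambda>i. \<theta> (0 + i))) u + (\<Sum>t<n. 0)"
  proof (rule potential_bound[OF u, where F = "\<lambda>t. V (n - t) (\<lambda>i. \<theta> (t + i))"])
    fix t h p assume t: "t < n" and h: "h \<in> lists (X \<times> A \<times> B)" "length h = t" "p \<in> X"
    have "\<theta> (t + 0) * secured p (\<sigma> h p) + lin_ext (V (n - Suc t) (\<lambda>i. \<theta> (t + Suc i))) (next_law p (\<sigma> h p))
       \<le> V (Suc (n - Suc t)) (\<lambda>i. \<theta> (t + i)) p"
      by (rule V_upper) (use \<theta> h strategyD[OF u(2)] in auto)
    thus "\<theta> t * secured p (\<sigma> h p) + lin_ext (V (n - Suc t) (\<lambda>i. \<theta> (Suc t + i))) (next_law p (\<sigma> h p))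
       \<le> V (n - t) (\<lambda>i. \<theta> (t + i)) p + 0" using t by (simp add: Suc_diff_Suc del: V.simps)
  qed
  thus ?thesis by (simp add: case_prod_unfold)
qed

definition reply :: "nat \<Rightarrow> (nat \<Rightarrow> real) \<Rightarrow> real \<Rightarrow> 'x \<Rightarrow> 'b" where
  "reply n \<theta> \<epsilon> p = (SOME b. b \<in> B \<and> (\<forall>a\<in>A.
     \<theta> 0 * g p a b + lin_ext (V n (\<lambda>t. \<theta> (Suc t))) (next_law p a) \<le> V (Suc n) \<theta> p + \<epsilon>))"

lemma reply:
  assumes "\<forall>t. 0 \<le> \<theta> t" "p \<in> X" "\<epsilon> > 0"
  shows "reply n \<theta> \<epsilon> p \<in> B"
    and "a \<in> A \<Longrightarrow> \<theta> 0 * g p a (reply n \<theta> \<epsilon> p) + lin_ext (V n (\<lambda>t. \<theta> (Suc t))) (next_law p a)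
       \<le> V (Suc n) \<theta> p + \<epsilon>"
proof -
  have "\<exists>b. b \<in> B \<and> (\<forall>a\<in>A. \<theta> 0 * g p a b + lin_ext (V n (\<lambda>t. \<theta> (Suc t))) (next_law p a) \<le> V (Suc n) \<theta> p + \<epsilon>)"
    using optimal_reply[OF assms, of n] by blast
  from someI_ex[OF this, folded reply_def]
  show "reply n \<theta> \<epsilon> p \<in> B"
    and "a \<in> A \<Longrightarrow> \<theta> 0 * g p a (reply n \<theta> \<epsilon> p) + lin_ext (V n (\<lambda>t. \<theta> (Suc t))) (next_law p a)
       \<le> V (Suc n) \<theta> p + \<epsilon>" by blast+
qed

text \<open>
  Weights that select the stages counted by \<^const>\<open>v_tilde\<close>, namely those following the first \<open>m\<close>.
\<close>

definition late :: "nat \<Rightarrow> nat \<Rightarrow> real" where "late m t = (if t < m then 0 else 1)"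

lemma late_nonneg: "\<forall>t. 0 \<le> late m t" by (simp add: late_def)

lemma sum_late: "(\<Sum>t<m+n. late m t * h t) = (\<Sum>t=m..<m+n. h t)"
proof -
  have "(\<Sum>t<m+n. late m t * h t) = (\<Sum>t<m. late m t * h t) + (\<Sum>t=m..<m+n. late m t * h t)"
    using sum.atLeastLessThan_concat[of 0 m "m+n" "\<lambda>t. late m t * h t"] by (simp add: lessThan_atLeast0)
  also have "(\<Sum>t<m. late m t * h t) = 0" by (rule sum.neutral) (simp add: late_def)
  also have "(\<Sum>t=m..<m+n. late m t * h t) = (\<Sum>t=m..<m+n. h t)" by (rule sum.cong) (auto simp: late_def)
  finally show ?thesis by simp
qed

lemma opt_avg_eq:
  assumes u: "u \<in> Delta_f X" and n: "n \<ge> 1"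
  shows "n * mdp.opt_avg m n u = lin_ext (V (m + n) (late m)) u"
proof (rule antisym)
  have "mdp.opt_avg m n u \<le> lin_ext (V (m + n) (late m)) u / n"
  proof (rule mdp.opt_avg_least)
    fix s assume s: "s \<in> mdp.plays"
    have "(\<Sum>t=m..<m+n. mdp.reward u s t) \<le> lin_ext (V (m + n) (late m)) u"
      using weighted_reward_le[OF late_nonneg[of m] u s, of "m+n"] by (simp only: sum_late)
    thus "mdp.avg u s m n \<le> lin_ext (V (m + n) (late m)) u / n"
      using n by (simp add: mdp.avg_def divide_right_mono)
  qed
  thus "n * mdp.opt_avg m n u \<le> lin_ext (V (m + n) (late m)) u" using n by (simp add: field_simps)
  show "lin_ext (V (m + n) (late m)) u \<le> n * mdp.opt_avg m n u"
  proof (rule field_le_epsilon)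
    fix \<epsilon> :: real assume "\<epsilon> > 0"
    from near_optimal_weighted[OF late_nonneg[of m] this, of "m+n"] u
    obtain s where s: "s \<in> mdp.plays" "(\<Sum>t=m..<m+n. mdp.reward u s t) \<ge> lin_ext (V (m + n) (late m)) u - \<epsilon>"
      unfolding sum_late by blast
    have "(\<Sum>t=m..<m+n. mdp.reward u s t) = n * mdp.avg u s m n" using n by (simp add: mdp.avg_def)
    also have "\<dots> \<le> n * mdp.opt_avg m n u" by (intro mult_left_mono mdp.avg_le_opt_avg u s) simp
    finally show "lin_ext (V (m + n) (late m)) u \<le> n * mdp.opt_avg m n u + \<epsilon>" using s by linarith
  qed
qed

lemma finite_horizon_reply:
  fixes \<epsilon> :: real
  assumes \<theta>: "\<forall>t. 0 \<le> \<theta> t" and e: "\<epsilon> > 0"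
  shows "\<exists>\<tau>\<in>S2. \<forall>u\<in>Delta_f X. \<forall>\<sigma>\<in>S1.
     (\<Sum>t<n. \<theta> t * stage u \<sigma> \<tau> t g) \<le> lin_ext (V n \<theta>) u + n * \<epsilon>"
proof -
  define \<tau> :: "('x, 'a, 'b, 'b) strategy" where
    "\<tau> h p = reply (n - Suc (length h)) (\<lambda>i. \<theta> (length h + i)) \<epsilon> p" for h p
  have \<theta>': "\<forall>i. 0 \<le> \<theta> (k + i)" for k using \<theta> by simp
  have \<tau>: "\<tau> \<in> S2" unfolding strategies_def \<tau>_def using \<theta>' e by (auto intro!: reply(1))
  have "(\<Sum>t<n. \<theta> t * stage u \<sigma> \<tau> t g) \<le> lin_ext (V n \<theta>) u + n * \<epsilon>"
    if u: "u \<in> Delta_f X" "\<sigma> \<in> S1" for u \<sigma>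
  proof -
    have "(\<Sum>t<n. \<theta> t * stage u \<sigma> \<tau> t g) +
       lin_ext (\<lambda>(h, p). V (n - n) (\<lambda>i. \<theta> (n + i)) p) (play l u \<sigma> \<tau> n) \<le>
       lin_ext (V (n - 0) (\<lambda>i. \<theta> (0 + i))) u + (\<Sum>t<n. \<epsilon>)"
    proof (rule potential_bound[OF u \<tau>, where F = "\<lambda>t. V (n - t) (\<lambda>i. \<theta> (t + i))"])
      fix t h p assume t: "t < n" and h: "h \<in> lists (X \<times> A \<times> B)" "length h = t" "p \<in> X"
      have "\<theta> (t + 0) * g p (\<sigma> h p) (\<tau> h p) + lin_ext (V (n - Suc t) (\<lambda>i. \<theta> (t + Suc i))) (next_law p (\<sigma> h p))
         \<le> V (Suc (n - Suc t)) (\<lambda>i. \<theta> (t + i)) p + \<epsilon>"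
        unfolding \<tau>_def h(2) by (rule reply(2)[OF \<theta>' h(3) e strategyD[OF u(2) h(1,3)]])
      thus "\<theta> t * g p (\<sigma> h p) (\<tau> h p) + lin_ext (V (n - Suc t) (\<lambda>i. \<theta> (Suc t + i))) (next_law p (\<sigma> h p))
         \<le> V (n - t) (\<lambda>i. \<theta> (t + i)) p + \<epsilon>" using t by (simp add: Suc_diff_Suc del: V.simps)
    qed
    thus ?thesis by (simp add: case_prod_unfold)
  qed
  with \<tau> show ?thesis by blast
qed

text \<open>
  The reply restarts an \<open>n\<close>-stage strategy at each multiple of \<open>n\<close>. To bound the payoff of block \<open>k\<close>,
  the potential before this block is the best expected value of the \<open>n\<close>-stage game that will start at
  its beginning, that is \<open>V\<close> with the weights \<open>late (k * n)\<close>.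
\<close>

lemma block_reply:
  assumes n: "n \<ge> 1" and e: "\<epsilon> > 0"
  shows "\<exists>\<tau>\<in>Tau2M X A B. \<forall>u\<in>Delta_f X. \<forall>\<sigma>\<in>S1. \<forall>k.
     (\<Sum>t=k*n..<k*n+n. stage u \<sigma> \<tau> t g) \<le> n * (mdp.opt_avg (k * n) n u + \<epsilon>)"
proof -
  define \<tau> :: "('x, 'a, 'b, 'b) strategy" where
    "\<tau> h p = reply (n - Suc (length h mod n)) (\<lambda>_. 1) \<epsilon> p" for h p
  have "\<tau> \<in> Tau2M X A B"
    using reply(1)[OF _ _ e] by (auto simp: strategies_def markov_strategies_def \<tau>_def)
  hence \<tau>: "\<tau> \<in> S2" by (simp add: markov_strategies_def)
  have "(\<Sum>t=k*n..<k*n+n. stage u \<sigma> \<tau> t g) \<le> n * (mdp.opt_avg (k * n) n u + \<epsilon>)"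
    if u: "u \<in> Delta_f X" "\<sigma> \<in> S1" for u \<sigma> k
  proof -
    define m where "m = k * n"
    \<comment> \<open>errors of \<open>\<epsilon>\<close> are made inside the block only, hence the factor \<open>late m t\<close>\<close>
    have "(\<Sum>t<m+n. late m t * stage u \<sigma> \<tau> t g) +
       lin_ext (\<lambda>(h, p). V (m + n - (m + n)) (\<lambda>i. late m (m + n + i)) p) (play l u \<sigma> \<tau> (m + n)) \<le>
       lin_ext (V (m + n - 0) (\<lambda>i. late m (0 + i))) u + (\<Sum>t<m+n. late m t * \<epsilon>)"
    proof (rule potential_bound[OF u \<tau>, where F = "\<lambda>t. V (m + n - t) (\<lambda>i. late m (t + i))"])
      fix t h p assume t: "t < m + n" and h: "h \<in> lists (X \<times> A \<times> B)" "length h = t" "p \<in> X"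
      have a: "\<sigma> h p \<in> A" by (rule strategyD[OF u(2) h(1,3)])
      have nn: "\<forall>i. 0 \<le> late m (t + i)" using late_nonneg by simp
      have "late m (t + 0) * g p (\<sigma> h p) (\<tau> h p) +
          lin_ext (V (m + n - Suc t) (\<lambda>i. late m (t + Suc i))) (next_law p (\<sigma> h p))
         \<le> V (Suc (m + n - Suc t)) (\<lambda>i. late m (t + i)) p + late m t * \<epsilon>"
      proof (cases "t < m")
        case True
        thus ?thesis using V_upper[OF nn h(3) a, of "m + n - Suc t"] by (simp add: late_def del: V.simps)
      next
        case False
        define j where "j = t - m"
        have j: "t = m + j" "j < n" using False t by (auto simp: j_def)
        have "length h mod n = j" unfolding h(2) j(1) m_def using j(2) by simp
        hence \<tau>h: "\<tau> h p = reply (n - Suc j) (\<lambda>_. 1) \<epsilon> p" by (simp add: \<tau>_def)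
        have "(\<lambda>i. late m (t + i)) = (\<lambda>_. 1)" "(\<lambda>i. late m (t + Suc i)) = (\<lambda>_. 1)" "late m t = 1" "m + n - Suc t = n - Suc j"
          using False j by (auto simp: late_def)
        moreover have "1 * g p (\<sigma> h p) (\<tau> h p) + lin_ext (V (n - Suc j) (\<lambda>_. 1)) (next_law p (\<sigma> h p))
            \<le> V (Suc (n - Suc j)) (\<lambda>_. 1) p + \<epsilon>"
          unfolding \<tau>h using reply(2)[OF _ h(3) e a, of "\<lambda>_. 1"] by simp
        ultimately show ?thesis by (simp only: add_0_right mult_1)
      qed
      thus "late m t * g p (\<sigma> h p) (\<tau> h p) + lin_ext (V (m + n - Suc t) (\<lambda>i. late m (Suc t + i))) (next_law p (\<sigma> h p))
         \<le> V (m + n - t) (\<lambda>i. late m (t + i)) p + late m t * \<epsilon>"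
        using t by (simp add: Suc_diff_Suc del: V.simps)
    qed
    hence "(\<Sum>t=m..<m+n. stage u \<sigma> \<tau> t g) \<le> lin_ext (V (m + n) (late m)) u + n * \<epsilon>"
      unfolding sum_late by (simp add: case_prod_unfold)
    also have "\<dots> = n * (mdp.opt_avg m n u + \<epsilon>)"
      using opt_avg_eq[OF u(1) n, of m] by (simp add: distrib_left)
    finally show ?thesis unfolding m_def .
  qed
  with \<open>\<tau> \<in> Tau2M X A B\<close> show ?thesis by blast
qed

definition markov :: "(nat \<Rightarrow> 'x \<Rightarrow> 'a) \<Rightarrow> ('x, 'a, 'b, 'a) strategy" where
  "markov s h p = s (length h) p"

lemma markov_strategy: "s \<in> mdp.plays \<Longrightarrow> markov s \<in> Sigma1M X A B"
  unfolding markov_strategies_def strategies_def markov_def mdp.plays_def by (auto simp: decisions_def)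

lemma markov_strategy': "s \<in> mdp.plays \<Longrightarrow> markov s \<in> S1"
  using markov_strategy by (simp add: markov_strategies_def)

text \<open>
  Under a Markov strategy of player 1 the law of the current state is the same for all strategies
  of player 2.
\<close>

lemma lin_ext_play_markov:
  assumes u: "u \<in> Delta_f X" and s: "s \<in> mdp.plays" and \<tau>: "\<tau> \<in> S2"
  shows "lin_ext (\<lambda>(h, p). f p) (play l u (markov s) \<tau> t) = lin_ext f (mdp.state u s t)"
proof (induction t arbitrary: f)
  case (Suc t)
  have st: "s t \<in> decisions" using s by (simp add: mdp.plays_def)
  have "lin_ext (\<lambda>(h, p). f p) (play l u (markov s) \<tau> (Suc t)) =
      lin_ext (\<lambda>(h, p). lin_ext f (next_law p (s t p))) (play l u (markov s) \<tau> t)"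
    unfolding lin_ext_play_Suc[OF u markov_strategy'[OF s] \<tau>]
    by (rule lin_ext_cong) (auto simp: markov_def dest: play_support(3)[OF u markov_strategy'[OF s] \<tau>])
  also have "\<dots> = lin_ext (\<lambda>p. lin_ext f (next_law p (s t p))) (mdp.state u s t)" by (rule Suc.IH)
  also have "\<dots> = lin_ext f (mdp.state u s (Suc t))"
    using lin_ext_law_step[OF mdp.state_closed[OF u s] st] by simp
  finally show ?case .
qed simp

lemma stage_markov:
  assumes u: "u \<in> Delta_f X" and s: "s \<in> mdp.plays" and \<tau>: "\<tau> \<in> S2"
  shows "stage u (markov s) \<tau> t (\<lambda>p a b. secured p a) = mdp.reward u s t"
proof -
  have "stage u (markov s) \<tau> t (\<lambda>p a b. secured p a) = lin_ext (\<lambda>(h, p). secured p (s t p)) (play l u (markov s) \<tau> t)"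
    unfolding stage_def
    by (rule lin_ext_cong) (auto simp: markov_def dest: play_support(3)[OF u markov_strategy'[OF s] \<tau>])
  thus ?thesis using lin_ext_play_markov[OF assms, where f = "\<lambda>p. secured p (s t p)" and t = t]
    by (simp add: mdp.reward_def law_reward_def)
qed

lemma markov_payoff_ge:
  assumes u: "u \<in> Delta_f X" and s: "s \<in> mdp.plays" and \<tau>: "\<tau> \<in> S2"
  shows "mdp.avg u s m n \<le> payoff g l u m n (markov s) \<tau>"
proof -
  have "(\<Sum>t=m..<m+n. mdp.reward u s t) \<le> (\<Sum>t=m..<m+n. stage u (markov s) \<tau> t g)"
    by (rule sum_mono) (use stage_secured_le[OF u markov_strategy'[OF s] \<tau>] stage_markov[OF assms] in simp)
  thus ?thesis unfolding payoff_eq_stages[OF u markov_strategy'[OF s] \<tau>]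
    by (simp add: mdp.avg_def divide_right_mono)
qed

lemma S1_nonempty: "S1 \<noteq> {}" and S2_nonempty: "S2 \<noteq> {}"
proof -
  obtain a b where "a \<in> A" "b \<in> B" using nonempty by auto
  hence "(\<lambda>_ _. a) \<in> S1" "(\<lambda>_ _. b) \<in> S2" by (auto simp: strategies_def)
  thus "S1 \<noteq> {}" "S2 \<noteq> {}" by auto
qed

text \<open>
  The infimum over strategies of player 2 is taken after \<open>\<sigma>\<close> is fixed, so his strategy may anticipate
  the action that \<open>\<sigma>\<close> prescribes.
\<close>

lemma myopic_reply:
  assumes \<sigma>: "\<sigma> \<in> S1" and e: "\<epsilon> > 0"
  shows "\<exists>\<tau>\<in>S2. \<forall>u\<in>Delta_f X. \<forall>t. stage u \<sigma> \<tau> t g \<le> stage u \<sigma> \<tau> t (\<lambda>p a b. secured p a) + \<epsilon>"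
proof -
  have "\<forall>p a. \<exists>b. p \<in> X \<and> a \<in> A \<longrightarrow> b \<in> B \<and> g p a b < secured p a + \<epsilon>"
    using secured_near[OF _ _ e] by blast
  then obtain b where b: "\<And>p a. p \<in> X \<Longrightarrow> a \<in> A \<Longrightarrow> b p a \<in> B \<and> g p a (b p a) < secured p a + \<epsilon>" by metis
  define \<tau> :: "('x, 'a, 'b, 'b) strategy" where "\<tau> h p = b p (\<sigma> h p)" for h p
  have \<tau>: "\<tau> \<in> S2" using b strategyD[OF \<sigma>] by (auto simp: strategies_def \<tau>_def)
  have "stage u \<sigma> \<tau> t g \<le> stage u \<sigma> \<tau> t (\<lambda>p a b. secured p a) + \<epsilon>" if "u \<in> Delta_f X" for u t
    by (rule stage_mono[OF that \<sigma> \<tau>]) (simp add: \<tau>_def less_imp_le b strategyD[OF \<sigma>])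
  with \<tau> show ?thesis by blast
qed

lemma payoff_bdd:
  assumes "u \<in> Delta_f X"
  shows "\<sigma> \<in> S1 \<Longrightarrow> bdd_below ((\<lambda>\<tau>. payoff g l u m n \<sigma> \<tau>) ` S2)"
    and "\<tau> \<in> S2 \<Longrightarrow> bdd_above ((\<lambda>\<sigma>. payoff g l u m n \<sigma> \<tau>) ` S1)"
  using payoff_range[OF assms] by (auto intro!: bdd_belowI2[of _ 0] bdd_aboveI2[of _ _ 1])

lemma near_optimal_reply:
  assumes u: "u \<in> Delta_f X" and n: "n \<ge> 1" and e: "\<epsilon> > 0"
  shows "\<exists>\<tau>\<in>S2. \<forall>\<sigma>\<in>S1. payoff g l u m n \<sigma> \<tau> \<le> mdp.opt_avg m n u + \<epsilon>"
proof -
  \<comment> \<open>errors accumulate over \<open>m + n\<close> stages and are divided by \<open>n\<close>\<close>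
  define \<epsilon>' where "\<epsilon>' = n * \<epsilon> / (m + n)"
  have e': "\<epsilon>' > 0" "(m + n) * \<epsilon>' = n * \<epsilon>" using e n by (auto simp: \<epsilon>'_def)
  obtain \<tau> where \<tau>: "\<tau> \<in> S2" "\<And>\<sigma>. \<sigma>\<in>S1 \<Longrightarrow>
     (\<Sum>t<m+n. late m t * stage u \<sigma> \<tau> t g) \<le> lin_ext (V (m + n) (late m)) u + real (m + n) * \<epsilon>'"
    using finite_horizon_reply[OF late_nonneg[of m] e'(1), of "m + n"] u by blast
  have "payoff g l u m n \<sigma> \<tau> \<le> mdp.opt_avg m n u + \<epsilon>" if \<sigma>: "\<sigma> \<in> S1" for \<sigma>
  proof -
    have "(\<Sum>t=m..<m+n. stage u \<sigma> \<tau> t g) \<le> n * (mdp.opt_avg m n u + \<epsilon>)"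
      using \<tau>(2)[OF \<sigma>] e'(2) opt_avg_eq[OF u n, of m] unfolding sum_late by (simp add: distrib_left)
    thus ?thesis using n unfolding payoff_eq_stages[OF u \<sigma> \<tau>(1)]
      by (simp add: divide_le_eq mult.commute)
  qed
  with \<tau>(1) show ?thesis by blast
qed

lemma v_tilde_eq:
  assumes u: "u \<in> Delta_f X" and n: "n \<ge> 1"
  shows "v_tilde X A B g l m n u = mdp.opt_avg m n u"
    and "(INF \<tau>\<in>S2. SUP \<sigma>\<in>S1. payoff g l u m n \<sigma> \<tau>) = mdp.opt_avg m n u"
proof -
  have low: "mdp.opt_avg m n u \<le> v_tilde X A B g l m n u"
  proof (rule mdp.opt_avg_least)
    fix s assume s: "s \<in> mdp.plays"
    have "mdp.avg u s m n \<le> (INF \<tau>\<in>S2. payoff g l u m n (markov s) \<tau>)"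
      by (rule cINF_greatest[OF S2_nonempty markov_payoff_ge[OF u s]])
    also have "\<dots> \<le> v_tilde X A B g l m n u" unfolding v_tilde_def
    proof (rule cSUP_upper[OF markov_strategy'[OF s]], rule bdd_aboveI2)
      fix \<sigma> assume \<sigma>: "\<sigma> \<in> S1"
      obtain \<tau> where "\<tau> \<in> S2" using S2_nonempty by auto
      thus "(INF \<tau>\<in>S2. payoff g l u m n \<sigma> \<tau>) \<le> 1"
        using payoff_range[OF u \<sigma>] by (intro cINF_lower2[OF payoff_bdd(1)[OF u \<sigma>]]) auto
    qed
    finally show "mdp.avg u s m n \<le> v_tilde X A B g l m n u" .
  qed
  have up: "v_tilde X A B g l m n u \<le> mdp.opt_avg m n u"
  proof (rule field_le_epsilon)
    fix \<epsilon> :: real assume "\<epsilon> > 0"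
    then obtain \<tau> where \<tau>: "\<tau> \<in> S2" "\<And>\<sigma>. \<sigma>\<in>S1 \<Longrightarrow> payoff g l u m n \<sigma> \<tau> \<le> mdp.opt_avg m n u + \<epsilon>"
      using near_optimal_reply[OF u n] by blast
    show "v_tilde X A B g l m n u \<le> mdp.opt_avg m n u + \<epsilon>" unfolding v_tilde_def
    proof (rule cSUP_least[OF S1_nonempty])
      fix \<sigma> assume \<sigma>: "\<sigma> \<in> S1"
      show "(INF \<tau>\<in>S2. payoff g l u m n \<sigma> \<tau>) \<le> mdp.opt_avg m n u + \<epsilon>"
        by (rule cINF_lower2[OF payoff_bdd(1)[OF u \<sigma>] \<tau>(1)]) (rule \<tau>(2)[OF \<sigma>])
    qed
  qed
  show "v_tilde X A B g l m n u = mdp.opt_avg m n u" using low up by simp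
  have sup_ge: "mdp.opt_avg m n u \<le> (SUP \<sigma>\<in>S1. payoff g l u m n \<sigma> \<tau>)" if \<tau>: "\<tau> \<in> S2" for \<tau>
  proof (rule mdp.opt_avg_least)
    fix s assume s: "s \<in> mdp.plays"
    show "mdp.avg u s m n \<le> (SUP \<sigma>\<in>S1. payoff g l u m n \<sigma> \<tau>)"
      by (rule cSUP_upper2[OF payoff_bdd(2)[OF u \<tau>] markov_strategy'[OF s]])
         (rule markov_payoff_ge[OF u s \<tau>])
  qed
  have bdd: "bdd_below ((\<lambda>\<tau>. SUP \<sigma>\<in>S1. payoff g l u m n \<sigma> \<tau>) ` S2)"
    using sup_ge by (rule bdd_belowI2)
  show "(INF \<tau>\<in>S2. SUP \<sigma>\<in>S1. payoff g l u m n \<sigma> \<tau>) = mdp.opt_avg m n u"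
  proof (rule antisym)
    show "(INF \<tau>\<in>S2. SUP \<sigma>\<in>S1. payoff g l u m n \<sigma> \<tau>) \<le> mdp.opt_avg m n u"
    proof (rule field_le_epsilon)
      fix \<epsilon> :: real assume "\<epsilon> > 0"
      then obtain \<tau> where \<tau>: "\<tau> \<in> S2" "\<And>\<sigma>. \<sigma>\<in>S1 \<Longrightarrow> payoff g l u m n \<sigma> \<tau> \<le> mdp.opt_avg m n u + \<epsilon>"
        using near_optimal_reply[OF u n] by blast
      show "(INF \<tau>\<in>S2. SUP \<sigma>\<in>S1. payoff g l u m n \<sigma> \<tau>) \<le> mdp.opt_avg m n u + \<epsilon>"
        by (rule cINF_lower2[OF bdd \<tau>(1)]) (rule cSUP_least[OF S1_nonempty \<tau>(2)])
    qed
    show "mdp.opt_avg m n u \<le> (INF \<tau>\<in>S2. SUP \<sigma>\<in>S1. payoff g l u m n \<sigma> \<tau>)"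
      by (rule cINF_greatest[OF S2_nonempty sup_ge])
  qed
qed

text \<open>
  The myopic reply makes all averages of a strategy \<open>\<sigma>\<close> as small as possible simultaneously. The
  expected rewards it leaves to \<open>\<sigma>\<close> satisfy the inequalities of \<open>reachable_rewards\<close>, so a Markov
  strategy earns as much at every stage, hence in every average.
\<close>

lemma w_val_eq:
  assumes u: "u \<in> Delta_f X" and n: "n \<ge> 1"
  shows "w_val X A B g l m n u = mdp.opt_min_avg m n u"
proof (rule antisym)
  have range: "0 \<le> Min ((\<lambda>t. payoff g l u m t \<sigma> \<tau>) ` {1..n}) \<and> Min ((\<lambda>t. payoff g l u m t \<sigma> \<tau>) ` {1..n}) \<le> 1"
    if "\<sigma> \<in> S1" "\<tau> \<in> S2" for \<sigma> \<tau>
  proof -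
    have "Min ((\<lambda>t. payoff g l u m t \<sigma> \<tau>) ` {1..n}) \<in> (\<lambda>t. payoff g l u m t \<sigma> \<tau>) ` {1..n}"
      using n by (intro Min_in) auto
    thus ?thesis using payoff_range[OF u that] by auto
  qed
  have bdd: "bdd_below ((\<lambda>\<tau>. Min ((\<lambda>t. payoff g l u m t \<sigma> \<tau>) ` {1..n})) ` S2)" if "\<sigma> \<in> S1" for \<sigma>
    using range[OF that] by (intro bdd_belowI2[of _ 0]) auto
  show "mdp.opt_min_avg m n u \<le> w_val X A B g l m n u"
  proof (rule mdp.opt_min_avg_least)
    fix s assume s: "s \<in> mdp.plays"
    have "Min (mdp.avg u s m ` {1..n}) \<le> Min ((\<lambda>t. payoff g l u m t (markov s) \<tau>) ` {1..n})"
      if \<tau>: "\<tau> \<in> S2" for \<tau>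
    proof (rule Min.boundedI)
      fix y assume "y \<in> (\<lambda>t. payoff g l u m t (markov s) \<tau>) ` {1..n}"
      then obtain t where t: "t \<in> {1..n}" "y = payoff g l u m t (markov s) \<tau>" by auto
      have "Min (mdp.avg u s m ` {1..n}) \<le> mdp.avg u s m t" using t by (intro Min_le) auto
      also have "\<dots> \<le> y" unfolding t(2) by (rule markov_payoff_ge[OF u s \<tau>])
      finally show "Min (mdp.avg u s m ` {1..n}) \<le> y" .
    qed (use n in auto)
    hence "Min (mdp.avg u s m ` {1..n}) \<le> (INF \<tau>\<in>S2. Min ((\<lambda>t. payoff g l u m t (markov s) \<tau>) ` {1..n}))"
      by (rule cINF_greatest[OF S2_nonempty])
    also have "\<dots> \<le> w_val X A B g l m n u" unfolding w_val_def
    proof (rule cSUP_upper[OF markov_strategy'[OF s]], rule bdd_aboveI2)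
      fix \<sigma> assume \<sigma>: "\<sigma> \<in> S1"
      obtain \<tau> where "\<tau> \<in> S2" using S2_nonempty by auto
      thus "(INF \<tau>\<in>S2. Min ((\<lambda>t. payoff g l u m t \<sigma> \<tau>) ` {1..n})) \<le> 1"
        using range[OF \<sigma>] by (intro cINF_lower2[OF bdd[OF \<sigma>]]) auto
    qed
    finally show "Min (mdp.avg u s m ` {1..n}) \<le> w_val X A B g l m n u" .
  qed
  show "w_val X A B g l m n u \<le> mdp.opt_min_avg m n u"
  proof (rule field_le_epsilon)
    fix \<epsilon> :: real assume "\<epsilon> > 0"
    hence e: "\<epsilon> / 2 > 0" by simp
    show "w_val X A B g l m n u \<le> mdp.opt_min_avg m n u + \<epsilon>" unfolding w_val_def
    proof (rule cSUP_least[OF S1_nonempty])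
      fix \<sigma> assume \<sigma>: "\<sigma> \<in> S1"
      obtain \<tau> where \<tau>: "\<tau> \<in> S2"
        "\<And>t. stage u \<sigma> \<tau> t g \<le> stage u \<sigma> \<tau> t (\<lambda>p a b. secured p a) + \<epsilon>/2"
        using myopic_reply[OF \<sigma> e] u by blast
      obtain s where s: "s \<in> mdp.plays"
        "\<And>t. t < m + n \<Longrightarrow> mdp.reward u s t \<ge> stage u \<sigma> \<tau> t (\<lambda>p a b. secured p a) - \<epsilon>/2"
        using reachable_rewards[OF u weighted_secured_le[OF u \<sigma> \<tau>(1)] e, of "m + n"] by blast
      have "Min ((\<lambda>t. payoff g l u m t \<sigma> \<tau>) ` {1..n}) - \<epsilon> \<le> mdp.avg u s m j" if j: "j \<in> {1..n}" for j
      proof -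
        have "(\<Sum>t=m..<m+j. stage u \<sigma> \<tau> t g) \<le> (\<Sum>t=m..<m+j. mdp.reward u s t + \<epsilon>)"
        proof (rule sum_mono)
          fix t assume "t \<in> {m..<m+j}"
          hence "t < m + n" using j by auto
          thus "stage u \<sigma> \<tau> t g \<le> mdp.reward u s t + \<epsilon>" using \<tau>(2)[of t] s(2)[of t] by linarith
        qed
        also have "\<dots> = j * (mdp.avg u s m j + \<epsilon>)"
          using j by (simp add: sum.distrib mdp.avg_def distrib_left)
        finally have "payoff g l u m j \<sigma> \<tau> \<le> mdp.avg u s m j + \<epsilon>"
          using j unfolding payoff_eq_stages[OF u \<sigma> \<tau>(1)] by (simp add: divide_le_eq mult.commute)
        moreover have "Min ((\<lambda>t. payoff g l u m t \<sigma> \<tau>) ` {1..n}) \<le> payoff g l u m j \<sigma> \<tau>"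
          using j by (intro Min_le) auto
        ultimately show ?thesis by linarith
      qed
      hence "Min ((\<lambda>t. payoff g l u m t \<sigma> \<tau>) ` {1..n}) - \<epsilon> \<le> mdp.opt_min_avg m n u"
        by (rule mdp.opt_min_avg_ge_of_good[OF u s(1) n])
      thus "(INF \<tau>\<in>S2. Min ((\<lambda>t. payoff g l u m t \<sigma> \<tau>) ` {1..n})) \<le> mdp.opt_min_avg m n u + \<epsilon>"
        by (intro cINF_lower2[OF bdd[OF \<sigma>] \<tau>(1)]) linarith
    qed
  qed
qed

section \<open>The uniform value\<close>

lemma markov_guarantee_1:
  assumes u: "u \<in> Delta_f X" and e: "\<epsilon> > 0"
  shows "\<exists>\<sigma>\<in>Sigma1M X A B. \<exists>N0\<ge>1. \<forall>N\<ge>N0. \<forall>\<tau>\<in>S2. payoff g l u 0 N \<sigma> \<tau> \<ge> mdp.limit_value u - \<epsilon>"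
proof -
  obtain s N0 where s: "s \<in> mdp.plays" "N0 \<ge> 1" "\<And>N. N \<ge> N0 \<Longrightarrow> mdp.avg u s 0 N \<ge> mdp.limit_value u - \<epsilon>"
    using mdp.near_optimal_play[OF u e] by blast
  have "payoff g l u 0 N (markov s) \<tau> \<ge> mdp.limit_value u - \<epsilon>" if "N \<ge> N0" "\<tau> \<in> S2" for N \<tau>
    using s(3)[OF that(1)] markov_payoff_ge[OF u s(1) that(2), of 0 N] by linarith
  thus ?thesis using markov_strategy[OF s(1)] s(2) by blast
qed

text \<open>
  Each complete block of the reply costs at most \<open>n\<close> times the limit value up to \<open>\<epsilon>/2\<close>; the
  incomplete last block costs at most \<open>n\<close>, which is negligible for large \<open>N\<close>.
\<close>

lemma markov_guarantee_2:
  assumes u: "u \<in> Delta_f X" and e: "\<epsilon> > 0"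
  shows "\<exists>\<tau>\<in>Tau2M X A B. \<exists>N0\<ge>1. \<forall>N\<ge>N0. \<forall>\<sigma>\<in>S1. payoff g l u 0 N \<sigma> \<tau> \<le> mdp.limit_value u + \<epsilon>"
proof -
  have e4: "\<epsilon> / 4 > 0" using e by simp
  obtain n where n: "n \<ge> 1" "\<And>m s. s \<in> mdp.plays \<Longrightarrow> mdp.avg u s m n \<le> mdp.limit_value u + \<epsilon>/4"
    using mdp.long_average_le_pointwise[OF u e4] by blast
  have v: "mdp.opt_avg m n u \<le> mdp.limit_value u + \<epsilon>/4" for m
    by (rule mdp.opt_avg_least) (rule n(2))
  obtain \<tau> where \<tau>: "\<tau> \<in> Tau2M X A B" "\<And>\<sigma> k. \<sigma> \<in> S1 \<Longrightarrow>
     (\<Sum>t=k*n..<k*n+n. stage u \<sigma> \<tau> t g) \<le> n * (mdp.opt_avg (k * n) n u + \<epsilon>/4)"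
    using block_reply[OF n(1) e4] u by blast
  have \<tau>2: "\<tau> \<in> S2" using \<tau>(1) by (simp add: markov_strategies_def)
  define c where "c = mdp.limit_value u + \<epsilon>/2"
  have c: "c \<ge> 0" using mdp.limit_value_range[OF u] e by (simp add: c_def)
  obtain N0 :: nat where N0: "2 * n / \<epsilon> < N0" using reals_Archimedean2 by blast
  have "payoff g l u 0 N \<sigma> \<tau> \<le> mdp.limit_value u + \<epsilon>" if N: "N \<ge> max 1 N0" and \<sigma>: "\<sigma> \<in> S1" for N \<sigma>
  proof -
    let ?h = "\<lambda>t. stage u \<sigma> \<tau> t g"
    have blocks: "(\<Sum>t<k * n. ?h t) \<le> k * n * c" for k
    proof (induction k)
      case (Suc k)
      have "(\<Sum>t<Suc k * n. ?h t) = (\<Sum>t<k * n. ?h t) + (\<Sum>t=k*n..<k*n+n. ?h t)"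
        using sum.atLeastLessThan_concat[of 0 "k*n" "k*n+n" ?h] by (simp add: lessThan_atLeast0 add.commute)
      also have "(\<Sum>t=k*n..<k*n+n. ?h t) \<le> n * (mdp.opt_avg (k * n) n u + \<epsilon>/4)" by (rule \<tau>(2)[OF \<sigma>])
      also have "\<dots> \<le> n * c" using v[of "k*n"] unfolding c_def by (intro mult_left_mono) auto
      finally show ?case using Suc by (simp add: algebra_simps)
    qed simp
    define k where "k = N div n"
    have Nk: "N = k * n + N mod n" "N mod n \<le> n" using n(1) by (auto simp: k_def less_imp_le)
    have "(\<Sum>t<N. ?h t) = (\<Sum>t<k * n. ?h t) + (\<Sum>t=k*n..<N. ?h t)"
      using sum.atLeastLessThan_concat[of 0 "k*n" N ?h] Nk(1) by (simp add: lessThan_atLeast0)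
    also have "(\<Sum>t=k*n..<N. ?h t) \<le> (\<Sum>t=k*n..<N. 1)"
      by (rule sum_mono) (use stage_g_range[OF u \<sigma> \<tau>2] in auto)
    also have "(\<Sum>t=k*n..<N. 1) = real (N mod n)" by (simp add: k_def flip: minus_div_mult_eq_mod)
    also have "(\<Sum>t<k * n. ?h t) \<le> k * n * c" by (rule blocks)
    also have "k * n * c \<le> N * c" using Nk(1) c by (intro mult_right_mono) (auto simp flip: of_nat_mult)
    also have "real (N mod n) \<le> n" using Nk(2) by simp
    also have "real n \<le> N * (\<epsilon>/2)"
    proof -
      have "2 * n / \<epsilon> < N" using N0 N by linarith
      thus ?thesis using e by (simp add: field_simps)
    qed
    finally have "(\<Sum>t<N. ?h t) \<le> N * (mdp.limit_value u + \<epsilon>)" by (simp add: c_def algebra_simps)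
    thus ?thesis using N unfolding payoff_eq_stages[OF u \<sigma> \<tau>2]
      by (simp add: divide_le_eq mult.commute lessThan_atLeast0)
  qed
  thus ?thesis using \<tau>(1) by (intro bexI[of _ \<tau>] exI[of _ "max 1 N0"]) auto
qed

lemma uniform_value:
  assumes u: "u \<in> Delta_f X"
  shows "is_uniform_value X A B g l u (mdp.limit_value u)"
proof -
  let ?v = "mdp.limit_value u"
  let ?lo = "lower_uniform_value X A B g l u" and ?up = "upper_uniform_value X A B g l u"
  have "?lo \<le> ?up" unfolding lower_uniform_value_def upper_uniform_value_def
  proof (rule SUP_least, rule INF_greatest)
    fix \<sigma> \<tau> assume \<sigma>: "\<sigma> \<in> S1" and \<tau>: "\<tau> \<in> S2"
    have "(INF \<tau>\<in>S2. payoff g l u 0 n \<sigma> \<tau>) \<le> (SUP \<sigma>\<in>S1. payoff g l u 0 n \<sigma> \<tau>)" for n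
      by (rule order_trans[OF cINF_lower[OF payoff_bdd(1)[OF u \<sigma>] \<tau>] cSUP_upper[OF \<sigma> payoff_bdd(2)[OF u \<tau>]]])
    hence "liminf (\<lambda>n. ereal (INF \<tau>\<in>S2. payoff g l u 0 n \<sigma> \<tau>)) \<le>
        liminf (\<lambda>n. ereal (SUP \<sigma>\<in>S1. payoff g l u 0 n \<sigma> \<tau>))" by (intro Liminf_mono) simp
    also have "\<dots> \<le> limsup (\<lambda>n. ereal (SUP \<sigma>\<in>S1. payoff g l u 0 n \<sigma> \<tau>))"
      by (rule Liminf_le_Limsup) simp
    finally show "liminf (\<lambda>n. ereal (INF \<tau>\<in>S2. payoff g l u 0 n \<sigma> \<tau>)) \<le>
        limsup (\<lambda>n. ereal (SUP \<sigma>\<in>S1. payoff g l u 0 n \<sigma> \<tau>))" .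
  qed
  moreover have "ereal ?v \<le> ?lo"
  proof (rule ereal_le_epsilon2)
    fix \<epsilon> :: real assume e: "0 < \<epsilon>"
    obtain \<sigma> N0 where \<sigma>: "\<sigma> \<in> Sigma1M X A B" "\<And>N \<tau>. N \<ge> N0 \<Longrightarrow> \<tau> \<in> S2 \<Longrightarrow> payoff g l u 0 N \<sigma> \<tau> \<ge> ?v - \<epsilon>"
      using markov_guarantee_1[OF u e] by blast
    have \<sigma>1: "\<sigma> \<in> S1" using \<sigma>(1) by (simp add: markov_strategies_def)
    have "\<forall>\<^sub>F n in sequentially. ereal (?v - \<epsilon>) \<le> ereal (INF \<tau>\<in>S2. payoff g l u 0 n \<sigma> \<tau>)"
      unfolding eventually_sequentially ereal_less_eq
      by (intro exI[of _ N0] allI impI cINF_greatest[OF S2_nonempty] \<sigma>(2))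
    hence "ereal (?v - \<epsilon>) \<le> liminf (\<lambda>n. ereal (INF \<tau>\<in>S2. payoff g l u 0 n \<sigma> \<tau>))"
      by (rule Liminf_bounded)
    also have "\<dots> \<le> ?lo" unfolding lower_uniform_value_def by (rule SUP_upper[OF \<sigma>1])
    finally have "ereal (?v - \<epsilon>) + ereal \<epsilon> \<le> ?lo + ereal \<epsilon>" by (rule add_right_mono)
    thus "ereal ?v \<le> ?lo + ereal \<epsilon>" by simp
  qed
  moreover have "?up \<le> ereal ?v"
  proof (rule ereal_le_epsilon2)
    fix \<epsilon> :: real assume e: "0 < \<epsilon>"
    obtain \<tau> N0 where \<tau>: "\<tau> \<in> Tau2M X A B" "\<And>N \<sigma>. N \<ge> N0 \<Longrightarrow> \<sigma> \<in> S1 \<Longrightarrow> payoff g l u 0 N \<sigma> \<tau> \<le> ?v + \<epsilon>"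
      using markov_guarantee_2[OF u e] by blast
    have \<tau>2: "\<tau> \<in> S2" using \<tau>(1) by (simp add: markov_strategies_def)
    have "\<forall>\<^sub>F n in sequentially. ereal (SUP \<sigma>\<in>S1. payoff g l u 0 n \<sigma> \<tau>) \<le> ereal (?v + \<epsilon>)"
      unfolding eventually_sequentially ereal_less_eq
      by (intro exI[of _ N0] allI impI cSUP_least[OF S1_nonempty] \<tau>(2))
    hence "limsup (\<lambda>n. ereal (SUP \<sigma>\<in>S1. payoff g l u 0 n \<sigma> \<tau>)) \<le> ereal (?v + \<epsilon>)"
      by (rule Limsup_bounded)
    thus "?up \<le> ereal ?v + ereal \<epsilon>"
      unfolding upper_uniform_value_def using INF_lower2[OF \<tau>2] by simp
  qed
  ultimately show ?thesis unfolding is_uniform_value_def by (meson antisym order_trans)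
qed

text \<open>
  Matching plays stage by stage compares all averages and all minima of averages.
\<close>

lemma values_nonexpansive:
  assumes u: "u \<in> Delta_f X" and v: "v \<in> Delta_f X" and n: "n \<ge> 1"
  shows "mdp.opt_avg m n u - mdp.opt_avg m n v \<le> wasserstein X u v"
    and "mdp.opt_min_avg m n u - mdp.opt_min_avg m n v \<le> wasserstein X u v"
proof -
  have W: "0 \<le> wasserstein X u v" by (rule wasserstein_nonneg[OF X(1) u v])
  have *: "mdp.matched (wasserstein X u v + \<epsilon>) u v" if "\<epsilon> > 0" for \<epsilon>
    using that by (intro wasserstein_matched u v) simp
  show "mdp.opt_avg m n u - mdp.opt_avg m n v \<le> wasserstein X u v"
  proof (rule field_le_epsilon)
    fix \<epsilon> :: real assume "\<epsilon> > 0"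
    thus "mdp.opt_avg m n u - mdp.opt_avg m n v \<le> wasserstein X u v + \<epsilon>"
      using mdp.matched_opt_avg[OF *[OF \<open>\<epsilon> > 0\<close>] _ v, of m n] W by simp
  qed
  show "mdp.opt_min_avg m n u - mdp.opt_min_avg m n v \<le> wasserstein X u v"
  proof (rule field_le_epsilon)
    fix \<epsilon> :: real assume "\<epsilon> > 0"
    thus "mdp.opt_min_avg m n u - mdp.opt_min_avg m n v \<le> wasserstein X u v + \<epsilon>"
      using mdp.matched_opt_min_avg[OF *[OF \<open>\<epsilon> > 0\<close>] _ v n, of m] W by simp
  qed
qed

end

lemma wasserstein_commute: "wasserstein X u v = wasserstein X v u"
  by (simp add: wasserstein_def abs_minus_commute)

theorem theorem2p16:
  fixes X :: "'x::real_normed_vector set"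
    and A :: "'a::topological_real_vector set"
    and B :: "'b::topological_real_vector set"
    and g :: "'x \<Rightarrow> 'a \<Rightarrow> 'b \<Rightarrow> real"
    and l :: "'x \<Rightarrow> 'a \<Rightarrow> 'b \<Rightarrow> 'x pmf"
  assumes nonempty: "X \<noteq> {}" "A \<noteq> {}" "B \<noteq> {}"
    and g_range: "\<forall>p\<in>X. \<forall>a\<in>A. \<forall>b\<in>B. g p a b \<in> {0..1}"
    and l_range: "\<forall>p\<in>X. \<forall>a\<in>A. \<forall>b\<in>B. l p a b \<in> Delta_f X"
    and H1: "\<forall>p\<in>X. \<forall>a\<in>A. \<forall>b\<in>B. \<forall>b'\<in>B. l p a b = l p a b'"
    and H2: "compact X" "convex X"
    and H3: "compact A" "convex A" "compact B" "convex B"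
    and H4_g1: "\<forall>p\<in>X. \<forall>b\<in>B. concave_on A (\<lambda>a. g p a b) \<and> usc_on A (\<lambda>a. g p a b)"
    and H4_g2: "\<forall>p\<in>X. \<forall>a\<in>A. convex_on B (\<lambda>b. g p a b) \<and> lsc_on B (\<lambda>b. g p a b)"
    and H5: "\<exists>D \<subseteq> E1 X. Phi A B g l 1 (\<lambda>_. 0) \<in> D \<and>
               (\<forall>f\<in>D. \<forall>\<alpha>\<in>{0..1}. Phi A B g l \<alpha> f \<in> D)"
    and H6_cont: "\<forall>p\<in>X. \<forall>b\<in>B.
               continuous_map (top_of_set A) (weak_star X) (\<lambda>a. l p a b)"
    and H6_concave: "\<forall>p\<in>X. \<forall>b\<in>B. \<forall>a\<in>A. \<forall>a'\<in>A. \<forall>r\<in>{0..1}.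
               dominates X (l p (r *\<^sub>R a + (1 - r) *\<^sub>R a') b)
                 (bind_pmf (bernoulli_pmf r) (\<lambda>c. if c then l p a b else l p a' b))"
      \<comment> \<open>a convex combination is indexed by a probability \<open>w\<close> on \<open>{1..S}\<close>, so that the
          mixture of the transitions is a \<^const>\<open>bind_pmf\<close>\<close>
    and H7: "\<forall>(S::nat) (w :: nat pmf) ps as.
               set_pmf w \<subseteq> {1..S} \<and> (\<forall>s\<in>{1..S}. ps s \<in> X \<and> as s \<in> A) \<longrightarrow>
               (\<exists>a\<in>A.
                 (\<forall>b\<in>B. dominates X (l (\<Sum>s=1..S. pmf w s *\<^sub>R ps s) a b)
                                  (bind_pmf w (\<lambda>s. l (ps s) (as s) b))) \<and>
                 (INF b\<in>B. g (\<Sum>s=1..S. pmf w s *\<^sub>R ps s) a b)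
                   \<ge> (\<Sum>s=1..S. pmf w s * (INF b\<in>B. g (ps s) (as s) b)))"
  shows "\<exists>vstar :: 'x pmf \<Rightarrow> real.
    (\<forall>u\<in>Delta_f X.
       is_uniform_value X A B g l u (vstar u) \<and>
       (\<forall>\<epsilon>>0. \<exists>\<sigma>\<in>Sigma1M X A B. \<exists>\<tau>\<in>Tau2M X A B. \<exists>N0\<ge>1. \<forall>N\<ge>N0.
          \<forall>\<sigma>'\<in>Sigma1 X A B. \<forall>\<tau>'\<in>Tau2 X A B.
            payoff g l u 0 N \<sigma> \<tau>' \<ge> vstar u - \<epsilon> \<and> payoff g l u 0 N \<sigma>' \<tau> \<le> vstar u + \<epsilon>) \<and>
       (\<forall>m. \<forall>n\<ge>1. v_tilde X A B g l m n u =
          (INF \<tau>\<in>Tau2 X A B. SUP \<sigma>\<in>Sigma1 X A B. payoff g l u m n \<sigma> \<tau>)) \<and>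
       vstar u = (INF n\<in>{1..}. SUP m. v_tilde X A B g l m n u) \<and>
       vstar u = (SUP m. INF n\<in>{1..}. v_tilde X A B g l m n u) \<and>
       vstar u = (INF n\<in>{1..}. SUP m. w_val X A B g l m n u) \<and>
       vstar u = (SUP m. INF n\<in>{1..}. w_val X A B g l m n u)) \<and>
    (\<forall>m. \<forall>n\<ge>1. \<forall>u\<in>Delta_f X. \<forall>v\<in>Delta_f X.
       \<bar>v_tilde X A B g l m n u - v_tilde X A B g l m n v\<bar> \<le> wasserstein X u v \<and>
       \<bar>w_val X A B g l m n u - w_val X A B g l m n v\<bar> \<le> wasserstein X u v) \<and>
    uniform_limit X (\<lambda>n p. v_tilde X A B g l 0 n (return_pmf p))
      (\<lambda>p. vstar (return_pmf p)) sequentially"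
proof -
  interpret controlled_game X A B g l
  proof (rule controlled_game.intro)
    show "X \<noteq> {}" "A \<noteq> {}" "B \<noteq> {}" by (fact nonempty)+
    show "compact X" "convex X" by (fact H2)+
    show "compact A" "convex A" by (fact H3)+
    show "\<exists>D \<subseteq> E1 X. Phi A B g l 1 (\<lambda>_. 0) \<in> D \<and> (\<forall>f\<in>D. \<forall>\<alpha>\<in>{0..1}. Phi A B g l \<alpha> f \<in> D)"
      by (fact H5)
  next
    fix p a b assume "p \<in> X" "a \<in> A" "b \<in> B"
    thus "0 \<le> g p a b \<and> g p a b \<le> 1" "l p a b \<in> Delta_f X" using g_range l_range by auto
  next
    fix p a b b' assume "p \<in> X" "a \<in> A" "b \<in> B" "b' \<in> B"
    thus "l p a b = l p a b'" using H1 by blast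
  next
    fix p b assume "p \<in> X" "b \<in> B"
    thus "concave_on A (\<lambda>a. g p a b)" "usc_on A (\<lambda>a. g p a b)"
      "continuous_map (top_of_set A) (weak_star X) (\<lambda>a. l p a b)"
      using H4_g1 H6_cont by auto
  next
    fix p a assume "p \<in> X" "a \<in> A"
    thus "convex_on B (\<lambda>b. g p a b)" using H4_g2 by auto
  next
    fix p b a a' and r :: real
    assume "p \<in> X" "b \<in> B" "a \<in> A" "a' \<in> A" "0 \<le> r" "r \<le> 1"
    thus "dominates X (l p (r *\<^sub>R a + (1 - r) *\<^sub>R a') b)
        (bind_pmf (bernoulli_pmf r) (\<lambda>c. if c then l p a b else l p a' b))"
      using H6_concave by simp
  next
    fix w :: "nat pmf" and ps as and n :: nat
    assume "set_pmf w \<subseteq> {1..n}" "\<forall>s\<in>{1..n}. ps s \<in> X \<and> as s \<in> A"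
    thus "\<exists>a\<in>A. (\<forall>b\<in>B. dominates X (l (\<Sum>s=1..n. pmf w s *\<^sub>R ps s) a b)
            (bind_pmf w (\<lambda>s. l (ps s) (as s) b))) \<and>
        (INF b\<in>B. g (\<Sum>s=1..n. pmf w s *\<^sub>R ps s) a b)
          \<ge> (\<Sum>s=1..n. pmf w s * (INF b\<in>B. g (ps s) (as s) b))"
      using H7[rule_format, of w n ps as] by blast
  qed
  show ?thesis
  proof (intro exI[of _ mdp.limit_value] conjI ballI allI impI)
    fix u assume u: "u \<in> Delta_f X"
    show "is_uniform_value X A B g l u (mdp.limit_value u)" by (rule uniform_value[OF u])
    show "v_tilde X A B g l m n u = (INF \<tau>\<in>S2. SUP \<sigma>\<in>S1. payoff g l u m n \<sigma> \<tau>)" if "1 \<le> n" for m n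
      using v_tilde_eq[OF u that] by simp
    have v: "(INF n\<in>{1..}. v_tilde X A B g l m n u) = (INF n\<in>{1..}. mdp.opt_avg m n u)"
      and w: "(INF n\<in>{1..}. w_val X A B g l m n u) = (INF n\<in>{1..}. mdp.opt_min_avg m n u)" for m
      by (rule INF_cong; simp add: v_tilde_eq[OF u] w_val_eq[OF u])+
    show "mdp.limit_value u = (INF n\<in>{1..}. SUP m. v_tilde X A B g l m n u)"
      unfolding mdp.limit_value_def by (rule INF_cong) (simp_all add: v_tilde_eq[OF u])
    show "mdp.limit_value u = (SUP m. INF n\<in>{1..}. v_tilde X A B g l m n u)"
      unfolding v by (rule mdp.limit_value_formulas[OF u])
    show "mdp.limit_value u = (INF n\<in>{1..}. SUP m. w_val X A B g l m n u)"
      unfolding mdp.limit_value_formulas(2)[OF u] by (rule INF_cong) (simp_all add: w_val_eq[OF u])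
    show "mdp.limit_value u = (SUP m. INF n\<in>{1..}. w_val X A B g l m n u)"
      unfolding w by (rule mdp.limit_value_formulas[OF u])
    fix \<epsilon> :: real assume e: "0 < \<epsilon>"
    obtain \<sigma> N1 where \<sigma>: "\<sigma> \<in> Sigma1M X A B" "1 \<le> N1"
      "\<And>N \<tau>'. N \<ge> N1 \<Longrightarrow> \<tau>' \<in> S2 \<Longrightarrow> payoff g l u 0 N \<sigma> \<tau>' \<ge> mdp.limit_value u - \<epsilon>"
      using markov_guarantee_1[OF u e] by blast
    obtain \<tau> N2 where \<tau>: "\<tau> \<in> Tau2M X A B" "1 \<le> N2"
      "\<And>N \<sigma>'. N \<ge> N2 \<Longrightarrow> \<sigma>' \<in> S1 \<Longrightarrow> payoff g l u 0 N \<sigma>' \<tau> \<le> mdp.limit_value u + \<epsilon>"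
      using markov_guarantee_2[OF u e] by blast
    show "\<exists>\<sigma>\<in>Sigma1M X A B. \<exists>\<tau>\<in>Tau2M X A B. \<exists>N0\<ge>1. \<forall>N\<ge>N0. \<forall>\<sigma>'\<in>S1. \<forall>\<tau>'\<in>S2.
        payoff g l u 0 N \<sigma> \<tau>' \<ge> mdp.limit_value u - \<epsilon> \<and> payoff g l u 0 N \<sigma>' \<tau> \<le> mdp.limit_value u + \<epsilon>"
      using \<sigma> \<tau> by (intro bexI[of _ \<sigma>] bexI[of _ \<tau>] exI[of _ "max N1 N2"]) auto
  next
    fix m n :: nat and u v assume n: "1 \<le> n" and u: "u \<in> Delta_f X" and v: "v \<in> Delta_f X"
    show "\<bar>v_tilde X A B g l m n u - v_tilde X A B g l m n v\<bar> \<le> wasserstein X u v"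
      using values_nonexpansive(1)[OF u v n, of m] values_nonexpansive(1)[OF v u n, of m]
      by (simp add: v_tilde_eq(1)[OF u n] v_tilde_eq(1)[OF v n] wasserstein_commute[of X v u] abs_le_iff)
    show "\<bar>w_val X A B g l m n u - w_val X A B g l m n v\<bar> \<le> wasserstein X u v"
      using values_nonexpansive(2)[OF u v n, of m] values_nonexpansive(2)[OF v u n, of m]
      by (simp add: w_val_eq[OF u n] w_val_eq[OF v n] wasserstein_commute[of X v u] abs_le_iff)
  next
    show "uniform_limit X (\<lambda>n p. v_tilde X A B g l 0 n (return_pmf p))
        (\<lambda>p. mdp.limit_value (return_pmf p)) sequentially"
    proof (rule uniform_limitI)
      fix \<epsilon> :: real assume "\<epsilon> > 0"
      have d: "return_pmf p \<in> Delta_f X" if "p \<in> X" for p using that by (simp add: Delta_f_def)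
      have "\<forall>\<^sub>F n in sequentially. n \<ge> 1 \<and> (\<forall>u\<in>Delta_f X. dist (mdp.opt_avg 0 n u) (mdp.limit_value u) < \<epsilon>)"
        using uniform_limitD[OF mdp.opt_avg_uniform_limit \<open>\<epsilon> > 0\<close>] eventually_ge_at_top[of 1]
        by (simp add: eventually_conj_iff)
      thus "\<forall>\<^sub>F n in sequentially. \<forall>p\<in>X. dist (v_tilde X A B g l 0 n (return_pmf p)) (mdp.limit_value (return_pmf p)) < \<epsilon>"
        by (rule eventually_mono) (use d in \<open>auto simp: v_tilde_eq\<close>)
    qed
  qed
qed

end
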